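(* Let $\mathcal P(u)=\big(\frac{P_1(u)}{Q_1(u)},\frac{P_2(u)}{Q_2(u)}\big)$ be a linear differential rational parametrization with $m_i=\mathrm{ord}\big(\frac{P_i(u)}{Q_i(u)}\big)\ge0$ for $i=1,2$. Then $\mathcal P(u)$ is proper if and only if $$R:=\delta\text{-}\mathrm{Res}_u\big(xQ_1(u)-P_1(u),\,yQ_2(u)-P_2(u)\big)\neq0,\qquad \mathrm{ord}_xR=\mathrm{ord}\Big(\frac{P_2}{Q_2}\Big)\quad\text{and}\quad \mathrm{ord}_yR=\mathrm{ord}\Big(\frac{P_1}{Q_1}\Big).$$
   Context: $\mathcal F$ is an ordinary differential field of characteristic $0$ with derivation $\delta$, and $\mathcal E$ is a fixed universal differential extension field of $\mathcal F$; $x,y$ are differential indeterminates over $\mathcal E$, and $u\in\mathcal E$ is differentially transcendental over $\mathcal F$. $\mathcal F\{S\}$ and $\mathcal F\langle S\rangle$ denote the differential ring and differential field generated by $S$ over $\mathcal F$; $w^{(k)}=\delta^k(w)$. Orders: for a differential polynomial $f$ and an indeterminate $w$, $\mathrm{ord}_w f$ is the largest $k$ such that $w^{(k)}$ effectively appears in $f$, and $-\infty$ if no derivative of $w$ (including $w$) appears. For $R(u)=P/Q\in\mathcal F\langle u\rangle$ in reduced form ($\gcd(P,Q)=1$), $\mathrm{ord}(R)=\max\{\mathrm{ord}_uP,\mathrm{ord}_uQ\}$. A linear differential rational parametrization is a pair $\mathcal P(u)=\big(\frac{P_1(u)}{Q_1(u)},\frac{P_2(u)}{Q_2(u)}\big)\in\mathcal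 F\langle u\rangle^2\setminus\mathcal F^2$ such that, for $i=1,2$, $P_i,Q_i\in\mathcal F\{u\}$ have degree at most $1$ and $\gcd(P_i,Q_i)=1$. It is proper if $\mathcal F\langle \frac{P_1(u)}{Q_1(u)},\frac{P_2(u)}{Q_2(u)}\rangle=\mathcal F\langle u\rangle$. Differential resultant: let $f_1,f_2\in\mathbb D\{u\}$ be linear differential polynomials (degree $1$ in $u$ and its derivatives, possibly with a constant term) of orders $m_1,m_2$ in $u$ over a differential domain $\mathbb D$ (here $\mathbb D=\mathcal F\{x,y\}$). Let $M$ be the $(m_1+m_2+2)\times(m_1+m_2+2)$ matrix whose $k$-th row is the coefficient vector of the $k$-th element of the list $f_1^{(m_2)},f_1^{(m_2-1)},\dots,f_1,f_2^{(m_1)},f_2^{(m_1-1)},\dots,f_2$ with respect to $u^{(m_1+m_2)}>u^{(m_1+m_2-1)}>\cdots>u>1$. Then $\delta\text{-}\mathrm{Res}_u(f_1,f_2):=\det(M)$. *)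

theory Defs
  imports
    "HOL-Library.Extended_Real"
    "HOL-Algebra.Subrings"
    "Jordan_Normal_Form.Determinant"
    "HOL-Library.Poly_Mapping"
begin

section \<open>Differential fields\<close>

definition derivation :: "('a::comm_ring \<Rightarrow> 'a) \<Rightarrow> bool" where
  "derivation d \<longleftrightarrow> (\<forall>a b. d (a + b) = d a + d b) \<and> (\<forall>a b. d (a * b) = d a * b + a * d b)"

text \<open>
  The base field and the ambient field are types, but the differential fields generated inside the
  ambient field, and the abstract extensions quantified over in the definition of a universal
  extension, need carrier sets; these use the ring records.
\<close>

definition ring_of :: "'a::comm_ring_1 set \<Rightarrow> 'a ring" where
  "ring_of K = \<lparr>carrier = K, monoid.mult = (*), one = 1, zero = 0, add = (+)\<rparr>"

definition diff_field :: "'a ring \<Rightarrow> ('a \<Rightarrow> 'a) \<Rightarrow> bool" where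
  "diff_field G D \<longleftrightarrow> field G \<and> D \<in> carrier G \<rightarrow> carrier G \<and>
     (\<forall>a\<in>carrier G. \<forall>b\<in>carrier G. D (a \<oplus>\<^bsub>G\<^esub> b) = D a \<oplus>\<^bsub>G\<^esub> D b) \<and>
     (\<forall>a\<in>carrier G. \<forall>b\<in>carrier G. D (a \<otimes>\<^bsub>G\<^esub> b) = (D a \<otimes>\<^bsub>G\<^esub> b) \<oplus>\<^bsub>G\<^esub> (a \<otimes>\<^bsub>G\<^esub> D b))"

definition diff_subfield :: "'a ring \<Rightarrow> ('a \<Rightarrow> 'a) \<Rightarrow> 'a set \<Rightarrow> bool" where
  "diff_subfield G D K \<longleftrightarrow> subfield K G \<and> D ` K \<subseteq> K"

definition dfield_gen :: "'a ring \<Rightarrow> ('a \<Rightarrow> 'a) \<Rightarrow> 'a set \<Rightarrow> 'a set" where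
  "dfield_gen G D A = diff_subfield G D hull A"

definition diff_hom :: "'a ring \<Rightarrow> ('a \<Rightarrow> 'a) \<Rightarrow> 'b ring \<Rightarrow> ('b \<Rightarrow> 'b) \<Rightarrow> ('a \<Rightarrow> 'b) set" where
  "diff_hom G D H D' = {h \<in> Ring.ring_hom G H. \<forall>a\<in>carrier G. h (D a) = D' (h a)}"

text \<open>
  Kolchin's notion: an extension of \<open>K\<close> is semiuniversal over \<open>K\<close> if every finitely generated
  differential field extension of \<open>K\<close> embeds into it over \<open>K\<close>. Here \<open>K\<close> is a differential subfield
  of the differential field \<open>('e, dE)\<close>, and an extension of \<open>K\<close> is a differential field \<open>(G, D)\<close>
  together with a homomorphism \<open>i\<close> from \<open>K\<close>. In characteristic \<open>0\<close>, the field \<open>K\<close> is infinite, so a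
  finitely generated extension of \<open>K\<close> has the cardinality of \<open>K\<close>; hence letting \<open>G\<close> range over the
  differential fields with carrier in \<open>'e\<close> captures all of them up to isomorphism.
\<close>

definition semiuniversal :: "('e::field_char_0 \<Rightarrow> 'e) \<Rightarrow> 'e set \<Rightarrow> bool" where
  "semiuniversal dE K \<longleftrightarrow>
     (\<forall>(G :: 'e ring) D i T.
        diff_field G D \<and> i \<in> diff_hom (ring_of K) dE G D \<and>
        finite T \<and> T \<subseteq> carrier G \<and> dfield_gen G D (i ` K \<union> T) = carrier G \<longrightarrow>
        (\<exists>j \<in> diff_hom G D (ring_of UNIV) dE. \<forall>a\<in>K. j (i a) = a))"

text \<open>\<open>adjoin \<iota> dE S\<close> is $\mathcal{F}\langle S\rangle$, where $\mathcal{F}$ is embedded by \<open>\<iota>\<close>.\<close>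

definition adjoin :: "('f::field_char_0 \<Rightarrow> 'e::field_char_0) \<Rightarrow> ('e \<Rightarrow> 'e) \<Rightarrow> 'e set \<Rightarrow> 'e set" where
  "adjoin \<iota> dE S = dfield_gen (ring_of UNIV) dE (range \<iota> \<union> S)"

definition universal_extension ::
  "('f::field_char_0 \<Rightarrow> 'f) \<Rightarrow> ('e::field_char_0 \<Rightarrow> 'e) \<Rightarrow> ('f \<Rightarrow> 'e) \<Rightarrow> bool" where
  "universal_extension d dE \<iota> \<longleftrightarrow>
     derivation d \<and> derivation dE \<and> \<iota> \<in> diff_hom (ring_of UNIV) d (ring_of UNIV) dE \<and>
     (\<forall>S. finite S \<longrightarrow> semiuniversal dE (adjoin \<iota> dE S))"

section \<open>Differential polynomials\<close>

text \<open>
  The pair \<open>(w, k)\<close> stands for the derivative $w^{(k)}$ of the indeterminate \<open>w\<close>. A differential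
  polynomial is a polynomial in these, i.e. a finitely supported function from monomials
  (finitely supported exponent functions) to coefficients, with the convolution product.
\<close>

type_synonym ('w, 'r) dpoly = "(('w \<times> nat) \<Rightarrow>\<^sub>0 nat) \<Rightarrow>\<^sub>0 'r"

text \<open>One indeterminate, named \<open>()\<close>.\<close>
type_synonym 'r udpoly = "(unit, 'r) dpoly"

datatype indet = Ix | Iy

type_synonym 'r xydpoly = "(indet, 'r) dpoly"

definition dconst :: "'r::comm_ring_1 \<Rightarrow> ('w, 'r) dpoly" where
  "dconst c = Poly_Mapping.single 0 c"

definition dmon :: "'w \<Rightarrow> nat \<Rightarrow> ('w \<times> nat) \<Rightarrow>\<^sub>0 nat" where
  "dmon w k = Poly_Mapping.single (w, k) 1"

definition dvar :: "'w \<Rightarrow> nat \<Rightarrow> ('w, 'r::comm_ring_1) dpoly" where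
  "dvar w k = Poly_Mapping.single (dmon w k) 1"

text \<open>
  The derivation of the ring of differential polynomials that extends the derivation \<open>d\<close> of the
  coefficient ring and maps $w^{(k)}$ to $w^{(k+1)}$: a term $c\,m$ is mapped to
  $d(c)\,m + \sum_{w,k} c\,\frac{\partial m}{\partial w^{(k)}}\,w^{(k+1)}$.
\<close>

definition dpoly_deriv :: "('r::comm_ring_1 \<Rightarrow> 'r) \<Rightarrow> ('w, 'r) dpoly \<Rightarrow> ('w, 'r) dpoly" where
  "dpoly_deriv d p =
     (\<Sum>m\<in>Poly_Mapping.keys p. Poly_Mapping.single m (d (Poly_Mapping.lookup p m)) +
        (\<Sum>(w, k)\<in>Poly_Mapping.keys m.
           Poly_Mapping.single (m - dmon w k + dmon w (Suc k)) (of_nat (Poly_Mapping.lookup m (w, k)) * Poly_Mapping.lookup p m)))"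

definition dpoly_eval ::
  "('r::comm_ring_1 \<Rightarrow> 'e::comm_ring_1) \<Rightarrow> ('e \<Rightarrow> 'e) \<Rightarrow> ('w \<Rightarrow> 'e) \<Rightarrow> ('w, 'r) dpoly \<Rightarrow> 'e" where
  "dpoly_eval \<iota> dE a p =
     (\<Sum>m\<in>Poly_Mapping.keys p. \<iota> (Poly_Mapping.lookup p m) * (\<Prod>(w, k)\<in>Poly_Mapping.keys m. (dE ^^ k) (a w) ^ Poly_Mapping.lookup m (w, k)))"

definition total_degree :: "('w, 'r::comm_ring_1) dpoly \<Rightarrow> nat" where
  "total_degree p = Max (insert 0 ((\<lambda>m. \<Sum>v\<in>Poly_Mapping.keys m. Poly_Mapping.lookup m v) ` Poly_Mapping.keys p))"

definition appearing :: "'w \<Rightarrow> ('w, 'r::comm_ring_1) dpoly \<Rightarrow> nat set" where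
  "appearing w p = {k. \<exists>m\<in>Poly_Mapping.keys p. (w, k) \<in> Poly_Mapping.keys m}"

definition dord :: "'w \<Rightarrow> ('w, 'r::comm_ring_1) dpoly \<Rightarrow> ereal" where
  "dord w p = (if appearing w p = {} then -\<infinity> else ereal (real (Max (appearing w p))))"

text \<open>
  \<open>gcd(P, Q) = 1\<close>; the class of the library constant \<open>coprime\<close> does not cover polynomial mappings.
\<close>

definition dcoprime :: "('w, 'r::comm_ring_1) dpoly \<Rightarrow> ('w, 'r) dpoly \<Rightarrow> bool" where
  "dcoprime P Q \<longleftrightarrow> (\<forall>g. g dvd P \<and> g dvd Q \<longrightarrow> g dvd 1)"

text \<open>The order of the differential rational function \<open>P/Q\<close>, given in reduced form.\<close>

definition rat_ord :: "'r::comm_ring_1 udpoly \<Rightarrow> 'r udpoly \<Rightarrow> ereal" where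
  "rat_ord P Q = max (dord () P) (dord () Q)"

section \<open>Differential resultant of two linear differential polynomials\<close>

text \<open>The coefficient vector of \<open>f\<close> with respect to $u^{(N)} > \dots > u^{(1)} > u > 1$.\<close>

definition coeff_row :: "nat \<Rightarrow> 'r::comm_ring_1 udpoly \<Rightarrow> 'r list" where
  "coeff_row N f = map (\<lambda>k. Poly_Mapping.lookup f (dmon () k)) (rev [0..<Suc N]) @ [Poly_Mapping.lookup f 0]"

text \<open>
  The argument \<open>d\<close> is the derivation of the coefficient domain; the orders of \<open>f\<close> and \<open>g\<close> are
  meant to be nonnegative.
\<close>

definition dres :: "('r::comm_ring_1 \<Rightarrow> 'r) \<Rightarrow> 'r udpoly \<Rightarrow> 'r udpoly \<Rightarrow> 'r" where
  "dres d f g =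
     (let m1 = Max (appearing () f);
          m2 = Max (appearing () g);
          rows = map (\<lambda>k. (dpoly_deriv d ^^ k) f) (rev [0..<Suc m2]) @
                 map (\<lambda>k. (dpoly_deriv d ^^ k) g) (rev [0..<Suc m1])
      in det (mat_of_rows_list (m1 + m2 + 2) (map (coeff_row (m1 + m2)) rows)))"

section \<open>Linear differential rational parametrizations\<close>

definition diff_transcendental ::
  "('f::field_char_0 \<Rightarrow> 'e::field_char_0) \<Rightarrow> ('e \<Rightarrow> 'e) \<Rightarrow> 'e \<Rightarrow> bool" where
  "diff_transcendental \<iota> dE u \<longleftrightarrow>
     (\<forall>p :: 'f udpoly. p \<noteq> 0 \<longrightarrow> dpoly_eval \<iota> dE (\<lambda>_. u) p \<noteq> 0)"

text \<open>
  As \<open>u\<close> is differentially transcendental, the elements of $\mathcal{F}\{u\}$ are the values at \<open>u\<close>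
  of unique differential polynomials in one indeterminate over $\mathcal{F}$.
\<close>

definition rat_val ::
  "('f::field_char_0 \<Rightarrow> 'e::field_char_0) \<Rightarrow> ('e \<Rightarrow> 'e) \<Rightarrow> 'e \<Rightarrow> 'f udpoly \<Rightarrow> 'f udpoly \<Rightarrow> 'e" where
  "rat_val \<iota> dE u P Q = dpoly_eval \<iota> dE (\<lambda>_. u) P / dpoly_eval \<iota> dE (\<lambda>_. u) Q"

definition linear_param ::
  "('f::field_char_0 \<Rightarrow> 'e::field_char_0) \<Rightarrow> ('e \<Rightarrow> 'e) \<Rightarrow> 'e \<Rightarrow>
   'f udpoly \<Rightarrow> 'f udpoly \<Rightarrow> 'f udpoly \<Rightarrow> 'f udpoly \<Rightarrow> bool" where
  "linear_param \<iota> dE u P1 Q1 P2 Q2 \<longleftrightarrow>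
     Q1 \<noteq> 0 \<and> Q2 \<noteq> 0 \<and>
     total_degree P1 \<le> 1 \<and> total_degree Q1 \<le> 1 \<and> dcoprime P1 Q1 \<and>
     total_degree P2 \<le> 1 \<and> total_degree Q2 \<le> 1 \<and> dcoprime P2 Q2 \<and>
     (rat_val \<iota> dE u P1 Q1, rat_val \<iota> dE u P2 Q2) \<notin> range \<iota> \<times> range \<iota>"

definition proper_param ::
  "('f::field_char_0 \<Rightarrow> 'e::field_char_0) \<Rightarrow> ('e \<Rightarrow> 'e) \<Rightarrow> 'e \<Rightarrow>
   'f udpoly \<Rightarrow> 'f udpoly \<Rightarrow> 'f udpoly \<Rightarrow> 'f udpoly \<Rightarrow> bool" where
  "proper_param \<iota> dE u P1 Q1 P2 Q2 \<longleftrightarrow>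
     adjoin \<iota> dE {rat_val \<iota> dE u P1 Q1, rat_val \<iota> dE u P2 Q2} = adjoin \<iota> dE {u}"

text \<open>
  The linear differential polynomial \<open>w Q(u) - P(u)\<close> in \<open>u\<close>, where \<open>w\<close> is \<open>x\<close> or \<open>y\<close>, with
  coefficients in $\mathcal{F}\{x,y\}$.
\<close>

definition implicit_poly :: "indet \<Rightarrow> 'f::field_char_0 udpoly \<Rightarrow> 'f udpoly \<Rightarrow> 'f xydpoly udpoly" where
  "implicit_poly w P Q =
     dconst (dvar w 0) * Poly_Mapping.map dconst Q - Poly_Mapping.map dconst P"

end

theory Submission
  imports Defs
begin

text \<open>
  Write $P_i = p_i(u) + a_i$ and $Q_i = q_i(u) + b_i$ with linear differential operators $p_i, q_i$
  over $\mathcal{F}$, let $x_0, y_0$ be the two components of the parametrization, and put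
  $K = \mathcal{F}\langle x_0, y_0\rangle$. The operators $l_1 = x_0 q_1 - p_1$ and
  $l_2 = y_0 q_2 - p_2$ have coefficients in $K$ and orders $m_1$ and $m_2$, and up to the factors
  $-Q_i(u)$ they are the differentials of $x_0$ and $y_0$ as functions of $u$. Everything is decided
  by the left ideal $J$ that $l_1$ and $l_2$ generate in the skew polynomial ring
  $\mathcal{E}[\delta]$.

  Properness means $1 \in J$. The differential
  $a \mapsto \sum_k \frac{\partial a}{\partial u^{(k)}} \delta^k$ is a derivation of
  $\mathcal{F}\langle u\rangle$ into $\mathcal{E}[\delta]$ that commutes with $\delta$. Hence the
  elements with differential in $J$ form a differential field, which contains $K$; as $u$ has
  differential $1$, properness gives $1 \in J$ (\<open>u_in_K_imp_unit\<close>). Conversely, the monic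
  generator of $J$ has coefficients in $K$, so $1 \in J$ gives $1 = A l_1 + B l_2$ with $A, B$ over
  $K$, and as $l_1(u), l_2(u) \in K$, applying both sides to $u$ shows $u \in K$
  (\<open>unit_imp_u_in_K\<close>).

  The conditions on the resultant $R$ are about two other determinants. The derivative $x^{(m_2)}$
  occurs only in the first row of the matrix, where its coefficient is the row of $Q_1$; likewise
  $y^{(m_1)}$ occurs only in the first row of the second block. So $R$ has the orders $m_2$ and
  $m_1$ exactly if the two determinants \<open>Sx\<close> and \<open>Sy\<close>, in which that row is replaced by the
  row of $Q_1$ respectively $Q_2$, do not vanish (\<open>orders_R\<close>).

  If $1 \in J$, evaluate \<open>Sx\<close> and \<open>Sy\<close> at $(x_0, y_0)$. All rows except that of $Q_i$ vanish on
  the jet of $u$, so a linear relation between the rows cannot involve the row of $Q_i$; it becomes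
  a relation $A l_1 + B l_2 = 0$ with $\deg A < m_2$ or $\deg B < m_1$, and such a relation is trivial
  if $l_1, l_2$ have no common right factor (\<open>syzygy_degree\<close>, \<open>replaced_det_nonzero\<close>).

  If $1 \notin J$, let $G$ be the monic generator of $J$, of order $g \ge 1$, and $l_1 = A G$,
  $l_2 = B G$. Differentiating these identities with respect to $u^{(k)}$, modulo $J$, for the two
  largest relevant $k$ shows (\<open>dichotomy\<close>): the operator $\tau = \partial G / \partial u^{(g)}$ is
  congruent to $-q_1/Q_1(u)$ and to $-q_2/Q_2(u)$ modulo $J$, and if $A$ or $B$ has positive order,
  then also $\delta\tau \in J$; here characteristic $0$ enters. In that case all derivatives of the
  affine operators $P_i, Q_i$ lie in the space spanned by $\theta(v) = \tau(v - u) - 1$ and the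
  $h(v - u)$ with $h \in J$. In orders up to $m_1 + m_2$ this space is proper, so some nonzero
  vector is orthogonal to it; a linear functional $\mathcal{E} \to \mathcal{F}$ turns it into a
  vector over $\mathcal{F}$, which is in the kernel of the matrix of \<open>Sy\<close>. If $A$ and $B$ both have
  order $0$, then $l_1, l_2$ are proportional, and $P_2, Q_2$ are combinations of $P_1, Q_1$ over
  $\mathcal{F}$. Then three rows of the matrix of \<open>Sy\<close> lie in the span of two vectors. In both cases
  \<open>Sy\<close> vanishes.
\<close>

section \<open>Derivations and finitely supported functions\<close>

lemma derivationD:
  assumes "derivation d"
  shows "d (a + b) = d a + d b" "d (a * b) = d a * b + a * d b"
  using assms unfolding derivation_def by blast+

lemma derivation_zero: "derivation d \<Longrightarrow> d 0 = 0"
  using derivationD(1)[of d 0 0] by simp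

lemma derivation_diff: "derivation d \<Longrightarrow> d (a - b) = d a - d b"
  using derivationD(1)[of d "a - b" b] by (simp add: algebra_simps)

lemma derivation_sum: "derivation d \<Longrightarrow> d (sum f A) = (\<Sum>x\<in>A. d (f x))"
  by (induction A rule: infinite_finite_induct) (auto simp: derivation_zero derivationD)

lemma derivation_one: "derivation (d :: 'a::comm_ring_1 \<Rightarrow> 'a) \<Longrightarrow> d 1 = 0"
  using derivationD(2)[of d 1 1] by simp

lemma derivation_of_nat: "derivation (d :: 'a::comm_ring_1 \<Rightarrow> 'a) \<Longrightarrow> d (of_nat n) = 0"
  by (induction n) (auto simp: derivation_zero derivation_one derivationD)

lemma derivation_funpow_add: "derivation d \<Longrightarrow> (d ^^ n) (a + b) = (d ^^ n) a + (d ^^ n) b"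
  by (induction n) (auto simp: derivationD)

lemma derivation_funpow_diff: "derivation d \<Longrightarrow> (d ^^ n) (a - b) = (d ^^ n) a - (d ^^ n) b"
  by (induction n) (auto simp: derivation_diff)

lemma sum_keys_superset:
  assumes "finite S" "Poly_Mapping.keys p \<subseteq> S" "\<And>m. \<phi> m 0 = 0"
  shows "(\<Sum>m\<in>Poly_Mapping.keys p. \<phi> m (Poly_Mapping.lookup p m)) = (\<Sum>m\<in>S. \<phi> m (Poly_Mapping.lookup p m))"
  using assms by (intro sum.mono_neutral_left) (auto simp: in_keys_iff)

lemma sum_keys_add:
  fixes p q :: "'m \<Rightarrow>\<^sub>0 'r::comm_monoid_add"
  assumes z: "\<And>m. \<phi> m 0 = 0" and a: "\<And>m x y. \<phi> m (x + y) = \<phi> m x + \<phi> m y"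
  shows "(\<Sum>m\<in>Poly_Mapping.keys (p + q). \<phi> m (Poly_Mapping.lookup (p + q) m)) =
    (\<Sum>m\<in>Poly_Mapping.keys p. \<phi> m (Poly_Mapping.lookup p m)) +
    (\<Sum>m\<in>Poly_Mapping.keys q. \<phi> m (Poly_Mapping.lookup q m))"
proof -
  let ?S = "Poly_Mapping.keys p \<union> Poly_Mapping.keys q"
  have "(\<Sum>m\<in>Poly_Mapping.keys (p + q). \<phi> m (Poly_Mapping.lookup (p + q) m)) = (\<Sum>m\<in>?S. \<phi> m (Poly_Mapping.lookup (p + q) m))"
    by (rule sum_keys_superset) (auto simp: z keys_add)
  moreover have "(\<Sum>m\<in>Poly_Mapping.keys p. \<phi> m (Poly_Mapping.lookup p m)) = (\<Sum>m\<in>?S. \<phi> m (Poly_Mapping.lookup p m))"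
    "(\<Sum>m\<in>Poly_Mapping.keys q. \<phi> m (Poly_Mapping.lookup q m)) = (\<Sum>m\<in>?S. \<phi> m (Poly_Mapping.lookup q m))"
    by (rule sum_keys_superset; auto simp: z)+
  ultimately show ?thesis by (simp add: lookup_add a sum.distrib)
qed

lemma poly_mapping_sum_singles:
  "p = (\<Sum>m\<in>Poly_Mapping.keys p. Poly_Mapping.single m (Poly_Mapping.lookup p m))"
  by (rule poly_mapping_eqI) (auto simp: lookup_sum lookup_single when_def in_keys_iff)

lemma poly_mapping_single_induct [case_names zero add]:
  assumes "P 0" "\<And>m c p. P p \<Longrightarrow> P (Poly_Mapping.single m c + p)"
  shows "P (p :: 'm \<Rightarrow>\<^sub>0 'r::comm_monoid_add)"
proof -
  have "P (\<Sum>m\<in>S. Poly_Mapping.single m (Poly_Mapping.lookup p m))" if "finite S" for S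
    using that by (induction S) (auto intro: assms)
  then show ?thesis
    by (subst poly_mapping_sum_singles) simp
qed

section \<open>Evaluation of differential polynomials\<close>

definition mon_eval :: "('e::comm_ring_1 \<Rightarrow> 'e) \<Rightarrow> ('w \<Rightarrow> 'e) \<Rightarrow> (('w \<times> nat) \<Rightarrow>\<^sub>0 nat) \<Rightarrow> 'e" where
  "mon_eval dE a m = (\<Prod>(w, k)\<in>Poly_Mapping.keys m. (dE ^^ k) (a w) ^ Poly_Mapping.lookup m (w, k))"

lemma mon_eval_superset:
  assumes "finite S" "Poly_Mapping.keys m \<subseteq> S"
  shows "mon_eval dE a m = (\<Prod>(w, k)\<in>S. (dE ^^ k) (a w) ^ Poly_Mapping.lookup m (w, k))"
  unfolding mon_eval_def using assms by (intro prod.mono_neutral_left) (auto simp: in_keys_iff)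

lemma mon_eval_add: "mon_eval dE a (m + n) = mon_eval dE a m * mon_eval dE a n"
proof -
  let ?S = "Poly_Mapping.keys m \<union> Poly_Mapping.keys n"
  have "mon_eval dE a (m + n) = (\<Prod>(w, k)\<in>?S. (dE ^^ k) (a w) ^ Poly_Mapping.lookup (m + n) (w, k))"
    by (rule mon_eval_superset) (auto simp: keys_add)
  moreover have "mon_eval dE a m = (\<Prod>(w, k)\<in>?S. (dE ^^ k) (a w) ^ Poly_Mapping.lookup m (w, k))"
     "mon_eval dE a n = (\<Prod>(w, k)\<in>?S. (dE ^^ k) (a w) ^ Poly_Mapping.lookup n (w, k))"
    by (rule mon_eval_superset; simp)+
  ultimately show ?thesis
    by (simp add: lookup_add power_add prod.distrib case_prod_beta)
qed

lemma mon_eval_zero [simp]: "mon_eval dE a 0 = 1"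
  by (simp add: mon_eval_def)

lemma mon_eval_dmon [simp]: "mon_eval dE a (dmon w k) = (dE ^^ k) (a w)"
  by (simp add: mon_eval_def dmon_def)

definition is_hom :: "('a::comm_ring_1 \<Rightarrow> 'b::comm_ring_1) \<Rightarrow> bool" where
  "is_hom h \<longleftrightarrow> h 1 = 1 \<and> (\<forall>a b. h (a + b) = h a + h b) \<and> (\<forall>a b. h (a * b) = h a * h b)"

lemma is_homD:
  assumes "is_hom h"
  shows "h 1 = 1" "h (a + b) = h a + h b" "h (a * b) = h a * h b" "h 0 = 0" "h (- a) = - h a"
    "h (a - b) = h a - h b" "h (sum f A) = (\<Sum>x\<in>A. h (f x))" "h (prod f A) = (\<Prod>x\<in>A. h (f x))"
    "h (a ^ n) = h a ^ n" "h (of_nat n) = of_nat n"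
proof -
  show *: "h 1 = 1" and a: "h (a + b) = h a + h b" and m: "h (a * b) = h a * h b" for a b
    using assms by (auto simp: is_hom_def)
  show z: "h 0 = 0" using a[of 0 0] by simp
  show mi: "h (- a) = - h a" for a using a[of a "- a"] z by (simp add: minus_unique)
  show "h (a - b) = h a - h b" using a[of a "- b"] mi by simp
  show "h (sum f A) = (\<Sum>x\<in>A. h (f x))" by (induction A rule: infinite_finite_induct) (auto simp: z a)
  show "h (prod f A) = (\<Prod>x\<in>A. h (f x))" by (induction A rule: infinite_finite_induct) (auto simp: * m)
  show "h (a ^ n) = h a ^ n" by (induction n) (auto simp: * m)
  show "h (of_nat n) = of_nat n" by (induction n) (auto simp: * z a)
qed

lemma is_hom_compose: "is_hom f \<Longrightarrow> is_hom g \<Longrightarrow> is_hom (f \<circ> g)"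
  by (simp add: is_hom_def)

lemma dpoly_eval_mon:
  "dpoly_eval \<iota> dE a p = (\<Sum>m\<in>Poly_Mapping.keys p. \<iota> (Poly_Mapping.lookup p m) * mon_eval dE a m)"
  by (simp add: dpoly_eval_def mon_eval_def)

lemma dpoly_eval_single: "\<iota> 0 = 0 \<Longrightarrow> dpoly_eval \<iota> dE a (Poly_Mapping.single m c) = \<iota> c * mon_eval dE a m"
  by (simp add: dpoly_eval_mon)

lemma dpoly_eval_add:
  assumes "is_hom \<iota>" shows "dpoly_eval \<iota> dE a (p + q) = dpoly_eval \<iota> dE a p + dpoly_eval \<iota> dE a q"
  unfolding dpoly_eval_mon by (rule sum_keys_add) (auto simp: is_homD[OF assms] algebra_simps)

text \<open>
  By bilinearity it suffices to consider terms, where multiplicativity is that of \<open>mon_eval\<close>. The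
  function \<open>dE\<close> is arbitrary here, so arbitrary geometric sequences can be substituted for the
  derivatives of \<open>u\<close>; \<open>linear_unit\<close> relies on this.
\<close>

lemma is_hom_dpoly_eval:
  assumes h: "is_hom \<iota>"
  shows "is_hom (dpoly_eval \<iota> dE a)"
proof -
  note add = dpoly_eval_add[OF h] and single = dpoly_eval_single[of \<iota>, OF is_homD(4)[OF h]]
  have z: "dpoly_eval \<iota> dE a 0 = 0" by (simp add: dpoly_eval_mon)
  have *: "dpoly_eval \<iota> dE a (Poly_Mapping.single m c * q) = \<iota> c * mon_eval dE a m * dpoly_eval \<iota> dE a q" for m c q
    by (induction q rule: poly_mapping_single_induct)
       (auto simp: z ring_distribs add single mult_single mon_eval_add is_homD[OF h])
  have "dpoly_eval \<iota> dE a (p * q) = dpoly_eval \<iota> dE a p * dpoly_eval \<iota> dE a q" for p q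
    by (induction p rule: poly_mapping_single_induct) (auto simp: z ring_distribs add single *)
  moreover have "dpoly_eval \<iota> dE a 1 = 1"
    using single[of dE a 0 1] by (simp add: is_homD[OF h])
  ultimately show ?thesis using add by (auto simp: is_hom_def)
qed

lemma dpoly_eval_dconst: "is_hom \<iota> \<Longrightarrow> dpoly_eval \<iota> dE a (dconst c) = \<iota> c"
  by (simp add: dconst_def dpoly_eval_single is_homD)

lemma dpoly_eval_dvar: "is_hom \<iota> \<Longrightarrow> dpoly_eval \<iota> dE a (dvar w k) = (dE ^^ k) (a w)"
  by (simp add: dvar_def dpoly_eval_single is_homD)

lemma dpoly_eval_compose:
  assumes h: "is_hom h" and c: "\<And>z. h (D z) = D' (h z)"
  shows "h (dpoly_eval \<iota> D a p) = dpoly_eval (h \<circ> \<iota>) D' (h \<circ> a) p"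
proof -
  have "h ((D ^^ k) z) = (D' ^^ k) (h z)" for k z by (induction k) (auto simp: c)
  then show ?thesis
    by (simp add: dpoly_eval_def is_homD[OF h] case_prod_beta)
qed

section \<open>The derivation of the ring of differential polynomials\<close>

text \<open>
  The part of the derivative of a term that comes from its monomial.
\<close>

definition mon_deriv :: "(('w \<times> nat) \<Rightarrow>\<^sub>0 nat) \<Rightarrow> ('w, 'r::comm_ring_1) dpoly" where
  "mon_deriv m = (\<Sum>(w, k)\<in>Poly_Mapping.keys m.
     Poly_Mapping.single (m - dmon w k + dmon w (Suc k)) (of_nat (Poly_Mapping.lookup m (w, k))))"

lemma mon_deriv_superset:
  assumes "finite S" "Poly_Mapping.keys m \<subseteq> S"
  shows "mon_deriv m = (\<Sum>(w, k)\<in>S. Poly_Mapping.single (m - dmon w k + dmon w (Suc k)) (of_nat (Poly_Mapping.lookup m (w, k))))"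
  unfolding mon_deriv_def using assms by (intro sum.mono_neutral_left) (auto simp: in_keys_iff)

lemma minus_dmon_plus:
  fixes m n e :: "('w \<times> nat) \<Rightarrow>\<^sub>0 nat"
  assumes "Poly_Mapping.lookup m (w, k) \<noteq> 0"
  shows "m + n - dmon w k + e = (m - dmon w k + e) + n"
  using assms by (intro poly_mapping_eqI) (auto simp: lookup_add lookup_minus dmon_def lookup_single when_def)

text \<open>
  The Leibniz rule for monomials. Subtraction of exponents is truncated, but a derivative that does
  not occur in the monomial contributes the coefficient $0$.
\<close>

lemma mon_deriv_add:
  "(mon_deriv (m + n) :: ('w, 'r::comm_ring_1) dpoly) = mon_deriv m * Poly_Mapping.single n 1 + Poly_Mapping.single m 1 * mon_deriv n"
proof -
  let ?S = "Poly_Mapping.keys m \<union> Poly_Mapping.keys n"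
  let ?t = "\<lambda>m w k. Poly_Mapping.single (m - dmon w k + dmon w (Suc k)) (of_nat (Poly_Mapping.lookup m (w, k)) :: 'r)"
  have 1: "mon_deriv (m + n) = (\<Sum>(w, k)\<in>?S. ?t (m + n) w k)"
    by (rule mon_deriv_superset) (auto simp: keys_add)
  have 2: "mon_deriv m = (\<Sum>(w, k)\<in>?S. ?t m w k)" "mon_deriv n = (\<Sum>(w, k)\<in>?S. ?t n w k)"
    by (rule mon_deriv_superset; simp)+
  have s: "Poly_Mapping.single (m + n - dmon w k + e) (of_nat (Poly_Mapping.lookup m (w, k)) :: 'r) =
     Poly_Mapping.single (m - dmon w k + e + n) (of_nat (Poly_Mapping.lookup m (w, k)))" for m n e :: "('w \<times> nat) \<Rightarrow>\<^sub>0 nat" and w k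
    using minus_dmon_plus[of m w k n e] by (cases "Poly_Mapping.lookup m (w, k) = 0") auto
  have "?t (m + n) w k = ?t m w k * Poly_Mapping.single n 1 + Poly_Mapping.single m 1 * (?t n w k)" for w k
  proof -
    have "?t (m + n) w k = Poly_Mapping.single (m + n - dmon w k + dmon w (Suc k)) (of_nat (Poly_Mapping.lookup m (w, k))) +
       Poly_Mapping.single (n + m - dmon w k + dmon w (Suc k)) (of_nat (Poly_Mapping.lookup n (w, k)))"
      by (simp add: lookup_add single_add add.commute)
    then show ?thesis by (simp only: s) (simp add: mult_single add.commute)
  qed
  then show ?thesis
    by (simp add: 1 2 case_prod_beta sum.distrib sum_distrib_left sum_distrib_right)
qed

lemma dpoly_deriv_mon:
  "dpoly_deriv d p = (\<Sum>m\<in>Poly_Mapping.keys p. Poly_Mapping.single m (d (Poly_Mapping.lookup p m)) +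
     dconst (Poly_Mapping.lookup p m) * mon_deriv m)"
  by (simp add: dpoly_deriv_def mon_deriv_def dconst_def sum_distrib_left case_prod_beta mult_single mult.commute)

lemma dpoly_deriv_add:
  assumes "derivation d" shows "dpoly_deriv d (p + q) = dpoly_deriv d p + dpoly_deriv d q"
  unfolding dpoly_deriv_mon
  by (rule sum_keys_add) (auto simp: derivationD[OF assms] derivation_zero[OF assms] dconst_def single_add algebra_simps)

lemma dpoly_deriv_single:
  "derivation d \<Longrightarrow> dpoly_deriv d (Poly_Mapping.single m c) = Poly_Mapping.single m (d c) + dconst c * mon_deriv m"
  by (simp add: dpoly_deriv_mon dconst_def derivation_zero)

lemma derivation_dpoly_deriv:
  assumes d: "derivation d"
  shows "derivation (dpoly_deriv d :: ('w, 'r::comm_ring_1) dpoly \<Rightarrow> _)"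
proof -
  note add = dpoly_deriv_add[OF d] and single = dpoly_deriv_single[OF d]
  have z: "dpoly_deriv d 0 = 0" by (simp add: dpoly_deriv_mon)
  have ss: "dpoly_deriv d (Poly_Mapping.single m c * Poly_Mapping.single n b) =
      dpoly_deriv d (Poly_Mapping.single m c) * Poly_Mapping.single n b +
      Poly_Mapping.single m c * dpoly_deriv d (Poly_Mapping.single n b)"
    for m n :: "('w \<times> nat) \<Rightarrow>\<^sub>0 nat" and c b :: 'r
  proof -
    have split: "Poly_Mapping.single k e = dconst e * Poly_Mapping.single k 1" for k :: "('w \<times> nat) \<Rightarrow>\<^sub>0 nat" and e :: 'r
      by (simp add: dconst_def mult_single)
    have c: "(dconst (e * f) :: ('w, 'r) dpoly) = dconst e * dconst f"
      "(dconst (e + f) :: ('w, 'r) dpoly) = dconst e + dconst f" for e f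
      by (simp_all add: dconst_def mult_single single_add)
    have mn: "Poly_Mapping.single (m + n) (1::'r) = Poly_Mapping.single m 1 * Poly_Mapping.single n 1"
      by (simp add: mult_single)
    have "dpoly_deriv d (Poly_Mapping.single m c * Poly_Mapping.single n b)
      = Poly_Mapping.single (m + n) (d c * b + c * d b) + dconst (c * b) * mon_deriv (m + n)"
      by (simp add: mult_single single derivationD[OF d])
    also have "\<dots> = dpoly_deriv d (Poly_Mapping.single m c) * Poly_Mapping.single n b +
      Poly_Mapping.single m c * dpoly_deriv d (Poly_Mapping.single n b)"
      unfolding single
      apply (subst split[of "m + n"]) apply (subst split[of m c]) apply (subst split[of n b])
      apply (subst split[of n "d b"]) apply (subst split[of m "d c"])
      by (simp add: c mon_deriv_add mn algebra_simps)
    finally show ?thesis .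
  qed
  have *: "dpoly_deriv d (Poly_Mapping.single m c * q) = dpoly_deriv d (Poly_Mapping.single m c) * q + Poly_Mapping.single m c * dpoly_deriv d q" for m c and q :: "('w, 'r) dpoly"
    by (induction q rule: poly_mapping_single_induct) (auto simp: z ring_distribs add ss)
  have "dpoly_deriv d (p * q) = dpoly_deriv d p * q + p * dpoly_deriv d q" for p q :: "('w, 'r) dpoly"
    by (induction p rule: poly_mapping_single_induct) (auto simp: z ring_distribs add *)
  then show ?thesis using add by (auto simp: derivation_def)
qed

lemma dpoly_deriv_dconst: "derivation d \<Longrightarrow> dpoly_deriv d (dconst c) = dconst (d c)"
  by (simp add: dconst_def dpoly_deriv_single mon_deriv_def)

lemma dpoly_deriv_dvar: "derivation d \<Longrightarrow> dpoly_deriv d (dvar w k) = dvar w (Suc k)"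
  by (simp add: dvar_def dpoly_deriv_single derivation_one mon_deriv_def dconst_def mult_single dmon_def)

section \<open>Induction over differential polynomials\<close>

text \<open>
  Constants and derivatives of the indeterminates generate the ring, so identities between maps
  that are compatible with sums and products need only be checked on these.
\<close>

lemma dpoly_induct [case_names dconst dvar add mult]:
  fixes p :: "('w, 'r::comm_ring_1) dpoly"
  assumes c: "\<And>c. P (dconst c)" and v: "\<And>w k. P (dvar w k)"
    and a: "\<And>p q. P p \<Longrightarrow> P q \<Longrightarrow> P (p + q)" and m: "\<And>p q. P p \<Longrightarrow> P q \<Longrightarrow> P (p * q)"
  shows "P p"
proof -
  have one: "P (Poly_Mapping.single m 1)" for m
  proof (induction m rule: poly_mapping_single_induct)
    case zero
    show ?case using c[of 1] by (simp add: dconst_def)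
  next
    case (add t e m)
    obtain w k where t: "t = (w, k)" by force
    show ?case
    proof (induction e)
      case 0
      then show ?case using add by simp
    next
      case (Suc e)
      have "Poly_Mapping.single (Poly_Mapping.single t (Suc e) + m) 1 =
          dvar w k * (Poly_Mapping.single (Poly_Mapping.single t e + m) 1 :: ('w, 'r) dpoly)"
        by (simp add: dvar_def dmon_def mult_single t flip: single_add add.assoc)
      then show ?case using Suc v m by simp
    qed
  qed
  have "Poly_Mapping.single m c = dconst c * Poly_Mapping.single m 1" for m and c :: 'r
    by (simp add: dconst_def mult_single)
  then have s: "P (Poly_Mapping.single m x)" for m x using m[OF c one] by metis
  show ?thesis
  proof (induction p rule: poly_mapping_single_induct)
    case zero
    show ?case using c[of 0] by (simp add: dconst_def)
  qed (use s a in auto)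
qed

lemma dpoly_eval_deriv:
  assumes h: "is_hom \<iota>" and d: "derivation d" "derivation dE" and c: "\<And>c. \<iota> (d c) = dE (\<iota> c)"
  shows "dpoly_eval \<iota> dE a (dpoly_deriv d p) = dE (dpoly_eval \<iota> dE a p)"
  by (induction p rule: dpoly_induct)
     (auto simp: dpoly_deriv_dconst dpoly_deriv_dvar dpoly_eval_dconst dpoly_eval_dvar h d c
        derivationD(1)[OF d(2)] derivationD(2)[OF d(2)] derivationD(1)[OF derivation_dpoly_deriv[OF d(1)]] derivationD(2)[OF derivation_dpoly_deriv[OF d(1)]]
        is_homD(2,3)[OF is_hom_dpoly_eval[OF h]])

section \<open>Constant and linear coefficients\<close>

lemma lookup_dconst_mult: "Poly_Mapping.lookup (dconst c * p) m = c * Poly_Mapping.lookup p m"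
  unfolding dconst_def by (simp flip: mult_map_scale_conv_mult add: map.rep_eq when_def)

text \<open>
  A monomial of degree one has only the trivial factorizations. Hence the constant and linear
  coefficients of a product depend only on those of the factors.
\<close>

lemma plus_eq_dmon_iff:
  "m + n = dmon w k \<longleftrightarrow> m = 0 \<and> n = dmon w k \<or> m = dmon w k \<and> n = 0"
proof
  assume eq: "m + n = dmon w k"
  have l: "Poly_Mapping.lookup m t + Poly_Mapping.lookup n t = Poly_Mapping.lookup (dmon w k) t" for t
    using eq by (metis lookup_add)
  have z: "Poly_Mapping.lookup m t = 0 \<and> Poly_Mapping.lookup n t = 0" if "t \<noteq> (w, k)" for t
    using l[of t] that by (simp add: dmon_def lookup_single)
  have "Poly_Mapping.lookup m (w, k) + Poly_Mapping.lookup n (w, k) = 1"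
    using l[of "(w, k)"] by (simp add: dmon_def)
  then consider "Poly_Mapping.lookup m (w, k) = 0" "Poly_Mapping.lookup n (w, k) = 1" |
    "Poly_Mapping.lookup m (w, k) = 1" "Poly_Mapping.lookup n (w, k) = 0" by linarith
  then show "m = 0 \<and> n = dmon w k \<or> m = dmon w k \<and> n = 0"
  proof cases
    case 1
    then have "Poly_Mapping.lookup m t = 0" "Poly_Mapping.lookup n t = Poly_Mapping.lookup (dmon w k) t" for t
      using z[of t] by (cases "t = (w, k)"; simp add: dmon_def lookup_single when_def)+
    then have "m = 0" "n = dmon w k" by (auto intro: poly_mapping_eqI)
    then show ?thesis by simp
  next
    case 2
    then have "Poly_Mapping.lookup n t = 0" "Poly_Mapping.lookup m t = Poly_Mapping.lookup (dmon w k) t" for t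
      using z[of t] by (cases "t = (w, k)"; simp add: dmon_def lookup_single when_def)+
    then have "n = 0" "m = dmon w k" by (auto intro: poly_mapping_eqI)
    then show ?thesis by simp
  qed
qed auto

lemma plus_eq_zero_mon_iff: "m + n = (0 :: 'v \<Rightarrow>\<^sub>0 nat) \<longleftrightarrow> m = 0 \<and> n = 0"
  by (auto simp: poly_mapping_eq_iff fun_eq_iff lookup_add)

lemma dmon_neq_zero [simp]: "dmon w k \<noteq> 0" "0 \<noteq> dmon w k"
  by (auto simp: dmon_def poly_mapping_eq_iff fun_eq_iff lookup_single when_def)

lemma dmon_eq_iff [simp]: "dmon w k = dmon w' k' \<longleftrightarrow> w = w' \<and> k = k'"
  unfolding dmon_def by (metis keys_single one_neq_zero prod.inject singleton_inject)

lemma lookup_dconst: "Poly_Mapping.lookup (dconst c) m = (if m = 0 then c else 0)"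
  by (simp add: dconst_def lookup_single when_def)

lemma lookup_dvar: "Poly_Mapping.lookup (dvar w k) m = (if m = dmon w k then 1 else 0)"
  by (simp add: dvar_def lookup_single when_def)

lemma dpoly_mult_induct:
  fixes p q :: "('w, 'r::comm_ring_1) dpoly"
  assumes l: "\<And>p p' q. f (p + p') q = f p q + f p' q" and r: "\<And>p q q'. f p (q + q') = f p q + f p q'"
    and l': "\<And>p p' q. g (p + p') q = g p q + g p' q" and r': "\<And>p q q'. g p (q + q') = g p q + g p q'"
    and s: "\<And>m n a b. f (Poly_Mapping.single m a) (Poly_Mapping.single n b) = g (Poly_Mapping.single m a) (Poly_Mapping.single n b)"
  shows "f p q = (g p q :: 'r)"
proof -
  have z: "f 0 q = 0" "g 0 q = 0" "f p 0 = 0" "g p 0 = 0" for p q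
    using l[of 0 0 q] l'[of 0 0 q] r[of p 0 0] r'[of p 0 0] by auto
  have "f (Poly_Mapping.single m a) q = g (Poly_Mapping.single m a) q" for m a q
    by (induction q rule: poly_mapping_single_induct) (auto simp: z r r' s)
  then show ?thesis
    by (induction p rule: poly_mapping_single_induct) (auto simp: z l l')
qed

lemma lookup_mult_zero:
  "Poly_Mapping.lookup (p * q :: ('w, 'r::comm_ring_1) dpoly) 0 = Poly_Mapping.lookup p 0 * Poly_Mapping.lookup q 0"
  by (rule dpoly_mult_induct)
     (auto simp: ring_distribs lookup_add mult_single lookup_single when_def plus_eq_zero_mon_iff)

lemma lookup_mult_dmon:
  "Poly_Mapping.lookup (p * q :: ('w, 'r::comm_ring_1) dpoly) (dmon w k) =
     Poly_Mapping.lookup p 0 * Poly_Mapping.lookup q (dmon w k) + Poly_Mapping.lookup p (dmon w k) * Poly_Mapping.lookup q 0"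
  by (rule dpoly_mult_induct)
     (auto simp: ring_distribs lookup_add mult_single lookup_single when_def plus_eq_dmon_iff)

lemma lookup_dpoly_deriv_zero:
  assumes d: "derivation d"
  shows "Poly_Mapping.lookup (dpoly_deriv d p :: ('w, 'r::comm_ring_1) dpoly) 0 = d (Poly_Mapping.lookup p 0)"
proof -
  have "(0::('w \<times> nat) \<Rightarrow>\<^sub>0 nat) = dmon w k \<longleftrightarrow> False" for w k by simp
  then show ?thesis
  by (induction p rule: dpoly_induct)
     (auto simp: dpoly_deriv_dconst[OF d] dpoly_deriv_dvar[OF d] derivationD(1)[OF d] derivationD(2)[OF d]
      derivationD(1)[OF derivation_dpoly_deriv[OF d]] derivationD(2)[OF derivation_dpoly_deriv[OF d]]
      lookup_add lookup_mult_zero lookup_dvar lookup_dconst derivation_zero[OF d])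
qed

lemma lookup_dpoly_deriv_dmon:
  assumes d: "derivation d"
  shows "Poly_Mapping.lookup (dpoly_deriv d p :: ('w, 'r::comm_ring_1) dpoly) (dmon w k) =
    d (Poly_Mapping.lookup p (dmon w k)) + (case k of 0 \<Rightarrow> 0 | Suc j \<Rightarrow> Poly_Mapping.lookup p (dmon w j))"
  by (induction p rule: dpoly_induct)
     (auto simp: dpoly_deriv_dconst[OF d] dpoly_deriv_dvar[OF d] derivationD(1)[OF d] derivationD(2)[OF d]
      derivationD(1)[OF derivation_dpoly_deriv[OF d]] derivationD(2)[OF derivation_dpoly_deriv[OF d]] lookup_dpoly_deriv_zero[OF d]
      lookup_add lookup_mult_zero lookup_mult_dmon lookup_dvar lookup_dconst derivation_zero[OF d] derivation_one[OF d]
      algebra_simps split: nat.splits)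

section \<open>Linear differential operators as skew polynomials\<close>

text \<open>
  A polynomial stands for the operator $\sum_i c_i \delta^i$. The composition of $\delta$ with this
  operator is $\sum_i (\delta(c_i) \delta^i + c_i \delta^{i+1})$.
\<close>

definition delta_comp :: "('a::field \<Rightarrow> 'a) \<Rightarrow> 'a poly \<Rightarrow> 'a poly" where
  "delta_comp d p = map_poly d p + pCons 0 p"

text \<open>
  The product $A \circ p$ in the skew polynomial ring, defined through the left action of
  $\delta$, so that the skew product needs no type of its own.
\<close>

definition op_comp :: "('a::field \<Rightarrow> 'a) \<Rightarrow> 'a poly \<Rightarrow> 'a poly \<Rightarrow> 'a poly" where
  "op_comp d A p = (\<Sum>i\<le>Polynomial.degree A. Polynomial.smult (coeff A i) ((delta_comp d ^^ i) p))"

definition op_apply :: "('a::field \<Rightarrow> 'a) \<Rightarrow> 'a \<Rightarrow> 'a poly \<Rightarrow> 'a" where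
  "op_apply d u p = (\<Sum>i\<le>Polynomial.degree p. coeff p i * (d ^^ i) u)"

text \<open>
  Over type class fields, differential subfields can be described without ring records; the two
  notions agree by \<open>diff_subfield_iff\<close>.
\<close>

definition dsubfield :: "('a::field \<Rightarrow> 'a) \<Rightarrow> 'a set \<Rightarrow> bool" where
  "dsubfield d K \<longleftrightarrow> 1 \<in> K \<and> (\<forall>a\<in>K. \<forall>b\<in>K. a + b \<in> K \<and> a * b \<in> K) \<and>
     (\<forall>a\<in>K. - a \<in> K \<and> inverse a \<in> K \<and> d a \<in> K)"

definition coeffs_in :: "'a::field set \<Rightarrow> 'a poly \<Rightarrow> bool" where
  "coeffs_in K p \<longleftrightarrow> (\<forall>i. coeff p i \<in> K)"

lemma dsubfieldD:
  assumes "dsubfield d K"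
  shows "1 \<in> K" "0 \<in> K" "a \<in> K \<Longrightarrow> b \<in> K \<Longrightarrow> a + b \<in> K" "a \<in> K \<Longrightarrow> b \<in> K \<Longrightarrow> a * b \<in> K"
    "a \<in> K \<Longrightarrow> - a \<in> K" "a \<in> K \<Longrightarrow> inverse a \<in> K" "a \<in> K \<Longrightarrow> d a \<in> K"
    "a \<in> K \<Longrightarrow> b \<in> K \<Longrightarrow> a - b \<in> K" "a \<in> K \<Longrightarrow> b \<in> K \<Longrightarrow> a / b \<in> K"
    "(\<And>i. i \<in> I \<Longrightarrow> f i \<in> K) \<Longrightarrow> sum f I \<in> K"
proof -
  note * = assms[unfolded dsubfield_def]
  show [intro]: "1 \<in> K" "a \<in> K \<Longrightarrow> b \<in> K \<Longrightarrow> a + b \<in> K" "a \<in> K \<Longrightarrow> b \<in> K \<Longrightarrow> a * b \<in> K"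
    "a \<in> K \<Longrightarrow> - a \<in> K" "a \<in> K \<Longrightarrow> inverse a \<in> K" "a \<in> K \<Longrightarrow> d a \<in> K" for a b using * by auto
  from \<open>1 \<in> K\<close> have "1 + (- 1) \<in> K" by blast
  then show [intro]: "0 \<in> K" by simp
  have "a \<in> K \<Longrightarrow> b \<in> K \<Longrightarrow> a + (- b) \<in> K" "a \<in> K \<Longrightarrow> b \<in> K \<Longrightarrow> a * inverse b \<in> K" by blast+
  then show "a \<in> K \<Longrightarrow> b \<in> K \<Longrightarrow> a - b \<in> K" "a \<in> K \<Longrightarrow> b \<in> K \<Longrightarrow> a / b \<in> K"
    by (simp_all add: divide_inverse)
  show "(\<And>i. i \<in> I \<Longrightarrow> f i \<in> K) \<Longrightarrow> sum f I \<in> K"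
    by (induction I rule: infinite_finite_induct) auto
qed

context
  fixes d :: "'a::field \<Rightarrow> 'a"
  assumes d: "derivation d"
begin

lemma coeff_delta_comp: "coeff (delta_comp d p) k = d (coeff p k) + (case k of 0 \<Rightarrow> 0 | Suc j \<Rightarrow> coeff p j)"
  by (simp add: delta_comp_def coeff_map_poly derivation_zero[OF d] coeff_pCons)

lemma delta_comp_0 [simp]: "delta_comp d 0 = 0" by (simp add: delta_comp_def)

lemma delta_comp_add: "delta_comp d (p + q) = delta_comp d p + delta_comp d q"
  by (rule poly_eqI) (simp add: coeff_delta_comp derivationD[OF d] split: nat.splits)

lemma delta_comp_smult: "delta_comp d (Polynomial.smult c p) = Polynomial.smult (d c) p + Polynomial.smult c (delta_comp d p)"
  by (rule poly_eqI) (simp add: coeff_delta_comp derivationD[OF d] algebra_simps split: nat.splits)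

lemma delta_comp_minus: "delta_comp d (- p) = - delta_comp d p"
  using delta_comp_add[of p "- p"] by (simp add: eq_neg_iff_add_eq_0 add.commute)

lemma delta_comp_diff: "delta_comp d (p - q) = delta_comp d p - delta_comp d q"
  using delta_comp_add[of p "- q"] by (simp add: delta_comp_minus)

lemma delta_comp_sum: "delta_comp d (sum f I) = (\<Sum>i\<in>I. delta_comp d (f i))"
  by (induction I rule: infinite_finite_induct) (auto simp: delta_comp_add)

lemma delta_comp_funpow_add: "(delta_comp d ^^ n) (p + q) = (delta_comp d ^^ n) p + (delta_comp d ^^ n) q"
  by (induction n) (auto simp: delta_comp_add)

lemma degree_delta_comp_le: "Polynomial.degree p \<le> n \<Longrightarrow> Polynomial.degree (delta_comp d p) \<le> Suc n"
  by (rule degree_le) (auto simp: coeff_delta_comp coeff_eq_0 derivation_zero[OF d] split: nat.splits)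

lemma degree_delta_comp_funpow_le: "Polynomial.degree p \<le> m \<Longrightarrow> Polynomial.degree ((delta_comp d ^^ n) p) \<le> n + m"
  by (induction n) (auto intro: degree_delta_comp_le)

lemma coeff_delta_comp_funpow_top:
  "Polynomial.degree p \<le> m \<Longrightarrow> coeff ((delta_comp d ^^ n) p) (n + m) = coeff p m"
proof (induction n)
  case (Suc n)
  then have "coeff ((delta_comp d ^^ n) p) (Suc n + m) = 0"
    using degree_delta_comp_funpow_le[of p m n] by (intro coeff_eq_0) auto
  then show ?case using Suc by (simp add: coeff_delta_comp derivation_zero[OF d])
qed simp

lemma op_comp_eq_sum:
  "Polynomial.degree A \<le> n \<Longrightarrow> op_comp d A p = (\<Sum>i\<le>n. Polynomial.smult (coeff A i) ((delta_comp d ^^ i) p))"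
  unfolding op_comp_def by (rule sum.mono_neutral_left) (auto simp: coeff_eq_0)

lemma op_comp_add_left: "op_comp d (A + B) p = op_comp d A p + op_comp d B p"
proof -
  let ?n = "max (Polynomial.degree A) (Polynomial.degree B)"
  have "op_comp d A p = (\<Sum>i\<le>?n. Polynomial.smult (coeff A i) ((delta_comp d ^^ i) p))"
    "op_comp d B p = (\<Sum>i\<le>?n. Polynomial.smult (coeff B i) ((delta_comp d ^^ i) p))"
    "op_comp d (A + B) p = (\<Sum>i\<le>?n. Polynomial.smult (coeff (A + B) i) ((delta_comp d ^^ i) p))"
    by (rule op_comp_eq_sum; simp add: degree_add_le_max)+
  then show ?thesis by (simp add: smult_add_left sum.distrib)
qed

lemma op_comp_0_left [simp]: "op_comp d 0 p = 0" by (simp add: op_comp_def)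
lemma op_comp_const [simp]: "op_comp d [:c:] p = Polynomial.smult c p" by (simp add: op_comp_def)
lemma op_comp_1 [simp]: "op_comp d 1 p = p" by (simp add: op_comp_def)

lemma op_comp_smult_left: "op_comp d (Polynomial.smult c A) p = Polynomial.smult c (op_comp d A p)"
  by (subst op_comp_eq_sum[of _ "Polynomial.degree A"])
     (auto simp: op_comp_def poly_eq_iff coeff_sum sum_distrib_left mult.assoc)

lemma op_comp_sum_left: "op_comp d (sum f I) p = (\<Sum>i\<in>I. op_comp d (f i) p)"
  by (induction I rule: infinite_finite_induct) (auto simp: op_comp_add_left)

lemma op_comp_monom: "op_comp d (monom c n) p = Polynomial.smult c ((delta_comp d ^^ n) p)"
proof -
  have "op_comp d (monom c n) p = (\<Sum>i\<le>n. Polynomial.smult (coeff (monom c n) i) ((delta_comp d ^^ i) p))"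
    by (rule op_comp_eq_sum) (simp add: degree_monom_le)
  also have "\<dots> = (\<Sum>i\<le>n. if i = n then Polynomial.smult c ((delta_comp d ^^ i) p) else 0)"
    by (rule sum.cong) auto
  finally show ?thesis by simp
qed

lemma op_comp_add_right: "op_comp d A (p + q) = op_comp d A p + op_comp d A q"
  by (simp add: op_comp_def delta_comp_funpow_add smult_add_right sum.distrib)

lemma op_comp_delta_comp: "op_comp d (delta_comp d A) p = delta_comp d (op_comp d A p)"
proof -
  let ?n = "Polynomial.degree A"
  have "op_comp d (delta_comp d A) p = (\<Sum>i\<le>Suc ?n. Polynomial.smult (coeff (delta_comp d A) i) ((delta_comp d ^^ i) p))"
    by (rule op_comp_eq_sum) (simp add: degree_delta_comp_le)
  also have "\<dots> = (\<Sum>i\<le>Suc ?n. Polynomial.smult (d (coeff A i)) ((delta_comp d ^^ i) p)) +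
     (\<Sum>i\<le>Suc ?n. Polynomial.smult (case i of 0 \<Rightarrow> 0 | Suc j \<Rightarrow> coeff A j) ((delta_comp d ^^ i) p))"
    by (simp add: coeff_delta_comp smult_add_left sum.distrib)
  also have "(\<Sum>i\<le>Suc ?n. Polynomial.smult (case i of 0 \<Rightarrow> 0 | Suc j \<Rightarrow> coeff A j) ((delta_comp d ^^ i) p)) =
     (\<Sum>i\<le>?n. Polynomial.smult (coeff A i) ((delta_comp d ^^ Suc i) p))"
    by (subst sum.atMost_Suc_shift) simp
  also have "(\<Sum>i\<le>Suc ?n. Polynomial.smult (d (coeff A i)) ((delta_comp d ^^ i) p)) =
     (\<Sum>i\<le>?n. Polynomial.smult (d (coeff A i)) ((delta_comp d ^^ i) p))"
    by (simp add: coeff_eq_0 derivation_zero[OF d])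
  finally show ?thesis
    by (simp add: op_comp_def delta_comp_sum delta_comp_smult sum.distrib)
qed

lemma op_comp_delta_comp_funpow: "op_comp d ((delta_comp d ^^ n) A) p = (delta_comp d ^^ n) (op_comp d A p)"
  by (induction n) (auto simp: op_comp_delta_comp)

lemma op_comp_assoc: "op_comp d A (op_comp d C p) = op_comp d (op_comp d A C) p"
  unfolding op_comp_def[of d A] by (simp add: op_comp_sum_left op_comp_smult_left op_comp_delta_comp_funpow)

lemma degree_op_comp_le:
  assumes "Polynomial.degree A \<le> a" "Polynomial.degree p \<le> m"
  shows "Polynomial.degree (op_comp d A p) \<le> a + m"
  unfolding op_comp_eq_sum[OF assms(1)]
proof (rule degree_sum_le)
  fix i assume "i \<in> {..a}"
  then show "Polynomial.degree (Polynomial.smult (coeff A i) ((delta_comp d ^^ i) p)) \<le> a + m"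
    using degree_delta_comp_funpow_le[OF assms(2), of i] degree_smult_le[of "coeff A i" "(delta_comp d ^^ i) p"]
    by (meson add_le_mono1 atMost_iff le_trans)
qed simp

text \<open>
  Leading coefficients multiply: differentiating a coefficient never contributes to the top order.
\<close>

lemma coeff_op_comp_top:
  assumes "Polynomial.degree A \<le> a" "Polynomial.degree p \<le> m"
  shows "coeff (op_comp d A p) (a + m) = coeff A a * coeff p m"
proof -
  have z: "coeff ((delta_comp d ^^ i) p) (a + m) = 0" if "i < a" for i
    using degree_delta_comp_funpow_le[OF assms(2), of i] that by (intro coeff_eq_0) auto
  have "coeff (op_comp d A p) (a + m) = (\<Sum>i\<le>a. coeff A i * coeff ((delta_comp d ^^ i) p) (a + m))"
    by (simp add: op_comp_eq_sum[OF assms(1)] coeff_sum)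
  also have "\<dots> = (\<Sum>i\<le>a. if i = a then coeff A i * coeff p m else 0)"
    by (rule sum.cong) (auto simp: z coeff_delta_comp_funpow_top[OF assms(2)])
  finally show ?thesis by simp
qed

lemma op_comp_nonzero:
  assumes "A \<noteq> 0" "p \<noteq> 0"
  shows "op_comp d A p \<noteq> 0" and "Polynomial.degree (op_comp d A p) = Polynomial.degree A + Polynomial.degree p"
proof -
  have "coeff (op_comp d A p) (Polynomial.degree A + Polynomial.degree p) \<noteq> 0"
    using assms by (subst coeff_op_comp_top) auto
  then show "op_comp d A p \<noteq> 0" "Polynomial.degree (op_comp d A p) = Polynomial.degree A + Polynomial.degree p"
    using degree_op_comp_le[of A "Polynomial.degree A" p "Polynomial.degree p"]
    by (auto intro: antisym le_degree)
qed

lemma op_apply_eq_sum: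
  "Polynomial.degree p \<le> n \<Longrightarrow> op_apply d u p = (\<Sum>i\<le>n. coeff p i * (d ^^ i) u)"
  unfolding op_apply_def by (rule sum.mono_neutral_left) (auto simp: coeff_eq_0)

lemma op_apply_0 [simp]: "op_apply d u 0 = 0" by (simp add: op_apply_def)

lemma op_apply_add: "op_apply d u (p + q) = op_apply d u p + op_apply d u q"
proof -
  let ?n = "max (Polynomial.degree p) (Polynomial.degree q)"
  have "op_apply d u p = (\<Sum>i\<le>?n. coeff p i * (d ^^ i) u)"
    "op_apply d u q = (\<Sum>i\<le>?n. coeff q i * (d ^^ i) u)"
    "op_apply d u (p + q) = (\<Sum>i\<le>?n. coeff (p + q) i * (d ^^ i) u)"
    by (rule op_apply_eq_sum; simp add: degree_add_le_max)+
  then show ?thesis by (simp add: ring_distribs sum.distrib)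
qed

lemma op_apply_smult: "op_apply d u (Polynomial.smult c p) = c * op_apply d u p"
  by (subst op_apply_eq_sum[of _ "Polynomial.degree p"]) (auto simp: op_apply_def sum_distrib_left mult.assoc)

lemma op_apply_diff: "op_apply d u (p - q) = op_apply d u p - op_apply d u q"
  using op_apply_add[of u "p - q" q] by simp

lemma op_apply_sum: "op_apply d u (sum f I) = (\<Sum>i\<in>I. op_apply d u (f i))"
  by (induction I rule: infinite_finite_induct) (auto simp: op_apply_add)

lemma op_apply_delta_comp: "op_apply d u (delta_comp d p) = d (op_apply d u p)"
proof -
  let ?n = "Polynomial.degree p"
  have "op_apply d u (delta_comp d p) = (\<Sum>i\<le>Suc ?n. coeff (delta_comp d p) i * (d ^^ i) u)"
    by (rule op_apply_eq_sum) (simp add: degree_delta_comp_le)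
  also have "\<dots> = (\<Sum>i\<le>Suc ?n. d (coeff p i) * (d ^^ i) u) +
     (\<Sum>i\<le>Suc ?n. (case i of 0 \<Rightarrow> 0 | Suc j \<Rightarrow> coeff p j) * (d ^^ i) u)"
    by (simp add: coeff_delta_comp ring_distribs sum.distrib)
  also have "(\<Sum>i\<le>Suc ?n. (case i of 0 \<Rightarrow> 0 | Suc j \<Rightarrow> coeff p j) * (d ^^ i) u) =
     (\<Sum>i\<le>?n. coeff p i * (d ^^ Suc i) u)"
    by (subst sum.atMost_Suc_shift) simp
  also have "(\<Sum>i\<le>Suc ?n. d (coeff p i) * (d ^^ i) u) = (\<Sum>i\<le>?n. d (coeff p i) * (d ^^ i) u)"
    by (simp add: coeff_eq_0 derivation_zero[OF d])
  finally show ?thesis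
    by (simp add: op_apply_def derivation_sum[OF d] derivationD[OF d] sum.distrib)
qed

lemma op_apply_delta_comp_funpow: "op_apply d u ((delta_comp d ^^ n) p) = (d ^^ n) (op_apply d u p)"
  by (induction n) (auto simp: op_apply_delta_comp)

lemma op_apply_comp: "op_apply d u (op_comp d A p) = (\<Sum>i\<le>Polynomial.degree A. coeff A i * (d ^^ i) (op_apply d u p))"
  by (simp add: op_comp_def op_apply_sum op_apply_smult op_apply_delta_comp_funpow)

lemma coeffs_in_delta_comp: "dsubfield d K \<Longrightarrow> coeffs_in K p \<Longrightarrow> coeffs_in K (delta_comp d p)"
  by (auto simp: coeffs_in_def coeff_delta_comp dsubfieldD split: nat.splits)

lemma coeffs_in_delta_comp_funpow: "dsubfield d K \<Longrightarrow> coeffs_in K p \<Longrightarrow> coeffs_in K ((delta_comp d ^^ n) p)"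
  by (induction n) (auto intro: coeffs_in_delta_comp)

lemma coeffs_in_add: "dsubfield d K \<Longrightarrow> coeffs_in K p \<Longrightarrow> coeffs_in K q \<Longrightarrow> coeffs_in K (p + q)"
  by (auto simp: coeffs_in_def dsubfieldD)

lemma coeffs_in_diff: "dsubfield d K \<Longrightarrow> coeffs_in K p \<Longrightarrow> coeffs_in K q \<Longrightarrow> coeffs_in K (p - q)"
  by (auto simp: coeffs_in_def dsubfieldD)

lemma coeffs_in_smult: "dsubfield d K \<Longrightarrow> c \<in> K \<Longrightarrow> coeffs_in K p \<Longrightarrow> coeffs_in K (Polynomial.smult c p)"
  by (auto simp: coeffs_in_def dsubfieldD)

lemma coeffs_in_op_comp: "dsubfield d K \<Longrightarrow> coeffs_in K A \<Longrightarrow> coeffs_in K p \<Longrightarrow> coeffs_in K (op_comp d A p)"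
  using coeffs_in_delta_comp_funpow[of K p]
  by (auto simp: op_comp_def coeffs_in_def coeff_sum intro!: dsubfieldD(10,4))

lemma coeffs_in_monom: "dsubfield d K \<Longrightarrow> c \<in> K \<Longrightarrow> coeffs_in K (monom c n)"
  by (auto simp: coeffs_in_def dsubfieldD)

lemma coeffs_in_0: "dsubfield d K \<Longrightarrow> coeffs_in K 0"
  by (auto simp: coeffs_in_def dsubfieldD)

lemma coeffs_in_1: "dsubfield d K \<Longrightarrow> coeffs_in K 1"
  using coeffs_in_monom[of K 1 0] by (simp add: dsubfieldD monom_0 one_pCons)

text \<open>
  Euclidean division on the right. It never leaves a differential field that contains the
  coefficients, which is what makes a greatest common right divisor rational over $K$.
\<close>

lemma op_division:
  assumes K: "dsubfield d K" and q: "q \<noteq> 0" "coeffs_in K q"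
  shows "coeffs_in K p \<Longrightarrow> \<exists>C r. coeffs_in K C \<and> coeffs_in K r \<and> p = op_comp d C q + r \<and>
    (r = 0 \<or> Polynomial.degree r < Polynomial.degree q)"
proof (induction "Polynomial.degree p" arbitrary: p rule: less_induct)
  case less
  show ?case
  proof (cases "p = 0 \<or> Polynomial.degree p < Polynomial.degree q")
    case True
    then show ?thesis using less.prems coeffs_in_0[OF K] by (intro exI[of _ 0] exI[of _ p]) auto
  next
    case False
    define k where "k = Polynomial.degree p - Polynomial.degree q"
    define A where "A = monom (lead_coeff p / lead_coeff q) k"
    define p' where "p' = p - op_comp d A q"
    have "lead_coeff p / lead_coeff q \<in> K"
      using less.prems q(2) by (intro dsubfieldD(9)[OF K]) (auto simp: coeffs_in_def)
    then have A: "Polynomial.degree A \<le> k" "coeffs_in K A"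
      unfolding A_def using coeffs_in_monom[OF K] by (auto simp: degree_monom_le)
    have dp: "Polynomial.degree p = k + Polynomial.degree q" using False by (simp add: k_def)
    have "Polynomial.degree (op_comp d A q) \<le> Polynomial.degree p"
      unfolding dp using A by (intro degree_op_comp_le) auto
    moreover have "coeff (op_comp d A q) (Polynomial.degree p) = lead_coeff p"
      unfolding dp using A q by (subst coeff_op_comp_top) (auto simp: A_def dp)
    ultimately have le: "Polynomial.degree p' \<le> Polynomial.degree p" "coeff p' (Polynomial.degree p) = 0"
      by (auto simp: p'_def degree_diff_le)
    have K': "coeffs_in K p'" unfolding p'_def
      using K A less.prems q by (intro coeffs_in_diff coeffs_in_op_comp) auto
    have "\<exists>C r. coeffs_in K C \<and> coeffs_in K r \<and> p' = op_comp d C q + r \<and> (r = 0 \<or> Polynomial.degree r < Polynomial.degree q)"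
    proof (cases "p' = 0")
      case True
      then show ?thesis using coeffs_in_0[OF K] by (intro exI[of _ 0]) auto
    next
      case False
      then have "Polynomial.degree p' < Polynomial.degree p"
        using le by (metis leading_coeff_0_iff le_neq_implies_less)
      then show ?thesis using less.hyps K' by blast
    qed
    then obtain C r where "coeffs_in K C" "coeffs_in K r" "p' = op_comp d C q + r" "r = 0 \<or> Polynomial.degree r < Polynomial.degree q"
      by blast
    then show ?thesis
      using A K by (intro exI[of _ "C + A"] exI[of _ r]) (auto simp: p'_def op_comp_add_left algebra_simps coeffs_in_add)
  qed
qed

lemma dsubfield_UNIV: "dsubfield d UNIV" by (simp add: dsubfield_def)
lemma coeffs_in_UNIV: "coeffs_in UNIV p" by (simp add: coeffs_in_def)

definition left_ideal :: "'a set \<Rightarrow> 'a poly \<Rightarrow> 'a poly \<Rightarrow> 'a poly set" where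
  "left_ideal K p q = {op_comp d A p + op_comp d B q | A B. coeffs_in K A \<and> coeffs_in K B}"

lemma left_idealI: "coeffs_in K A \<Longrightarrow> coeffs_in K B \<Longrightarrow> op_comp d A p + op_comp d B q \<in> left_ideal K p q"
  by (auto simp: left_ideal_def)

lemma left_ideal_gens:
  assumes "dsubfield d K" shows "p \<in> left_ideal K p q" "q \<in> left_ideal K p q" "0 \<in> left_ideal K p q"
  using left_idealI[of K 1 0 p q] left_idealI[of K 0 1 p q] left_idealI[of K 0 0 p q] coeffs_in_0[OF assms] coeffs_in_1[OF assms]
  by auto

lemma left_ideal_add:
  assumes K: "dsubfield d K" and "a \<in> left_ideal K p q" "b \<in> left_ideal K p q"
  shows "a + b \<in> left_ideal K p q"
proof -
  obtain A B A' B' where "a = op_comp d A p + op_comp d B q" "coeffs_in K A" "coeffs_in K B"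
     "b = op_comp d A' p + op_comp d B' q" "coeffs_in K A'" "coeffs_in K B'"
    using assms by (auto simp: left_ideal_def)
  then show ?thesis using left_idealI[of K "A + A'" "B + B'" p q] K
    by (simp add: coeffs_in_add op_comp_add_left algebra_simps)
qed

lemma left_ideal_op_comp:
  assumes K: "dsubfield d K" and C: "coeffs_in K C" and "a \<in> left_ideal K p q"
  shows "op_comp d C a \<in> left_ideal K p q"
proof -
  obtain A B where "a = op_comp d A p + op_comp d B q" "coeffs_in K A" "coeffs_in K B"
    using assms by (auto simp: left_ideal_def)
  then show ?thesis using left_idealI[of K "op_comp d C A" "op_comp d C B" p q] K C
    by (simp add: coeffs_in_op_comp op_comp_add_right op_comp_assoc)
qed

lemma left_ideal_smult:
  assumes K: "dsubfield d K" and C: "c \<in> K" and "a \<in> left_ideal K p q"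
  shows "Polynomial.smult c a \<in> left_ideal K p q"
  using left_ideal_op_comp[OF K _ assms(3), of "[:c:]"] coeffs_in_monom[OF K C, of 0] by (simp add: monom_0)

lemma left_ideal_diff:
  assumes K: "dsubfield d K" and "a \<in> left_ideal K p q" "b \<in> left_ideal K p q"
  shows "a - b \<in> left_ideal K p q"
  using left_ideal_add[OF K assms(2) left_ideal_smult[OF K _ assms(3), of "-1"]] dsubfieldD[OF K] by simp

lemma left_ideal_delta_comp:
  assumes K: "dsubfield d K" and "a \<in> left_ideal K p q"
  shows "delta_comp d a \<in> left_ideal K p q"
proof -
  have "op_comp d (monom 1 1) a \<in> left_ideal K p q"
    by (intro left_ideal_op_comp assms coeffs_in_monom dsubfieldD(1)[OF K])
  then show ?thesis by (simp add: op_comp_monom)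
qed

lemma left_ideal_mono: "K \<subseteq> K' \<Longrightarrow> left_ideal K p q \<subseteq> left_ideal K' p q"
  by (fastforce simp: left_ideal_def coeffs_in_def)

text \<open>
  A monic element of least order in the ideal over the small field generates the ideal over every
  larger field, because it already divides the two generators.
\<close>

lemma left_ideal_principal:
  assumes K: "dsubfield d K" and p: "coeffs_in K p" and q: "coeffs_in K q" and nz: "p \<noteq> 0"
  obtains G where "G \<in> left_ideal K p q" "lead_coeff G = 1" "coeffs_in K G"
    "\<And>K' a. dsubfield d K' \<Longrightarrow> K \<subseteq> K' \<Longrightarrow> a \<in> left_ideal K' p q \<Longrightarrow> \<exists>C. coeffs_in K' C \<and> a = op_comp d C G"
proof -
  let ?J = "left_ideal K p q"
  define n where "n = (LEAST n. \<exists>G\<in>?J. G \<noteq> 0 \<and> Polynomial.degree G = n)"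
  have "\<exists>n. \<exists>G\<in>?J. G \<noteq> 0 \<and> Polynomial.degree G = n" using left_ideal_gens[OF K] nz by blast
  from LeastI_ex[OF this, folded n_def] obtain H where H: "H \<in> ?J" "H \<noteq> 0" "Polynomial.degree H = n" by blast
  have min: "n \<le> Polynomial.degree a" if "a \<in> ?J" "a \<noteq> 0" for a
    unfolding n_def by (rule Least_le) (use that in blast)
  have cK: "coeffs_in K a" if "a \<in> ?J" for a
    using that K p q by (auto simp: left_ideal_def intro!: coeffs_in_add coeffs_in_op_comp)
  define G where "G = Polynomial.smult (1 / lead_coeff H) H"
  have lH: "lead_coeff H \<noteq> 0" "lead_coeff H \<in> K" using H cK by (auto simp: coeffs_in_def)
  have G: "G \<in> ?J" unfolding G_def using lH H dsubfieldD[OF K] by (intro left_ideal_smult K) auto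
  have lG: "lead_coeff G = 1" and dG: "Polynomial.degree G = n" and G0: "G \<noteq> 0"
    using lH H by (auto simp: G_def)
  have div: "\<exists>C. coeffs_in K C \<and> a = op_comp d C G" if a: "a \<in> ?J" for a
  proof -
    obtain C r where C: "coeffs_in K C" "a = op_comp d C G + r" "r = 0 \<or> Polynomial.degree r < n"
      using op_division[OF K G0 cK[OF G] cK[OF a]] dG by blast
    have "a - op_comp d C G \<in> ?J" using G C a by (intro left_ideal_diff left_ideal_op_comp K)
    then have "r \<in> ?J" using C by simp
    then have "r = 0" using min[of r] C(3) by (meson not_le)
    then show ?thesis using C by auto
  qed
  show ?thesis
  proof (rule that[OF G lG cK[OF G]])
    fix K' a assume K': "dsubfield d K'" "K \<subseteq> K'" and a: "a \<in> left_ideal K' p q"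
    obtain C1 C2 where C: "p = op_comp d C1 G" "q = op_comp d C2 G" "coeffs_in K C1" "coeffs_in K C2"
      using div[OF left_ideal_gens(1)[OF K]] div[OF left_ideal_gens(2)[OF K]] by blast
    then have C': "coeffs_in K' C1" "coeffs_in K' C2" using K'(2) by (auto simp: coeffs_in_def)
    obtain A B where AB: "a = op_comp d A p + op_comp d B q" "coeffs_in K' A" "coeffs_in K' B"
      using a by (auto simp: left_ideal_def)
    have "a = op_comp d (op_comp d A C1 + op_comp d B C2) G"
      unfolding AB(1) by (subst C(1), subst C(2)) (simp add: op_comp_add_left op_comp_assoc)
    then show "\<exists>C. coeffs_in K' C \<and> a = op_comp d C G"
      using AB C' K' by (blast intro: coeffs_in_add coeffs_in_op_comp)
  qed
qed

text \<open>
  The induction follows the Euclidean algorithm: for $p = C q + r$, a relation between $p$ and $q$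
  becomes one between $q$ and $r$ in which $r$ has the coefficient that $p$ had, and both summands of
  a relation have the same order. This is the lower bound in the fact that for operators without
  common right factor the least common left multiple has the sum of the orders as its order.
\<close>

lemma syzygy_degree:
  assumes "q \<noteq> 0" "1 \<in> left_ideal UNIV p q" "op_comp d A p + op_comp d B q = 0" "A \<noteq> 0"
  shows "Polynomial.degree q \<le> Polynomial.degree A"
  using assms
proof (induction "Polynomial.degree q" arbitrary: p q A B rule: less_induct)
  case less
  let ?deg = "Polynomial.degree :: 'a poly \<Rightarrow> nat"
  obtain C r where C: "p = op_comp d C q + r" "r = 0 \<or> ?deg r < ?deg q"
    using op_division[OF dsubfield_UNIV less.prems(1) coeffs_in_UNIV coeffs_in_UNIV, of p] by blast
  obtain S T where ST: "op_comp d S p + op_comp d T q = 1" using less.prems(2) by (auto simp: left_ideal_def)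
  show ?case
  proof (cases "r = 0")
    case True
    then have "op_comp d (op_comp d S C + T) q = 1" using ST C by (simp add: op_comp_add_left op_comp_assoc)
    then have "?deg q = 0"
      using op_comp_nonzero(2)[of "op_comp d S C + T" q] less.prems(1) by (cases "op_comp d S C + T = 0") auto
    then show ?thesis by simp
  next
    case False
    have "op_comp d (op_comp d S C + T) q + op_comp d S r = 1"
      using ST unfolding C(1) by (simp add: op_comp_add_left op_comp_add_right op_comp_assoc algebra_simps)
    then have one: "1 \<in> left_ideal UNIV q r"
      using left_idealI[OF coeffs_in_UNIV coeffs_in_UNIV] by metis
    define E where "E = op_comp d A C + B"
    have E: "op_comp d E q + op_comp d A r = 0"
      using less.prems(3) unfolding C(1) E_def by (simp add: op_comp_add_left op_comp_add_right op_comp_assoc algebra_simps)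
    have "E \<noteq> 0"
      using E op_comp_nonzero(1)[OF less.prems(4) False] by auto
    then have "?deg r \<le> ?deg E" using less.hyps[OF _ False one E] C(2) False by simp
    moreover have "op_comp d E q = - op_comp d A r" using E by (simp add: eq_neg_iff_add_eq_0)
    then have "?deg (op_comp d E q) = ?deg (op_comp d A r)" by simp
    then have "?deg E + ?deg q = ?deg A + ?deg r"
      using op_comp_nonzero(2)[OF \<open>E \<noteq> 0\<close> less.prems(1)] op_comp_nonzero(2)[OF less.prems(4) False] by simp
    ultimately show ?thesis by simp
  qed
qed

end

section \<open>Differentiating a greatest common right divisor\<close>

text \<open>
  The map \<open>\<D>\<close> abstracts the differential of a differential rational function in \<open>u\<close>: the coefficient
  of $\delta^k$ in \<open>\<D> a\<close> is $\partial a/\partial u^{(k)}$, so it commutes with $\delta$. For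
  $l_1 = x_0 q_1 - p_1$ the coefficients of $p_1, q_1$ are constant in $u$ and the differential of
  $x_0$ is $\kappa_1 l_1$, which gives the last condition on \<open>l1\<close>.
\<close>

locale tangent =
  fixes d :: "'a::field_char_0 \<Rightarrow> 'a" and K :: "'a set" and \<D> :: "'a \<Rightarrow> 'a poly"
    and l1 l2 q1 q2 :: "'a poly" and \<kappa>1 \<kappa>2 :: 'a
  assumes d: "derivation d" and K: "dsubfield d K"
    and \<D>_add: "\<And>a b. a \<in> K \<Longrightarrow> b \<in> K \<Longrightarrow> \<D> (a + b) = \<D> a + \<D> b"
    and \<D>_mult: "\<And>a b. a \<in> K \<Longrightarrow> b \<in> K \<Longrightarrow> \<D> (a * b) = Polynomial.smult a (\<D> b) + Polynomial.smult b (\<D> a)"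
    and \<D>_d: "\<And>a. a \<in> K \<Longrightarrow> \<D> (d a) = delta_comp d (\<D> a)"
    and \<D>_ideal: "\<And>a. a \<in> K \<Longrightarrow> \<D> a \<in> left_ideal d UNIV l1 l2"
    and l1: "l1 \<noteq> 0" "coeffs_in K l1" "\<kappa>1 \<noteq> 0" "\<And>i. \<D> (coeff l1 i) = Polynomial.smult (\<kappa>1 * coeff q1 i) l1"
    and l2: "l2 \<noteq> 0" "coeffs_in K l2" "\<kappa>2 \<noteq> 0" "\<And>i. \<D> (coeff l2 i) = Polynomial.smult (\<kappa>2 * coeff q2 i) l2"
begin

abbreviation "J \<equiv> left_ideal d UNIV l1 l2"

lemma \<D>_0 [simp]: "\<D> 0 = 0"
  using \<D>_add[of 0 0] dsubfieldD[OF K] by simp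

lemma \<D>_1 [simp]: "\<D> 1 = 0"
  using \<D>_mult[of 1 1] dsubfieldD[OF K] by simp

definition partial :: "nat \<Rightarrow> 'a poly \<Rightarrow> 'a poly" where
  "partial k p = map_poly (\<lambda>a. coeff (\<D> a) k) p"

lemma coeff_partial: "coeff (partial k p) i = coeff (\<D> (coeff p i)) k"
  by (simp add: partial_def coeff_map_poly)

lemma partial_0 [simp]: "partial k 0 = 0" by (simp add: partial_def)

lemma partial_add: "coeffs_in K p \<Longrightarrow> coeffs_in K q \<Longrightarrow> partial k (p + q) = partial k p + partial k q"
  by (rule poly_eqI) (auto simp: coeff_partial \<D>_add coeffs_in_def)

lemma partial_smult: "c \<in> K \<Longrightarrow> coeffs_in K p \<Longrightarrow> partial k (Polynomial.smult c p) = Polynomial.smult c (partial k p) + Polynomial.smult (coeff (\<D> c) k) p"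
  by (rule poly_eqI) (auto simp: coeff_partial \<D>_mult coeffs_in_def)

text \<open>
  As $\delta$ turns $u^{(k-1)}$ into $u^{(k)}$, it commutes with differentiation with respect to
  $u^{(k)}$ only up to differentiation with respect to $u^{(k-1)}$.
\<close>

lemma partial_delta_comp:
  assumes "coeffs_in K p"
  shows "partial k (delta_comp d p) = delta_comp d (partial k p) + (case k of 0 \<Rightarrow> 0 | Suc j \<Rightarrow> partial j p)"
  by (rule poly_eqI)
     (use assms in \<open>auto simp: coeff_partial coeff_delta_comp[OF d] \<D>_add \<D>_d coeffs_in_def dsubfieldD[OF K] derivation_zero[OF d] split: nat.splits\<close>)

lemma J_closed:
  "p \<in> J \<Longrightarrow> q \<in> J \<Longrightarrow> p + q \<in> J" "p \<in> J \<Longrightarrow> q \<in> J \<Longrightarrow> p - q \<in> J"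
  "p \<in> J \<Longrightarrow> Polynomial.smult c p \<in> J" "p \<in> J \<Longrightarrow> delta_comp d p \<in> J" "0 \<in> J"
  using left_ideal_add[OF d dsubfield_UNIV] left_ideal_diff[OF d dsubfield_UNIV] left_ideal_smult[OF d dsubfield_UNIV]
    left_ideal_delta_comp[OF d dsubfield_UNIV] left_ideal_gens[OF d dsubfield_UNIV] d by auto

lemma J_smult_cancel: "Polynomial.smult c p \<in> J \<Longrightarrow> c \<noteq> 0 \<Longrightarrow> p \<in> J"
  using J_closed(3)[of "Polynomial.smult c p" "1 / c"] by simp

lemma J_delta_comp_funpow: "p \<in> J \<Longrightarrow> (delta_comp d ^^ n) p \<in> J"
  by (induction n) (auto intro: J_closed)

text \<open>
  Modulo the ideal, differentiation is linear over the coefficients of $A$: the terms in which a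
  coefficient of $A$ is differentiated are multiples of some $\delta^i G$, hence in the ideal.
\<close>

lemma partial_op_comp:
  assumes G: "coeffs_in K G" "G \<in> J" and A: "coeffs_in K A"
  shows "partial k (op_comp d A G) - (\<Sum>i\<le>Polynomial.degree A. Polynomial.smult (coeff A i) (partial k ((delta_comp d ^^ i) G))) \<in> J"
proof -
  have c: "coeffs_in K (Polynomial.smult (coeff A i) ((delta_comp d ^^ i) G))" for i
    using G A by (intro coeffs_in_smult[OF d K] coeffs_in_delta_comp_funpow[OF d K]) (auto simp: coeffs_in_def)
  have "coeffs_in K (\<Sum>i<n. Polynomial.smult (coeff A i) ((delta_comp d ^^ i) G)) \<and>
     partial k (\<Sum>i<n. Polynomial.smult (coeff A i) ((delta_comp d ^^ i) G)) - (\<Sum>i<n. Polynomial.smult (coeff A i) (partial k ((delta_comp d ^^ i) G))) \<in> J" for n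
  proof (induction n)
    case 0
    then show ?case by (simp add: J_closed coeffs_in_0[OF d K])
  next
    case (Suc n)
    let ?S = "\<Sum>i<n. Polynomial.smult (coeff A i) ((delta_comp d ^^ i) G)"
    let ?S' = "\<Sum>i<n. Polynomial.smult (coeff A i) (partial k ((delta_comp d ^^ i) G))"
    let ?G = "(delta_comp d ^^ n) G"
    have "partial k (\<Sum>i<Suc n. Polynomial.smult (coeff A i) ((delta_comp d ^^ i) G)) - (\<Sum>i<Suc n. Polynomial.smult (coeff A i) (partial k ((delta_comp d ^^ i) G)))
      = (partial k ?S - ?S') + Polynomial.smult (coeff (\<D> (coeff A n)) k) ?G"
      using Suc c[of n] A coeffs_in_delta_comp_funpow[OF d K G(1), of n]
      by (simp add: partial_add partial_smult coeffs_in_def)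
    also have "\<dots> \<in> J"
      using Suc J_delta_comp_funpow[OF G(2)] by (intro J_closed(1)[OF _ J_closed(3)]) auto
    finally show ?case using Suc c[of n] by (auto intro: coeffs_in_add[OF d K])
  qed
  from this[of "Suc (Polynomial.degree A)"] show ?thesis
    by (simp add: op_comp_def lessThan_Suc_atMost)
qed

text \<open>
  Each $\delta$ raises the order in $u$ of the coefficients by at most one and shifts the top partial
  derivative along.
\<close>

lemma partial_delta_comp_funpow_top:
  assumes G: "coeffs_in K G" and n: "\<And>k. n < k \<Longrightarrow> partial k G = 0"
  shows "(n + i < k \<longrightarrow> partial k ((delta_comp d ^^ i) G) = 0) \<and> partial (n + i) ((delta_comp d ^^ i) G) = partial n G"
proof (induction i arbitrary: k)
  case (Suc i)
  have c: "coeffs_in K ((delta_comp d ^^ i) G)" by (rule coeffs_in_delta_comp_funpow[OF d K G])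
  show ?case
    using Suc[of k] Suc[of "k - 1"] Suc[of "n + Suc i"]
    by (auto simp: partial_delta_comp[OF c] delta_comp_0[OF d] split: nat.splits)
qed (use n in auto)

text \<open>
  One order below the top, each of the $i$ factors $\delta$ can be the one that differentiates the
  top partial derivative.
\<close>

lemma partial_delta_comp_funpow_second:
  assumes G: "coeffs_in K G" and n: "\<And>k. Suc n < k \<Longrightarrow> partial k G = 0"
  shows "partial (n + i) ((delta_comp d ^^ i) G) = partial n G + Polynomial.smult (of_nat i) (delta_comp d (partial (Suc n) G))"
proof (induction i)
  case (Suc i)
  have c: "coeffs_in K ((delta_comp d ^^ i) G)" by (rule coeffs_in_delta_comp_funpow[OF d K G])
  have "partial (Suc n + i) ((delta_comp d ^^ i) G) = partial (Suc n) G"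
    using partial_delta_comp_funpow_top[where n = "Suc n", OF G n] by blast
  then show ?case
    using Suc by (simp add: partial_delta_comp[OF c] smult_add_left)
qed simp

lemma coeff_delta_comp_funpow_second:
  assumes "lead_coeff G = 1" "Polynomial.degree G = Suc g"
  shows "coeff ((delta_comp d ^^ i) G) (g + i) = coeff G g"
proof (induction i)
  case (Suc i)
  have "coeff ((delta_comp d ^^ i) G) (i + Suc g) = 1"
    using coeff_delta_comp_funpow_top[OF d, where p = G and m = "Suc g" and n = i] assms by simp
  then show ?case using Suc by (simp add: coeff_delta_comp[OF d] derivation_one[OF d] add.commute)
qed simp

text \<open>
  Besides the two excluded situations only the following is left: a common right factor $G$ of
  positive order whose dependence on $u$ is given by an operator $\tau$, which both $q_1$ and $q_2$
  represent modulo the ideal up to a factor, and which satisfies $\delta\tau \in J$.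
\<close>

theorem dichotomy:
  assumes no_unit: "1 \<notin> left_ideal d K l1 l2" and not_prop: "\<And>\<beta>. l2 \<noteq> Polynomial.smult \<beta> l1"
  obtains G \<tau> where "G \<in> J" "0 < Polynomial.degree G" "\<And>a. a \<in> J \<Longrightarrow> \<exists>C. a = op_comp d C G"
    "Polynomial.degree \<tau> < Polynomial.degree G" "\<tau> - Polynomial.smult \<kappa>1 q1 \<in> J" "\<tau> - Polynomial.smult \<kappa>2 q2 \<in> J"
    "delta_comp d \<tau> \<in> J"
proof -
  obtain G where G: "G \<in> left_ideal d K l1 l2" "lead_coeff G = 1" "coeffs_in K G" and
    Gdiv: "\<And>K' a. dsubfield d K' \<Longrightarrow> K \<subseteq> K' \<Longrightarrow> a \<in> left_ideal d K' l1 l2 \<Longrightarrow> \<exists>C. coeffs_in K' C \<and> a = op_comp d C G"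
    using left_ideal_principal[OF d K l1(2) l2(2) l1(1)] by blast
  define g where "g = Polynomial.degree G"
  have GJ: "G \<in> J" using G(1) left_ideal_mono[OF d] by (metis subset_UNIV subsetD)
  have G0: "G \<noteq> 0" using G by auto
  have "g \<noteq> 0"
  proof
    assume "g = 0"
    then have "G = 1" using G(2) unfolding g_def by (metis degree_0_id one_pCons)
    then show False using G(1) no_unit by simp
  qed
  then obtain g' where g': "g = Suc g'" by (cases g) auto
  have div: "\<exists>C. a = op_comp d C G" if "a \<in> J" for a
    using Gdiv[OF dsubfield_UNIV[OF d] _ that] by blast
  have Jle: "a = Polynomial.smult (coeff a g) G" if a: "a \<in> J" and le: "Polynomial.degree a \<le> g" for a
  proof -
    obtain C where C: "a = op_comp d C G" using div[OF a] by blast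
    have "Polynomial.degree C = 0"
      using le op_comp_nonzero(2)[OF d _ G0, of C] C g_def by (cases "C = 0") auto
    then obtain c where "C = [:c:]" by (metis degree_eq_zeroE)
    then show ?thesis using C G(2) op_comp_const[OF d] by (simp add: g_def)
  qed
  have Jlt: "a = 0" if a: "a \<in> J" and lt: "Polynomial.degree a < g" for a
    using Jle[OF a] lt coeff_eq_0[OF lt] by simp
  obtain A B where A: "l1 = op_comp d A G" "coeffs_in K A" and B: "l2 = op_comp d B G" "coeffs_in K B"
    using Gdiv[OF K order_refl left_ideal_gens(1)[OF d K]] Gdiv[OF K order_refl left_ideal_gens(2)[OF d K]] by blast
  have partial_deg: "Polynomial.degree (partial k G) < g" for k
  proof -
    have "coeff (partial k G) i = 0" if "i > g'" for i
    proof (cases "i = g")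
      case True
      then show ?thesis using G(2) by (simp add: coeff_partial g_def)
    next
      case False
      then have "coeff G i = 0" using that g' unfolding g_def by (intro coeff_eq_0) auto
      then show ?thesis by (simp add: coeff_partial)
    qed
    then have "Polynomial.degree (partial k G) \<le> g'" by (intro degree_le) auto
    then show ?thesis using g' by simp
  qed
  have pdl: "partial k l1 = Polynomial.smult (\<kappa>1 * coeff l1 k) q1" "partial k l2 = Polynomial.smult (\<kappa>2 * coeff l2 k) q2" for k
    by (rule poly_eqI; simp add: coeff_partial l1(4) l2(4))+

  \<comment> \<open>The coefficients of $G$ have order at most $g$ in $u$: otherwise the top partial derivative of $l_1 = A G$ would be too high for $l_1$ but nonzero modulo the ideal.\<close>
  have high: "partial k G = 0" if k: "g < k" for k
  proof (rule ccontr)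
    assume nz: "partial k G \<noteq> 0"
    define S where "S = {k. partial k G \<noteq> 0}"
    have "S \<subseteq> (\<Union>i\<le>g. {..Polynomial.degree (\<D> (coeff G i))})"
    proof
      fix k assume "k \<in> S"
      then obtain i where i: "coeff (\<D> (coeff G i)) k \<noteq> 0"
        unfolding S_def by (auto simp: poly_eq_iff coeff_partial)
      then have "i \<le> g" unfolding g_def by (intro le_degree) auto
      moreover have "k \<le> Polynomial.degree (\<D> (coeff G i))" using i by (rule le_degree)
      ultimately show "k \<in> (\<Union>i\<le>g. {..Polynomial.degree (\<D> (coeff G i))})" by blast
    qed
    then have fin: "finite S" by (rule finite_subset) auto
    define n where "n = Max S"
    have n: "n \<in> S" "g < n" using Max_in[OF fin] Max_ge[OF fin, of k] nz k by (auto simp: n_def S_def)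
    have top: "partial k G = 0" if "n < k" for k
      using Max_ge[OF fin, of k] that unfolding n_def S_def by force
    let ?a = "Polynomial.degree A"
    have A0: "A \<noteq> 0" using A l1(1) op_comp_0_left[OF d] by auto
    have "Polynomial.degree l1 = ?a + g" using op_comp_nonzero(2)[OF d A0 G0] A g_def by simp
    then have "partial (n + ?a) l1 = 0" using n by (simp add: pdl coeff_eq_0)
    moreover have "(\<Sum>i\<le>?a. Polynomial.smult (coeff A i) (partial (n + ?a) ((delta_comp d ^^ i) G))) =
        (\<Sum>i\<le>?a. if i = ?a then Polynomial.smult (coeff A ?a) (partial n G) else 0)"
      using partial_delta_comp_funpow_top[where n = n, OF G(3) top] by (intro sum.cong) auto
    ultimately have "Polynomial.smult (lead_coeff A) (partial n G) \<in> J"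
      using J_closed(2)[OF J_closed(5) partial_op_comp[OF G(3) GJ A(2), of "n + ?a"]] A(1) by simp
    then have "partial n G \<in> J" using A0 by (auto intro: J_smult_cancel)
    then show False using Jlt partial_deg n by (auto simp: S_def)
  qed

  define \<tau> where "\<tau> = partial g G"
  \<comment> \<open>The differentials of the coefficients of $G$ are in the ideal and of order at most $g$, hence multiples of $G$.\<close>
  have pdG: "partial k G = Polynomial.smult (coeff G k) \<tau>" for k
  proof (rule poly_eqI)
    fix i
    have "coeff (\<D> (coeff G i)) k = 0" if "g < k" for k
      using high[OF that] coeff_partial[of k G i] by simp
    then have "\<D> (coeff G i) = Polynomial.smult (coeff (\<D> (coeff G i)) g) G"
      using G(3) by (intro Jle \<D>_ideal degree_le) (auto simp: coeffs_in_def)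
    then have "coeff (\<D> (coeff G i)) k = coeff (\<D> (coeff G i)) g * coeff G k"
      by (metis coeff_smult)
    then show "coeff (partial k G) i = coeff (Polynomial.smult (coeff G k) \<tau>) i"
      by (simp add: coeff_partial \<tau>_def)
  qed

  \<comment> \<open>Compare the partial derivatives of $l = A G$ with respect to $u^{(a+g)}$ and $u^{(a+g-1)}$, where $a$ is the order of $A$. The second one yields a multiple $a\,\delta\tau$ in the ideal.\<close>
  have key: "\<tau> - Polynomial.smult \<kappa> q \<in> J \<and> (0 < Polynomial.degree A \<longrightarrow> delta_comp d \<tau> \<in> J)"
    if l: "l = op_comp d A G" "coeffs_in K A" "A \<noteq> 0" "\<And>k. partial k l = Polynomial.smult (\<kappa> * coeff l k) q" for l q A \<kappa>
  proof -
    let ?a = "Polynomial.degree A"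
    note partial_l = partial_op_comp[OF G(3) GJ l(2), folded l(1)]
    note top = partial_delta_comp_funpow_top[where n = g, OF G(3) high]
    have lg: "coeff l (?a + g) = lead_coeff A"
      using coeff_op_comp_top[OF d order_refl, where A = A and p = G and m = g] G(2) l(1) by (simp add: g_def)
    have "(\<Sum>i\<le>?a. Polynomial.smult (coeff A i) (partial (g + ?a) ((delta_comp d ^^ i) G))) =
        (\<Sum>i\<le>?a. if i = ?a then Polynomial.smult (coeff A ?a) \<tau> else 0)"
      using top by (intro sum.cong) (auto simp: \<tau>_def)
    then have "Polynomial.smult (\<kappa> * lead_coeff A) q - Polynomial.smult (lead_coeff A) \<tau> \<in> J"
      using partial_l[of "g + ?a"] lg by (simp add: l(4) add.commute)
    then have "Polynomial.smult (- lead_coeff A) (\<tau> - Polynomial.smult \<kappa> q) \<in> J"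
      by (simp only: smult_diff_right smult_smult mult.commute) simp
    moreover have "- lead_coeff A \<noteq> 0" using l(3) by simp
    ultimately have \<tau>: "\<tau> - Polynomial.smult \<kappa> q \<in> J" by (rule J_smult_cancel)
    moreover have "delta_comp d \<tau> \<in> J" if pos: "0 < ?a"
    proof -
      from pos obtain a where a: "?a = Suc a" by (rule lessE)
      have "(\<Sum>i\<le>?a. Polynomial.smult (coeff A i) (partial (g' + ?a) ((delta_comp d ^^ i) G))) =
         (\<Sum>i<a. Polynomial.smult (coeff A i) (partial (g' + ?a) ((delta_comp d ^^ i) G))) +
         Polynomial.smult (coeff A a) (partial (g' + ?a) ((delta_comp d ^^ a) G)) +
         Polynomial.smult (lead_coeff A) (partial (g' + ?a) ((delta_comp d ^^ ?a) G))"
        using a by (simp add: lessThan_Suc_atMost[symmetric])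
      also have "(\<Sum>i<a. Polynomial.smult (coeff A i) (partial (g' + ?a) ((delta_comp d ^^ i) G))) = 0"
        using top g' a by (intro sum.neutral) auto
      also have "partial (g' + ?a) ((delta_comp d ^^ a) G) = \<tau>"
        using top[of a] g' a by (simp add: \<tau>_def)
      also have "partial (g' + ?a) ((delta_comp d ^^ ?a) G) = Polynomial.smult (coeff G g') \<tau> + Polynomial.smult (of_nat ?a) (delta_comp d \<tau>)"
        using partial_delta_comp_funpow_second[where n = g' and i = ?a, OF G(3) high[unfolded g']] g' by (simp add: pdG[of g'] \<tau>_def)
      finally have 1: "(\<Sum>i\<le>?a. Polynomial.smult (coeff A i) (partial (g' + ?a) ((delta_comp d ^^ i) G))) =
        Polynomial.smult (coeff A a + lead_coeff A * coeff G g') \<tau> + Polynomial.smult (lead_coeff A * of_nat ?a) (delta_comp d \<tau>)"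
        by (simp add: smult_add_right smult_add_left)
      have "coeff l (g' + ?a) = (\<Sum>i\<le>?a. coeff A i * coeff ((delta_comp d ^^ i) G) (g' + ?a))"
        by (simp add: l(1) op_comp_def coeff_sum)
      also have "\<dots> = (\<Sum>i<a. coeff A i * coeff ((delta_comp d ^^ i) G) (g' + ?a)) +
          coeff A a * coeff ((delta_comp d ^^ a) G) (g' + ?a) + lead_coeff A * coeff ((delta_comp d ^^ ?a) G) (g' + ?a)"
        using a by (simp add: lessThan_Suc_atMost[symmetric])
      also have "(\<Sum>i<a. coeff A i * coeff ((delta_comp d ^^ i) G) (g' + ?a)) = 0"
      proof (intro sum.neutral ballI)
        fix i assume "i \<in> {..<a}"
        then have "Polynomial.degree ((delta_comp d ^^ i) G) < g' + ?a"
          using degree_delta_comp_funpow_le[OF d, where p = G and m = g and n = i] g' a by (auto simp: g_def)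
        then show "coeff A i * coeff ((delta_comp d ^^ i) G) (g' + ?a) = 0" by (simp add: coeff_eq_0)
      qed
      also have "coeff ((delta_comp d ^^ a) G) (g' + ?a) = 1"
        using coeff_delta_comp_funpow_top[OF d, where p = G and m = g and n = a] G(2) g' a by (simp add: g_def add.commute)
      also have "coeff ((delta_comp d ^^ ?a) G) (g' + ?a) = coeff G g'"
        using coeff_delta_comp_funpow_second[OF G(2), of g' ?a] g' by (simp add: g_def)
      finally have 2: "coeff l (g' + ?a) = coeff A a + lead_coeff A * coeff G g'" by simp
      let ?e = "coeff A a + lead_coeff A * coeff G g'"
      have "Polynomial.smult (\<kappa> * ?e) q - (Polynomial.smult ?e \<tau> + Polynomial.smult (lead_coeff A * of_nat ?a) (delta_comp d \<tau>)) \<in> J"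
        using partial_l[of "g' + ?a"] unfolding l(4) 1 2 .
      from J_closed(1)[OF this J_closed(3)[OF \<tau>, of ?e]]
      have "Polynomial.smult (- (lead_coeff A * of_nat ?a)) (delta_comp d \<tau>) \<in> J"
        by (simp add: smult_diff_right mult.commute)
      moreover have "- (lead_coeff A * of_nat ?a) \<noteq> 0" using l(3) pos by simp
      ultimately show ?thesis by (rule J_smult_cancel)
    qed
    ultimately show ?thesis by blast
  qed

  have nz: "A \<noteq> 0" "B \<noteq> 0" using A B l1(1) l2(1) op_comp_0_left[OF d] by auto
  have "0 < Polynomial.degree A \<or> 0 < Polynomial.degree B"
  proof (rule ccontr)
    assume "\<not> ?thesis"
    then obtain \<alpha> \<beta> where "A = [:\<alpha>:]" "B = [:\<beta>:]" by (metis degree_eq_zeroE gr0I)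
    then have "l1 = Polynomial.smult \<alpha> G" "l2 = Polynomial.smult \<beta> G" "\<alpha> \<noteq> 0"
      using A(1) B(1) op_comp_const[OF d] nz by auto
    then have "l2 = Polynomial.smult (\<beta> / \<alpha>) l1" by simp
    then show False using not_prop by blast
  qed
  moreover note key[OF A nz(1) pdl(1)] key[OF B nz(2) pdl(2)]
  ultimately show ?thesis
    using that[OF GJ _ div, of \<tau>] partial_deg[of g] g' by (auto simp: \<tau>_def g_def)
qed

end

section \<open>Determinants of matrices given by functions\<close>

definition fdet :: "nat \<Rightarrow> (nat \<Rightarrow> nat \<Rightarrow> 'r::comm_ring_1) \<Rightarrow> 'r" where
  "fdet n M = det (mat n n (\<lambda>(i, j). M i j))"

lemma fdet_expand:
  "fdet n M = (\<Sum>p\<in>{p. p permutes {0..<n}}. signof p * (\<Prod>i\<in>{0..<n}. M i (p i)))"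
  unfolding fdet_def
  by (subst det_def'[of _ n], simp, rule sum.cong[OF refl], rule arg_cong[where f = "(*) _"], rule prod.cong)
     (auto simp: permutes_in_image)

lemma fdet_cong:
  "(\<And>i j. i < n \<Longrightarrow> j < n \<Longrightarrow> M i j = M' i j) \<Longrightarrow> fdet n M = fdet n M'"
  unfolding fdet_def by (rule arg_cong[where f = det], rule cong_mat) auto

lemma signof_cases: "(signof p :: 'a::comm_ring_1) = 1 \<or> (signof p :: 'a) = - 1"
  by (simp add: sign_def)

lemma fdet_hom:
  assumes h: "is_hom h" shows "h (fdet n M) = fdet n (\<lambda>i j. h (M i j))"
proof -
  have "h (signof p) = signof p" for p by (simp add: sign_def is_homD[OF h])
  then show ?thesis by (simp add: fdet_expand is_homD[OF h])
qed

lemma fdet_row_split: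
  assumes r: "r < n"
  shows "fdet n (M(r := \<lambda>j. x * a j + b j)) = x * fdet n (M(r := a)) + fdet n (M(r := b))"
proof -
  have "(\<Prod>i\<in>{0..<n}. (M(r := c)) i (p i)) = c (p r) * (\<Prod>i\<in>{0..<n} - {r}. M i (p i))" for c p
  proof -
    have "(\<Prod>i\<in>{0..<n}. (M(r := c)) i (p i)) = (M(r := c)) r (p r) * (\<Prod>i\<in>{0..<n} - {r}. (M(r := c)) i (p i))"
      using r by (intro prod.remove) auto
    also have "(\<Prod>i\<in>{0..<n} - {r}. (M(r := c)) i (p i)) = (\<Prod>i\<in>{0..<n} - {r}. M i (p i))"
      by (rule prod.cong) auto
    finally show ?thesis by simp
  qed
  then show ?thesis
    by (simp add: fdet_expand sum_distrib_left sum.distrib algebra_simps)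
qed

text \<open>
  Multiplication by the adjugate matrix shows that the determinant annihilates every vector in the
  kernel. Over a ring, a unit entry of such a vector forces the determinant to vanish.
\<close>

lemma fdet_eq_0_kernel:
  assumes ker: "\<And>i. i < n \<Longrightarrow> (\<Sum>j<n. M i j * v j) = 0" and k: "k < n" "v k dvd 1"
  shows "fdet n M = 0"
proof -
  let ?A = "mat n n (\<lambda>(i, j). M i j)" and ?v = "vec n v"
  have A: "?A \<in> carrier_mat n n" by simp
  have "?A *\<^sub>v ?v = 0\<^sub>v n"
    by (rule eq_vecI) (auto simp: scalar_prod_def ker atLeast0LessThan)
  then have "adj_mat ?A *\<^sub>v (?A *\<^sub>v ?v) = 0\<^sub>v n"
    using adj_mat(1)[OF A] by (auto simp: scalar_prod_def intro!: eq_vecI)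
  also have "adj_mat ?A *\<^sub>v (?A *\<^sub>v ?v) = (det ?A \<cdot>\<^sub>m 1\<^sub>m n) *\<^sub>v ?v"
    using adj_mat[OF A] by (subst assoc_mult_mat_vec[symmetric]) auto
  finally have "((det ?A \<cdot>\<^sub>m 1\<^sub>m n) *\<^sub>v ?v) $ k = 0" using k by simp
  moreover have "((det ?A \<cdot>\<^sub>m 1\<^sub>m n) *\<^sub>v ?v) $ k = det ?A * v k"
  proof -
    have "((det ?A \<cdot>\<^sub>m 1\<^sub>m n) *\<^sub>v ?v) $ k = (\<Sum>j\<in>{0..<n}. det ?A * (if j = k then 1 else 0) * v j)"
      using k(1) by (auto simp: scalar_prod_def intro!: sum.cong)
    also have "\<dots> = (\<Sum>j\<in>{0..<n}. if j = k then det ?A * v k else 0)"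
      by (rule sum.cong) auto
    finally have "((det ?A \<cdot>\<^sub>m 1\<^sub>m n) *\<^sub>v ?v) $ k = (\<Sum>j\<in>{0..<n}. if j = k then det ?A * v k else 0)" .
    then show ?thesis using k(1) by simp
  qed
  ultimately have "det ?A * v k = 0" by simp
  moreover obtain c where "1 = v k * c" using k(2) by (auto elim: dvdE)
  ultimately show ?thesis unfolding fdet_def by (metis mult.assoc mult.right_neutral mult_zero_left)
qed

lemma fdet_zero_row:
  assumes "r < n" "\<And>j. j < n \<Longrightarrow> B r j = 0" shows "fdet n B = 0"
proof -
  have "fdet n B = fdet n (B(r := \<lambda>j. 0 * 0 + 0))"
    by (rule fdet_cong) (use assms in auto)
  also have "\<dots> = fdet n (B(r := \<lambda>j. 0)) + fdet n (B(r := \<lambda>j. 0))"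
    using fdet_row_split[OF assms(1), of B 0 "\<lambda>_. 0" "\<lambda>_. 0"] fdet_row_split[OF assms(1), of B 1 "\<lambda>_. 0" "\<lambda>_. 0"] by simp
  finally show ?thesis
    using fdet_row_split[OF assms(1), of B 1 "\<lambda>_. 0" "\<lambda>_. 0"] by simp
qed

lemma fdet_eq_0_row_span:
  assumes M: "\<And>i j. i < n \<Longrightarrow> j < n \<Longrightarrow> M i j = (\<Sum>k<n. C i k * B k j)"
    and r: "r < n" "\<And>j. j < n \<Longrightarrow> B r j = 0"
  shows "fdet n M = 0"
proof -
  let ?m = "\<lambda>M. mat n n (\<lambda>(i, j). M i j)"
  have "?m M = ?m C * ?m B"
    by (rule eq_matI) (auto simp: M scalar_prod_def atLeast0LessThan)
  then have "fdet n M = fdet n C * fdet n B"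
    unfolding fdet_def by (simp add: det_mult[of _ n])
  then show ?thesis using fdet_zero_row[of r n B] r by simp
qed

lemma fdet_exists_kernel:
  fixes B :: "nat \<Rightarrow> nat \<Rightarrow> 'a::field"
  assumes "fdet n B = 0"
  obtains v k where "k < n" "v k \<noteq> 0" "\<And>i. i < n \<Longrightarrow> (\<Sum>j<n. B i j * v j) = 0"
proof -
  let ?A = "mat n n (\<lambda>(i, j). B i j)"
  obtain v where v: "v \<in> carrier_vec n" "v \<noteq> 0\<^sub>v n" "?A *\<^sub>v v = 0\<^sub>v n"
    using det_0_iff_vec_prod_zero_field[of ?A n] assms unfolding fdet_def by auto
  obtain k where "k < n" "v $ k \<noteq> 0" using v(1,2) by (auto simp: vec_eq_iff)
  moreover have "(\<Sum>j<n. B i j * v $ j) = 0" if "i < n" for i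
  proof -
    have "(?A *\<^sub>v v) $ i = 0" using v(3) that by simp
    then show ?thesis using that v(1) by (simp add: scalar_prod_def atLeast0LessThan)
  qed
  ultimately show ?thesis using that[of k "\<lambda>j. v $ j"] by blast
qed

lemma fdet_nonzero_if_rows_independent:
  fixes M :: "nat \<Rightarrow> nat \<Rightarrow> 'a::field"
  assumes ind: "\<And>v k. (\<And>j. j < n \<Longrightarrow> (\<Sum>i<n. v i * M i j) = 0) \<Longrightarrow> k < n \<Longrightarrow> v k = 0"
  shows "fdet n M \<noteq> 0"
proof
  assume 0: "fdet n M = 0"
  have "mat n n (\<lambda>(i, j). M j i) = transpose_mat (mat n n (\<lambda>(i, j). M i j))"
    by (rule eq_matI) auto
  then have "fdet n (\<lambda>i j. M j i) = 0"
    using 0 by (simp add: fdet_def det_transpose[of _ n])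
  then obtain v k where "k < n" "v k \<noteq> 0" "\<And>i. i < n \<Longrightarrow> (\<Sum>j<n. M j i * v j) = 0"
    using fdet_exists_kernel by blast
  then show False using ind[of v k] by (simp add: mult.commute)
qed

section \<open>Variables of differential polynomials\<close>

definition free_of :: "('w \<times> nat) set \<Rightarrow> ('w, 'r::comm_ring_1) dpoly \<Rightarrow> bool" where
  "free_of V p \<longleftrightarrow> (\<forall>m\<in>Poly_Mapping.keys p. Poly_Mapping.keys m \<inter> V = {})"

lemma free_of_add: "free_of V p \<Longrightarrow> free_of V q \<Longrightarrow> free_of V (p + q)"
  unfolding free_of_def using keys_add[of p q] by blast

lemma free_of_mult: "free_of V p \<Longrightarrow> free_of V q \<Longrightarrow> free_of V (p * q)"
  unfolding free_of_def
proof
  fix m assume p: "\<forall>m\<in>Poly_Mapping.keys p. Poly_Mapping.keys m \<inter> V = {}" "\<forall>m\<in>Poly_Mapping.keys q. Poly_Mapping.keys m \<inter> V = {}"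
    and "m \<in> Poly_Mapping.keys (p * q)"
  then obtain a b where "m = a + b" "a \<in> Poly_Mapping.keys p" "b \<in> Poly_Mapping.keys q"
    using keys_mult[of p q] by blast
  then show "Poly_Mapping.keys m \<inter> V = {}" using p keys_add[of a b] by blast
qed

lemma free_of_dconst [simp]: "free_of V (dconst c)"
  by (auto simp: free_of_def dconst_def split: if_splits)

lemma free_of_0 [simp]: "free_of V 0" and free_of_1 [simp]: "free_of V 1"
  by (auto simp: free_of_def)

lemma free_of_uminus: "free_of V p \<Longrightarrow> free_of V (- p)"
  by (auto simp: free_of_def in_keys_iff)

lemma free_of_diff: "free_of V p \<Longrightarrow> free_of V q \<Longrightarrow> free_of V (p - q)"
  using free_of_add[of V p "- q"] free_of_uminus[of V q] by simp

lemma free_of_sum: "(\<And>i. i \<in> I \<Longrightarrow> free_of V (f i)) \<Longrightarrow> free_of V (sum f I)"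
  by (induction I rule: infinite_finite_induct) (auto intro: free_of_add)

lemma free_of_prod: "(\<And>i. i \<in> I \<Longrightarrow> free_of V (f i)) \<Longrightarrow> free_of V (prod f I)"
  by (induction I rule: infinite_finite_induct) (auto intro: free_of_mult)

lemma free_of_dvar: "(w, k) \<notin> V \<Longrightarrow> free_of V (dvar w k)"
  by (auto simp: free_of_def dvar_def dmon_def)

lemma free_of_fdet:
  assumes "\<And>i j. i < n \<Longrightarrow> j < n \<Longrightarrow> free_of V (M i j)"
  shows "free_of V (fdet n M)"
proof -
  have "free_of V (signof p)" for p
    using signof_cases[of p] by (metis free_of_1 free_of_uminus)
  then show ?thesis
    unfolding fdet_expand using assms
    by (intro free_of_sum free_of_mult free_of_prod) (auto simp: permutes_in_image)
qed

lemma appearing_iff_not_free: "k \<in> appearing w p \<longleftrightarrow> \<not> free_of {(w, k)} p"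
  by (auto simp: appearing_def free_of_def)

lemma lookup_dvar_mult_shift:
  "Poly_Mapping.lookup (dvar w k * p) (dmon w k + m) = Poly_Mapping.lookup p m"
proof -
  have *: "dmon w k + n = dmon w k + m \<longleftrightarrow> n = m" for n by simp
  show ?thesis
    by (induction p rule: poly_mapping_single_induct)
       (auto simp: ring_distribs lookup_add dvar_def mult_single lookup_single *)
qed

text \<open>
  If a variable occurs in one row only, and there linearly, then the determinant is linear in it, and
  its coefficient is the determinant with that row replaced by the coefficient row.
\<close>

lemma appearing_fdet_iff:
  assumes r: "r < n"
    and Q: "\<And>j. j < n \<Longrightarrow> free_of {(w, k)} (Q j)" and b: "\<And>j. j < n \<Longrightarrow> free_of {(w, k)} (b j)"
    and M: "\<And>i j. i < n \<Longrightarrow> i \<noteq> r \<Longrightarrow> j < n \<Longrightarrow> free_of {(w, k)} (M i j)"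
  shows "k \<in> appearing w (fdet n (M(r := \<lambda>j. dvar w k * Q j + b j))) \<longleftrightarrow> fdet n (M(r := Q)) \<noteq> 0"
proof -
  let ?S = "fdet n (M(r := Q))" and ?T = "fdet n (M(r := b))"
  have T: "free_of {(w, k)} ?T" by (rule free_of_fdet) (use b M in auto)
  have eq: "fdet n (M(r := \<lambda>j. dvar w k * Q j + b j)) = dvar w k * ?S + ?T"
    by (rule fdet_row_split[OF r])
  show ?thesis
  proof
    assume "k \<in> appearing w (fdet n (M(r := \<lambda>j. dvar w k * Q j + b j)))"
    then show "?S \<noteq> 0" unfolding eq appearing_iff_not_free using T by auto
  next
    assume "?S \<noteq> 0"
    then obtain m where m: "m \<in> Poly_Mapping.keys ?S" by (metis all_not_in_conv keys_eq_empty)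
    have "(w, k) \<in> Poly_Mapping.keys (dmon w k + m)"
      by (simp add: in_keys_iff lookup_add dmon_def)
    moreover have "dmon w k + m \<notin> Poly_Mapping.keys ?T"
      using T calculation unfolding free_of_def by blast
    then have "Poly_Mapping.lookup ?T (dmon w k + m) = 0"
      by (simp add: not_in_keys_iff_lookup_eq_zero)
    then have "dmon w k + m \<in> Poly_Mapping.keys (dvar w k * ?S + ?T)"
      using m by (simp add: in_keys_iff lookup_add lookup_dvar_mult_shift)
    ultimately show "k \<in> appearing w (fdet n (M(r := \<lambda>j. dvar w k * Q j + b j)))"
      unfolding eq by (auto simp: appearing_def)
  qed
qed

lemma dord_eq_iff:
  assumes "\<And>k. m < k \<Longrightarrow> k \<notin> appearing w p"
  shows "dord w p = ereal (real m) \<longleftrightarrow> m \<in> appearing w p"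
proof -
  have sub: "appearing w p \<subseteq> {..m}" using assms by (auto simp: not_le[symmetric])
  then have fin: "finite (appearing w p)" by (rule finite_subset) auto
  show ?thesis
  proof
    assume "dord w p = ereal (real m)"
    then show "m \<in> appearing w p" using Max_in[OF fin] by (auto simp: dord_def split: if_splits)
  next
    assume m: "m \<in> appearing w p"
    then have "Max (appearing w p) = m" using sub by (intro Max_eqI fin) auto
    then show "dord w p = ereal (real m)" using m by (auto simp: dord_def)
  qed
qed

section \<open>The resultant as a determinant\<close>

text \<open>
  The last column, with index $N + 1$, belongs to the constant monomial.
\<close>

definition col_mon :: "nat \<Rightarrow> nat \<Rightarrow> (unit \<times> nat) \<Rightarrow>\<^sub>0 nat" where
  "col_mon N j = (if j \<le> N then dmon () (N - j) else 0)"

definition sylv_row :: "('r::comm_ring_1 \<Rightarrow> 'r) \<Rightarrow> nat \<Rightarrow> nat \<Rightarrow> 'r udpoly \<Rightarrow> 'r udpoly \<Rightarrow> nat \<Rightarrow> 'r udpoly" where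
  "sylv_row d m1 m2 f g i = (if i \<le> m2 then (dpoly_deriv d ^^ (m2 - i)) f else (dpoly_deriv d ^^ (m1 + m2 + 1 - i)) g)"

lemma dres_eq_fdet:
  assumes m: "m1 = Max (appearing () f)" "m2 = Max (appearing () g)"
  shows "dres d f g = fdet (m1 + m2 + 2) (\<lambda>i j. Poly_Mapping.lookup (sylv_row d m1 m2 f g i) (col_mon (m1 + m2) j))"
proof -
  let ?rows = "map (\<lambda>k. (dpoly_deriv d ^^ k) f) (rev [0..<Suc m2]) @ map (\<lambda>k. (dpoly_deriv d ^^ k) g) (rev [0..<Suc m1])"
  have row: "?rows ! i = sylv_row d m1 m2 f g i" if "i < m1 + m2 + 2" for i
    using that by (auto simp: nth_append sylv_row_def rev_nth simp del: upt_Suc)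
  have cr: "coeff_row N p ! j = Poly_Mapping.lookup p (col_mon N j)" if "j < N + 2" for N p j
    using that by (auto simp: coeff_row_def nth_append rev_nth col_mon_def simp del: upt_Suc)
  have "dres d f g = det (mat_of_rows_list (m1 + m2 + 2) (map (coeff_row (m1 + m2)) ?rows))"
    unfolding dres_def m Let_def ..
  also have "mat_of_rows_list (m1 + m2 + 2) (map (coeff_row (m1 + m2)) ?rows) =
     mat (m1 + m2 + 2) (m1 + m2 + 2) (\<lambda>(i, j). Poly_Mapping.lookup (sylv_row d m1 m2 f g i) (col_mon (m1 + m2) j))"
  proof (rule eq_matI)
    fix i j assume ij: "i < dim_row (mat (m1 + m2 + 2) (m1 + m2 + 2) (\<lambda>(i, j). Poly_Mapping.lookup (sylv_row d m1 m2 f g i) (col_mon (m1 + m2) j)))"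
      "j < dim_col (mat (m1 + m2 + 2) (m1 + m2 + 2) (\<lambda>(i, j). Poly_Mapping.lookup (sylv_row d m1 m2 f g i) (col_mon (m1 + m2) j)))"
    then have "i < length ?rows" by simp
    then have "map (coeff_row (m1 + m2)) ?rows ! i = coeff_row (m1 + m2) (sylv_row d m1 m2 f g i)"
      using row ij by (subst nth_map) auto
    then show "mat_of_rows_list (m1 + m2 + 2) (map (coeff_row (m1 + m2)) ?rows) $$ (i, j) =
       mat (m1 + m2 + 2) (m1 + m2 + 2) (\<lambda>(i, j). Poly_Mapping.lookup (sylv_row d m1 m2 f g i) (col_mon (m1 + m2) j)) $$ (i, j)"
      using ij cr by (simp add: mat_of_rows_list_def del: upt_Suc)
  qed (simp_all add: mat_of_rows_list_def)
  finally show ?thesis unfolding fdet_def .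
qed

section \<open>Generated differential fields\<close>

lemma field_ring_of_UNIV: "field (ring_of (UNIV :: 'a::field set))"
proof -
  have "cring (ring_of (UNIV :: 'a set))"
  proof (intro cringI abelian_groupI comm_monoidI)
    fix x :: 'a assume "x \<in> carrier (ring_of (UNIV :: 'a set))"
    show "\<exists>y\<in>carrier (ring_of (UNIV :: 'a set)). y \<oplus>\<^bsub>ring_of UNIV\<^esub> x = \<zero>\<^bsub>ring_of UNIV\<^esub>"
      by (rule bexI[of _ "- x"]) (auto simp: ring_of_def)
  qed (auto simp: ring_of_def algebra_simps)
  then show ?thesis
  proof (rule cring.cring_fieldI2)
    fix a :: 'a assume "a \<noteq> \<zero>\<^bsub>ring_of UNIV\<^esub>"
    then show "\<exists>b\<in>carrier (ring_of (UNIV :: 'a set)). a \<otimes>\<^bsub>ring_of UNIV\<^esub> b = \<one>\<^bsub>ring_of UNIV\<^esub>"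
      by (intro bexI[of _ "inverse a"]) (auto simp: ring_of_def)
  qed (auto simp: ring_of_def)
qed

lemma ring_of_UNIV_inv:
  assumes "(a :: 'a::field) \<noteq> 0" shows "inv\<^bsub>ring_of UNIV\<^esub> a = inverse a"
proof -
  interpret F: field "ring_of (UNIV :: 'a set)" by (rule field_ring_of_UNIV)
  show ?thesis
    by (rule F.comm_inv_char) (use assms in \<open>auto simp: ring_of_def\<close>)
qed

lemma ring_of_UNIV_a_inv: "\<ominus>\<^bsub>ring_of UNIV\<^esub> (a :: 'a::field) = - a"
proof -
  interpret F: field "ring_of (UNIV :: 'a set)" by (rule field_ring_of_UNIV)
  show ?thesis
    using F.minus_equality[of "- a" a] by (auto simp: ring_of_def)
qed

lemma diff_subfield_iff: "diff_subfield (ring_of UNIV) dE K \<longleftrightarrow> dsubfield dE (K :: 'a::field set)"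
proof -
  interpret F: field "ring_of (UNIV :: 'a set)" by (rule field_ring_of_UNIV)
  have r: "carrier (ring_of (UNIV :: 'a set)) = UNIV" "\<one>\<^bsub>ring_of (UNIV :: 'a set)\<^esub> = 1" "\<zero>\<^bsub>ring_of (UNIV :: 'a set)\<^esub> = 0"
    "\<And>x y. x \<oplus>\<^bsub>ring_of (UNIV :: 'a set)\<^esub> y = x + y" "\<And>x y. x \<otimes>\<^bsub>ring_of (UNIV :: 'a set)\<^esub> y = x * y"
    by (auto simp: ring_of_def)
  show ?thesis
  proof
    assume L: "diff_subfield (ring_of UNIV) dE K"
    then have S: "subfield K (ring_of UNIV)" and D: "dE ` K \<subseteq> K" by (auto simp: diff_subfield_def)
    note E = subringE[OF subfieldE(1)[OF S], unfolded r]
    have "inverse a \<in> K" if "a \<in> K" for a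
    proof (cases "a = 0")
      case False
      then show ?thesis using F.subfield_m_inv(1)[OF S, of a] that by (simp add: r ring_of_UNIV_inv)
    qed (use E in simp)
    moreover have "- a \<in> K" if "a \<in> K" for a using E(5)[OF that] by (simp add: ring_of_UNIV_a_inv)
    ultimately show "dsubfield dE K" using E D by (auto simp: dsubfield_def)
  next
    assume K: "dsubfield dE K"
    have "subfield K (ring_of UNIV)"
    proof (intro F.subfieldI' F.subringI)
      show "inv\<^bsub>ring_of UNIV\<^esub> k \<in> K" if "k \<in> K - {\<zero>\<^bsub>ring_of UNIV\<^esub>}" for k
        using that dsubfieldD[OF K] by (simp add: r ring_of_UNIV_inv)
    qed (use dsubfieldD[OF K] in \<open>auto simp: r ring_of_UNIV_a_inv\<close>)
    then show "diff_subfield (ring_of UNIV) dE K" using dsubfieldD[OF K] by (auto simp: diff_subfield_def)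
  qed
qed

lemma dsubfield_Inter: "(\<And>K. K \<in> \<K> \<Longrightarrow> dsubfield d K) \<Longrightarrow> dsubfield d (\<Inter>\<K>)"
  unfolding dsubfield_def
  by (intro conjI ballI InterI) (auto intro: dsubfieldD(1,3-7))

lemma dsubfield_adjoin: "dsubfield dE (adjoin \<iota> dE S)"
  unfolding adjoin_def dfield_gen_def
  by (subst diff_subfield_iff[symmetric], rule hull_in) (auto simp: diff_subfield_iff intro: dsubfield_Inter)

lemma adjoin_inc: "range \<iota> \<subseteq> adjoin \<iota> dE S" "S \<subseteq> adjoin \<iota> dE S"
  unfolding adjoin_def dfield_gen_def by (auto intro: hull_inc)

lemma adjoin_minimal: "dsubfield dE K \<Longrightarrow> range \<iota> \<subseteq> K \<Longrightarrow> S \<subseteq> K \<Longrightarrow> adjoin \<iota> dE S \<subseteq> K"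
  unfolding adjoin_def dfield_gen_def by (rule hull_minimal) (auto simp: diff_subfield_iff)

section \<open>Linear parts\<close>

definition linear_part :: "'r::comm_ring_1 udpoly \<Rightarrow> 'r poly" where
  "linear_part f = Abs_poly (\<lambda>k. Poly_Mapping.lookup f (dmon () k))"

lemma coeff_linear_part: "coeff (linear_part f) k = Poly_Mapping.lookup f (dmon () k)"
proof -
  have "finite {k. Poly_Mapping.lookup f (dmon () k) \<noteq> 0}"
    by (rule finite_imageD[of "dmon ()"], rule finite_subset[of _ "Poly_Mapping.keys f"])
       (auto simp: in_keys_iff inj_on_def)
  then have "\<forall>\<^sub>\<infinity>k. Poly_Mapping.lookup f (dmon () k) = 0" by (simp add: MOST_iff_cofinite)
  then show ?thesis unfolding linear_part_def by (simp add: Abs_poly_inverse)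
qed

lemma linear_part_deriv: "derivation d \<Longrightarrow> linear_part (dpoly_deriv d f) = delta_comp d (linear_part f)"
  by (rule poly_eqI) (simp add: coeff_linear_part coeff_delta_comp lookup_dpoly_deriv_dmon split: nat.splits)

lemma is_hom_dconst: "is_hom dconst"
  by (auto simp: is_hom_def dconst_def single_add mult_single)

lemma is_hom_lookup_zero: "is_hom (\<lambda>p :: ('w, 'r::comm_ring_1) dpoly. Poly_Mapping.lookup p 0)"
  by (auto simp: is_hom_def lookup_add lookup_mult_zero lookup_one)

section \<open>The differential of a differential rational function\<close>

locale generic_point =
  fixes d :: "'f::field_char_0 \<Rightarrow> 'f" and dE :: "'e::field_char_0 \<Rightarrow> 'e" and \<iota> :: "'f \<Rightarrow> 'e" and u :: 'e
  assumes d: "derivation d" and dE: "derivation dE" and \<iota>: "is_hom \<iota>" and \<iota>_d: "\<And>c. \<iota> (d c) = dE (\<iota> c)"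
    and transc: "diff_transcendental \<iota> dE u"
begin

definition ev :: "'f udpoly \<Rightarrow> 'e" where "ev p = dpoly_eval \<iota> dE (\<lambda>_. u) p"

text \<open>
  The value of \<open>p\<close> at $u + v$ for a new differential indeterminate $v$. Its linear part in $v$ is the
  differential of \<open>p\<close>, so the rules for partial derivatives follow from the fact that evaluation is a
  differential homomorphism.
\<close>

definition taylor :: "'f udpoly \<Rightarrow> 'e udpoly" where
  "taylor p = dpoly_eval (dconst \<circ> \<iota>) (dpoly_deriv dE) (\<lambda>_. dconst u + dvar () 0) p"

definition grad :: "'f udpoly \<Rightarrow> 'e poly" where "grad p = linear_part (taylor p)"

lemma is_hom_ev: "is_hom ev" unfolding ev_def[abs_def] by (rule is_hom_dpoly_eval[OF \<iota>])

lemma is_hom_taylor: "is_hom taylor"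
  unfolding taylor_def[abs_def] by (intro is_hom_dpoly_eval is_hom_compose is_hom_dconst \<iota>)

lemma ev_eq_0: "ev p = 0 \<Longrightarrow> p = 0"
  using transc by (auto simp: diff_transcendental_def ev_def)

lemma ev_deriv: "ev (dpoly_deriv d p) = dE (ev p)"
  unfolding ev_def by (rule dpoly_eval_deriv[OF \<iota> d dE \<iota>_d])

lemma taylor_deriv: "taylor (dpoly_deriv d p) = dpoly_deriv dE (taylor p)"
  unfolding taylor_def
  by (rule dpoly_eval_deriv) (auto simp: d derivation_dpoly_deriv[OF dE] is_hom_compose is_hom_dconst \<iota> \<iota>_d dpoly_deriv_dconst[OF dE])

lemma lookup_taylor_zero: "Poly_Mapping.lookup (taylor p) 0 = ev p"
proof -
  let ?h = "\<lambda>q :: 'e udpoly. Poly_Mapping.lookup q 0"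
  have "Poly_Mapping.lookup (taylor p) 0 =
    dpoly_eval (?h \<circ> (dconst \<circ> \<iota>)) dE (?h \<circ> (\<lambda>_. dconst u + dvar () 0)) p"
    unfolding taylor_def
    using dpoly_eval_compose[of ?h "dpoly_deriv dE" dE "dconst \<circ> \<iota>" "\<lambda>_. dconst u + dvar () 0" p,
      OF is_hom_lookup_zero lookup_dpoly_deriv_zero[OF dE]] .
  then show ?thesis by (simp add: ev_def comp_def lookup_dconst lookup_add lookup_dvar)
qed

lemma grad_simps:
  "grad (p + q) = grad p + grad q" "grad (p - q) = grad p - grad q"
  "grad (p * q) = Polynomial.smult (ev p) (grad q) + Polynomial.smult (ev q) (grad p)"
  "grad (dconst c) = 0" "grad (dpoly_deriv d p) = delta_comp dE (grad p)" "grad (dvar () 0) = 1"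
proof -
  show "grad (p + q) = grad p + grad q" "grad (p - q) = grad p - grad q"
    by (rule poly_eqI; simp add: grad_def coeff_linear_part is_homD[OF is_hom_taylor] lookup_add lookup_minus)+
  show "grad (p * q) = Polynomial.smult (ev p) (grad q) + Polynomial.smult (ev q) (grad p)"
    by (rule poly_eqI) (simp add: grad_def coeff_linear_part is_homD[OF is_hom_taylor] lookup_mult_dmon lookup_taylor_zero)
  show "grad (dpoly_deriv d p) = delta_comp dE (grad p)"
    by (simp add: grad_def taylor_deriv linear_part_deriv[OF dE])
  show "grad (dconst c) = 0"
    by (rule poly_eqI)
       (simp add: grad_def coeff_linear_part taylor_def dpoly_eval_dconst is_hom_compose is_hom_dconst \<iota> lookup_dconst)
  have "taylor (dvar () 0) = dconst u + dvar () 0"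
    unfolding taylor_def by (subst dpoly_eval_dvar) (auto simp: is_hom_compose is_hom_dconst \<iota>)
  then show "grad (dvar () 0) = 1"
    by (intro poly_eqI) (simp add: grad_def coeff_linear_part lookup_add lookup_dconst lookup_dvar)
qed

lemma ev_simps:
  "ev (p + q) = ev p + ev q" "ev (p - q) = ev p - ev q" "ev (p * q) = ev p * ev q" "ev (dconst c) = \<iota> c" "ev 1 = 1" "ev 0 = 0"
  "ev (dvar () k) = (dE ^^ k) u"
  using is_homD[OF is_hom_ev] by (auto simp: ev_def dpoly_eval_dconst[OF \<iota>] dpoly_eval_dvar[OF \<iota>])

text \<open>
  Differentiating $p = a q$ determines the differential of a quotient $a = p/q$. As a relation this
  avoids any choice of numerator and denominator.
\<close>

definition has_diff :: "'e \<Rightarrow> 'e poly \<Rightarrow> bool" where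
  "has_diff a m \<longleftrightarrow> (\<exists>p q. ev q \<noteq> 0 \<and> ev p = a * ev q \<and>
     (\<forall>i. coeff (grad p) i = ev q * coeff m i + a * coeff (grad q) i))"

text \<open>
  Two representations of $a$ satisfy $p q' = p' q$ as differential polynomials, as $u$ is
  differentially transcendental; the differentials of both sides are then equal.
\<close>

lemma has_diff_unique:
  assumes "has_diff a m" "has_diff a m'" shows "m = m'"
proof -
  obtain p q p' q' where 1: "ev q \<noteq> 0" "ev p = a * ev q" "\<And>i. coeff (grad p) i = ev q * coeff m i + a * coeff (grad q) i"
    and 2: "ev q' \<noteq> 0" "ev p' = a * ev q'" "\<And>i. coeff (grad p') i = ev q' * coeff m' i + a * coeff (grad q') i"
    using assms unfolding has_diff_def by blast
  have "ev (p * q' - p' * q) = 0" by (simp add: ev_simps 1 2)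
  then have eq: "p * q' = p' * q" using ev_eq_0 by fastforce
  show ?thesis
  proof (rule poly_eqI)
    fix i
    have "coeff (grad (p * q')) i = coeff (grad (p' * q)) i" by (simp add: eq)
    then have "ev q * ev q' * coeff m i = ev q * ev q' * coeff m' i"
      by (simp add: grad_simps 1 2 algebra_simps)
    then show "coeff m i = coeff m' i" using 1(1) 2(1) by simp
  qed
qed

lemma has_diff_ev: "has_diff (ev p) (grad p)"
  unfolding has_diff_def
  by (intro exI[of _ p] exI[of _ 1]) (use grad_simps(4)[of 1] in \<open>simp add: ev_simps dconst_def\<close>)

lemma has_diff_add:
  assumes "has_diff a m" "has_diff b n" shows "has_diff (a + b) (m + n)"
proof -
  obtain p q p' q' where "ev q \<noteq> 0" "ev p = a * ev q" "\<And>i. coeff (grad p) i = ev q * coeff m i + a * coeff (grad q) i"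
    "ev q' \<noteq> 0" "ev p' = b * ev q'" "\<And>i. coeff (grad p') i = ev q' * coeff n i + b * coeff (grad q') i"
    using assms unfolding has_diff_def by blast
  then show ?thesis
    unfolding has_diff_def
    by (intro exI[of _ "p * q' + p' * q"] exI[of _ "q * q'"]) (simp add: ev_simps grad_simps algebra_simps)
qed

lemma has_diff_mult:
  assumes "has_diff a m" "has_diff b n" shows "has_diff (a * b) (Polynomial.smult a n + Polynomial.smult b m)"
proof -
  obtain p q p' q' where "ev q \<noteq> 0" "ev p = a * ev q" "\<And>i. coeff (grad p) i = ev q * coeff m i + a * coeff (grad q) i"
    "ev q' \<noteq> 0" "ev p' = b * ev q'" "\<And>i. coeff (grad p') i = ev q' * coeff n i + b * coeff (grad q') i"
    using assms unfolding has_diff_def by blast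
  then show ?thesis
    unfolding has_diff_def
    by (intro exI[of _ "p * p'"] exI[of _ "q * q'"]) (simp add: ev_simps grad_simps algebra_simps)
qed

lemma has_diff_inverse:
  assumes "has_diff a m" "a \<noteq> 0" shows "has_diff (inverse a) (Polynomial.smult (- inverse a * inverse a) m)"
proof -
  obtain p q where "ev q \<noteq> 0" "ev p = a * ev q" "\<And>i. coeff (grad p) i = ev q * coeff m i + a * coeff (grad q) i"
    using assms unfolding has_diff_def by blast
  then show ?thesis using assms(2)
    unfolding has_diff_def
    by (intro exI[of _ q] exI[of _ p]) (simp add: field_simps)
qed

text \<open>
  By the quotient rule, $\delta(a) = (\delta(p) q - p\, \delta(q)) / q^2$ represents $\delta(a)$.
\<close>

lemma has_diff_deriv:
  assumes "has_diff a m" shows "has_diff (dE a) (delta_comp dE m)"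
proof -
  obtain p q where *: "ev q \<noteq> 0" "ev p = a * ev q" "\<And>i. coeff (grad p) i = ev q * coeff m i + a * coeff (grad q) i"
    using assms unfolding has_diff_def by blast
  have g: "grad p = Polynomial.smult (ev q) m + Polynomial.smult a (grad q)" by (rule poly_eqI) (simp add: *)
  define p' where "p' = dpoly_deriv d p * q - p * dpoly_deriv d q"
  have "ev p' = dE a * ev (q * q)"
    by (simp add: p'_def ev_simps ev_deriv *(2) derivationD[OF dE] algebra_simps)
  moreover have two: "coeff (2 * g) i = 2 * coeff g i" for g :: "'e poly" and i
    by (metis coeff_add mult_2)
  have "coeff (grad p') i = ev (q * q) * coeff (delta_comp dE m) i + dE a * coeff (grad (q * q)) i" for i
    by (simp add: p'_def ev_simps grad_simps ev_deriv *(2) g delta_comp_add[OF dE] delta_comp_smult[OF dE] derivationD[OF dE] algebra_simps two)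
  ultimately show ?thesis
    unfolding has_diff_def using *(1) by (intro exI[of _ p'] exI[of _ "q * q"]) (simp add: ev_simps)
qed

definition diff_of :: "'e \<Rightarrow> 'e poly" where "diff_of a = (THE m. has_diff a m)"

lemma diff_of_eq: "has_diff a m \<Longrightarrow> diff_of a = m"
  unfolding diff_of_def using has_diff_unique by blast

text \<open>
  This is how membership of a differential in a left ideal spreads from generators to the whole
  differential field that they generate.
\<close>

lemma dsubfield_diff_in:
  assumes J0: "0 \<in> J" and Jadd: "\<And>p q. p \<in> J \<Longrightarrow> q \<in> J \<Longrightarrow> p + q \<in> J"
    and Jsmult: "\<And>c p. p \<in> J \<Longrightarrow> Polynomial.smult c p \<in> J" and JsD: "\<And>p. p \<in> J \<Longrightarrow> delta_comp dE p \<in> J"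
  shows "dsubfield dE {a. \<exists>m\<in>J. has_diff a m}"
proof -
  have c: "has_diff (\<iota> c) 0" for c using has_diff_ev[of "dconst c"] by (simp add: ev_simps grad_simps)
  have c1: "has_diff 1 0" "has_diff (- 1) 0"
    using c[of 1] c[of "- 1"] by (auto simp: is_homD[OF \<iota>])
  have "\<exists>m\<in>J. has_diff (- a) m" if "has_diff a m" "m \<in> J" for a m
    using has_diff_mult[OF c1(2) that(1)] Jsmult[OF that(2), of "- 1"] by auto
  moreover have "\<exists>m\<in>J. has_diff (inverse a) m" if "has_diff a m" "m \<in> J" for a m
  proof (cases "a = 0")
    case False
    then show ?thesis using has_diff_inverse[OF that(1)] Jsmult[OF that(2)] by blast
  qed (use that in auto)
  moreover have "\<exists>m\<in>J. has_diff (dE a) m" if "has_diff a m" "m \<in> J" for a m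
    using has_diff_deriv[OF that(1)] JsD[OF that(2)] by blast
  moreover have "\<exists>m\<in>J. has_diff (a + b) m" "\<exists>m\<in>J. has_diff (a * b) m"
    if "has_diff a m" "m \<in> J" "has_diff b n" "n \<in> J" for a b m n
    using has_diff_add[OF that(1,3)] has_diff_mult[OF that(1,3)] Jadd[OF that(2,4)]
      Jadd[OF Jsmult[OF that(4)] Jsmult[OF that(2)]] by blast+
  ultimately show ?thesis unfolding dsubfield_def using c1(1) J0 by blast
qed

end

section \<open>Leibniz rule\<close>

lemma derivation_funpow_mult:
  assumes D: "derivation (D :: 'a::comm_ring_1 \<Rightarrow> 'a)"
  shows "(D ^^ n) (a * b) = (\<Sum>k\<le>n. of_nat (n choose k) * (D ^^ k) a * (D ^^ (n - k)) b)"
proof (induction n)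
  case (Suc n)
  let ?t = "\<lambda>k. (D ^^ k) a * (D ^^ (Suc n - k)) b"
  have "(D ^^ Suc n) (a * b) = (\<Sum>k\<le>n. D (of_nat (n choose k) * ((D ^^ k) a * (D ^^ (n - k)) b)))"
    by (simp add: Suc derivation_sum[OF D] mult.assoc)
  also have "\<dots> = (\<Sum>k\<le>n. of_nat (n choose k) * ?t (Suc k)) + (\<Sum>k\<le>n. of_nat (n choose k) * ?t k)"
    by (simp add: derivationD[OF D] derivation_of_nat[OF D] Suc_diff_le ring_distribs sum.distrib)
  also have "(\<Sum>k\<le>n. of_nat (n choose k) * ?t k) = (\<Sum>k\<le>Suc n. of_nat (n choose k) * ?t k)"
    by (simp add: binomial_eq_0)
  also have "\<dots> = ?t 0 + (\<Sum>k\<le>n. of_nat (n choose Suc k) * ?t (Suc k))"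
    by (subst sum.atMost_Suc_shift) simp
  also have "(\<Sum>k\<le>n. of_nat (n choose k) * ?t (Suc k)) + (?t 0 + (\<Sum>k\<le>n. of_nat (n choose Suc k) * ?t (Suc k)))
    = ?t 0 + (\<Sum>k\<le>n. of_nat (Suc n choose Suc k) * ?t (Suc k))"
    by (simp add: ring_distribs sum.distrib algebra_simps)
  also have "\<dots> = (\<Sum>k\<le>Suc n. of_nat (Suc n choose k) * ?t k)"
    by (subst sum.atMost_Suc_shift) simp
  finally show ?case by (simp add: mult.assoc)
qed simp

section \<open>Linear functionals on a field extension\<close>

text \<open>
  The field $\mathcal{E}$ is a vector space over $\mathcal{F}$ through \<open>\<iota>\<close>. Functionals transport
  linear relations with coefficients in $\mathcal{E}$ to relations over $\mathcal{F}$.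
\<close>

lemma exists_functional:
  assumes \<iota>: "is_hom (\<iota> :: 'f::field \<Rightarrow> 'e::field)"
  shows "z \<noteq> 0 \<Longrightarrow> \<exists>\<psi>. (\<forall>x y. \<psi> (x + y) = \<psi> x + \<psi> y) \<and> (\<forall>c x. \<psi> (\<iota> c * x) = c * \<psi> x) \<and> \<psi> z = 1"
    and "y \<notin> range \<iota> \<Longrightarrow> \<exists>\<psi>. (\<forall>x y. \<psi> (x + y) = \<psi> x + \<psi> y) \<and> (\<forall>c x. \<psi> (\<iota> c * x) = c * \<psi> x) \<and> \<psi> 1 = a \<and> \<psi> y = b"
proof -
  interpret V: vector_space_pair "\<lambda>(c::'f) (x::'e). \<iota> c * x" "(*) :: 'f \<Rightarrow> 'f \<Rightarrow> 'f"
    by unfold_locales (auto simp: is_homD[OF \<iota>] algebra_simps)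
  have ex: "\<exists>\<psi>. (\<forall>x y. \<psi> (x + y) = \<psi> x + \<psi> y) \<and> (\<forall>c x. \<psi> (\<iota> c * x) = c * \<psi> x) \<and> (\<forall>x\<in>B. \<psi> x = f x)"
    if B: "V.vs1.independent B" for B and f :: "'e \<Rightarrow> 'f"
  proof -
    obtain \<psi> where \<psi>: "Vector_Spaces.linear (\<lambda>(c::'f) (x::'e). \<iota> c * x) ((*) :: 'f \<Rightarrow> 'f \<Rightarrow> 'f) \<psi>" "\<forall>x\<in>B. \<psi> x = f x"
      using V.linear_independent_extend[OF B] by blast
    then show ?thesis using V.linear_add[OF \<psi>(1)] V.linear_scale[OF \<psi>(1)] by blast
  qed
  show "\<exists>\<psi>. (\<forall>x y. \<psi> (x + y) = \<psi> x + \<psi> y) \<and> (\<forall>c x. \<psi> (\<iota> c * x) = c * \<psi> x) \<and> \<psi> z = 1" if "z \<noteq> 0"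
    using ex[of "{z}" "\<lambda>_. 1"] that by (auto simp: V.vs1.dependent_single)
  show "\<exists>\<psi>. (\<forall>x y. \<psi> (x + y) = \<psi> x + \<psi> y) \<and> (\<forall>c x. \<psi> (\<iota> c * x) = c * \<psi> x) \<and> \<psi> 1 = a \<and> \<psi> y = b" if y: "y \<notin> range \<iota>"
  proof -
    have "y \<notin> V.vs1.span {1}" using y by (auto simp: V.vs1.span_singleton)
    then have "V.vs1.independent {y, 1}" by (auto simp: V.vs1.independent_insert V.vs1.dependent_single)
    moreover have "y \<noteq> 1" using y is_homD(1)[OF \<iota>] by (metis rangeI)
    ultimately show ?thesis using ex[of "{y, 1}" "\<lambda>x. if x = 1 then a else b"] by auto
  qed
qed

section \<open>Linear differential polynomials\<close>

lemma linear_keys: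
  fixes H :: "'r::comm_ring_1 udpoly"
  assumes H: "total_degree H \<le> 1" and m: "m \<in> Poly_Mapping.keys H"
  shows "m = 0 \<or> (\<exists>k. m = dmon () k)"
proof (cases "m = 0")
  case False
  then obtain v where v: "v \<in> Poly_Mapping.keys m" by (metis all_not_in_conv keys_eq_empty)
  have le: "(\<Sum>v\<in>Poly_Mapping.keys m. Poly_Mapping.lookup m v) \<le> 1"
    using H m unfolding total_degree_def by simp
  have "m = Poly_Mapping.single v 1"
  proof (rule poly_mapping_eqI)
    fix t
    have s: "(\<Sum>v\<in>Poly_Mapping.keys m. Poly_Mapping.lookup m v) =
       Poly_Mapping.lookup m v + (\<Sum>v\<in>Poly_Mapping.keys m - {v}. Poly_Mapping.lookup m v)"
      using v by (intro sum.remove) auto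
    have "Poly_Mapping.lookup m v \<noteq> 0" using v by (simp add: in_keys_iff)
    then have 1: "Poly_Mapping.lookup m v = 1" "(\<Sum>v\<in>Poly_Mapping.keys m - {v}. Poly_Mapping.lookup m v) = 0"
      using le s by linarith+
    show "Poly_Mapping.lookup m t = Poly_Mapping.lookup (Poly_Mapping.single v 1) t"
    proof (cases "t = v")
      case False
      have "\<forall>t\<in>Poly_Mapping.keys m - {v}. Poly_Mapping.lookup m t = 0"
        using 1(2) by (simp only: sum_eq_0_iff finite_Diff finite_keys)
      then have "Poly_Mapping.lookup m t = 0"
        using False not_in_keys_iff_lookup_eq_zero[of t m] by blast
      then show ?thesis using False by (simp add: lookup_single)
    qed (simp add: 1)
  qed
  then show ?thesis by (cases v) (auto simp: dmon_def)
qed simp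

lemma linear_decomp:
  fixes H :: "'r::comm_ring_1 udpoly"
  assumes H: "total_degree H \<le> 1" and n: "Polynomial.degree (linear_part H) \<le> n"
  shows "H = dconst (Poly_Mapping.lookup H 0) + (\<Sum>k\<le>n. dconst (coeff (linear_part H) k) * dvar () k)"
proof (rule poly_mapping_eqI)
  fix m
  have s: "Poly_Mapping.lookup (\<Sum>k\<le>n. dconst (coeff (linear_part H) k) * dvar () k) m =
     (\<Sum>k\<le>n. if m = dmon () k then coeff (linear_part H) k else 0)"
    by (simp add: lookup_sum lookup_dconst_mult lookup_dvar if_distrib cong: if_cong)
  consider "m = 0" | k where "m = dmon () k" | "m \<noteq> 0" "\<And>k. m \<noteq> dmon () k" by blast
  then show "Poly_Mapping.lookup H m = Poly_Mapping.lookup (dconst (Poly_Mapping.lookup H 0) + (\<Sum>k\<le>n. dconst (coeff (linear_part H) k) * dvar () k)) m"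
  proof cases
    case 1
    show ?thesis using s by (simp add: 1 lookup_add lookup_dconst)
  next
    case (2 k)
    have "(\<Sum>i\<le>n. if m = dmon () i then coeff (linear_part H) i else 0) = (\<Sum>i\<le>n. if i = k then coeff (linear_part H) i else 0)"
      by (rule sum.cong) (auto simp: 2)
    also have "\<dots> = coeff (linear_part H) k"
    proof (cases "k \<le> n")
      case False
      then have "coeff (linear_part H) k = 0" using n by (intro coeff_eq_0) auto
      then show ?thesis using False by simp
    qed simp
    finally have "Poly_Mapping.lookup (\<Sum>k\<le>n. dconst (coeff (linear_part H) k) * dvar () k) m = coeff (linear_part H) k"
      by (simp only: s)
    then show ?thesis unfolding lookup_add using 2 by (simp add: lookup_dconst coeff_linear_part)
  next
    case 3
    then have "Poly_Mapping.lookup H m = 0" using linear_keys[OF H, of m] by (auto simp: in_keys_iff)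
    then show ?thesis using 3 by (simp add: lookup_add s lookup_dconst)
  qed
qed

lemma appearing_linear:
  assumes "total_degree H \<le> 1" shows "k \<in> appearing () H \<longleftrightarrow> coeff (linear_part H) k \<noteq> 0"
proof
  assume "k \<in> appearing () H"
  then obtain m where m: "m \<in> Poly_Mapping.keys H" "((), k) \<in> Poly_Mapping.keys m" by (auto simp: appearing_def)
  then have "m = dmon () k" using linear_keys[OF assms m(1)] by (auto simp: dmon_def)
  then show "coeff (linear_part H) k \<noteq> 0" using m by (simp add: coeff_linear_part in_keys_iff)
next
  assume "coeff (linear_part H) k \<noteq> 0"
  then show "k \<in> appearing () H"
    unfolding appearing_def coeff_linear_part lookup_not_eq_zero_eq_in_keys
    by (intro CollectI bexI[of _ "dmon () k"]) (simp_all add: dmon_def)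
qed

text \<open>
  Substituting $u^{(k)} = c^k t$ maps $Q$ to $b + t\, f(c)$, where $b$ is the constant coefficient of
  $Q$ and $f$ the polynomial with the linear coefficients of $Q$. If $f$ is nonzero, then $c$ and $t$
  can be chosen such that this vanishes, which is impossible for a unit.
\<close>

lemma linear_unit:
  fixes Q :: "'f::field_char_0 udpoly"
  assumes Q: "total_degree Q \<le> 1" "Q dvd 1" shows "linear_part Q = 0"
proof (rule ccontr)
  assume nz: "linear_part Q \<noteq> 0"
  obtain h where h: "1 = Q * h" using Q(2) by (auto elim: dvdE)
  have "infinite (UNIV :: 'f set)" by (rule infinite_UNIV_char_0)
  then obtain c where c: "poly (linear_part Q) c \<noteq> 0"
    using poly_roots_finite[OF nz] by (metis (mono_tags, lifting) UNIV_eq_I mem_Collect_eq)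
  define t where "t = - Poly_Mapping.lookup Q 0 / poly (linear_part Q) c"
  define E where "E = dpoly_eval id ((*) c) (\<lambda>_::unit. t)"
  have hid: "is_hom (id :: 'f \<Rightarrow> 'f)" by (simp add: is_hom_def)
  have E: "is_hom E" unfolding E_def by (rule is_hom_dpoly_eval[OF hid])
  have pw: "((*) c ^^ k) t = c ^ k * t" for k by (induction k) auto
  have "E Q = Poly_Mapping.lookup Q 0 + (\<Sum>k\<le>Polynomial.degree (linear_part Q). coeff (linear_part Q) k * (c ^ k * t))"
    by (subst linear_decomp[OF Q(1) order_refl], simp only: is_homD[OF E])
       (simp add: E_def dpoly_eval_dconst[OF hid] dpoly_eval_dvar[OF hid] pw)
  also have "(\<Sum>k\<le>Polynomial.degree (linear_part Q). coeff (linear_part Q) k * (c ^ k * t)) = poly (linear_part Q) c * t"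
    by (simp add: poly_altdef sum_distrib_right mult.assoc)
  also have "Poly_Mapping.lookup Q 0 + poly (linear_part Q) c * t = 0" using c by (simp add: t_def)
  finally have "E 1 = 0" unfolding h by (simp add: is_homD[OF E])
  then show False by (simp add: is_homD[OF E])
qed

text \<open>
  For linear $P$ and $Q$ this says that \<open>m\<close> is the order of the pair; unlike \<open>rat_ord\<close> it is a
  natural number and speaks about coefficients.
\<close>

definition pair_order :: "'r::comm_ring_1 udpoly \<Rightarrow> 'r udpoly \<Rightarrow> nat \<Rightarrow> bool" where
  "pair_order P Q m \<longleftrightarrow> (\<forall>k>m. coeff (linear_part P) k = 0 \<and> coeff (linear_part Q) k = 0) \<and> (coeff (linear_part P) m \<noteq> 0 \<or> coeff (linear_part Q) m \<noteq> 0)"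

lemma dord_linear:
  assumes "total_degree H \<le> 1"
  shows "dord () H = (if linear_part H = 0 then - \<infinity> else ereal (real (Polynomial.degree (linear_part H))))"
proof (cases "linear_part H = 0")
  case True
  then have "appearing () H = {}" using appearing_linear[OF assms] by auto
  then show ?thesis using True by (simp add: dord_def)
next
  case False
  have "dord () H = ereal (real (Polynomial.degree (linear_part H)))"
    using False by (subst dord_eq_iff) (auto simp: appearing_linear[OF assms] coeff_eq_0)
  then show ?thesis using False by simp
qed

lemma pair_order_exists:
  assumes P: "total_degree P \<le> 1" and Q: "total_degree Q \<le> 1" and ge: "rat_ord P Q \<ge> 0"
  obtains m where "rat_ord P Q = ereal (real m)" "pair_order P Q m"
proof -
  consider "linear_part P = 0" "linear_part Q = 0" | "linear_part P = 0" "linear_part Q \<noteq> 0" | "linear_part P \<noteq> 0" "linear_part Q = 0" | "linear_part P \<noteq> 0" "linear_part Q \<noteq> 0" by blast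
  then show ?thesis
  proof cases
    case 1
    then show ?thesis using ge by (simp add: rat_ord_def dord_linear[OF P] dord_linear[OF Q])
  next
    case 2
    then show ?thesis
      by (intro that[of "Polynomial.degree (linear_part Q)"]) (auto simp: rat_ord_def dord_linear[OF P] dord_linear[OF Q] pair_order_def coeff_eq_0)
  next
    case 3
    then show ?thesis
      by (intro that[of "Polynomial.degree (linear_part P)"]) (auto simp: rat_ord_def dord_linear[OF P] dord_linear[OF Q] pair_order_def coeff_eq_0)
  next
    case 4
    then show ?thesis
      by (intro that[of "max (Polynomial.degree (linear_part P)) (Polynomial.degree (linear_part Q))"])
         (auto simp: rat_ord_def dord_linear[OF P] dord_linear[OF Q] pair_order_def coeff_eq_0 max_def)
  qed
qed

section \<open>Implicit polynomials\<close>

lemma lookup_map_dconst: "Poly_Mapping.lookup (Poly_Mapping.map dconst H) m = dconst (Poly_Mapping.lookup H m)"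
  by (simp add: map.rep_eq when_def dconst_def)

lemma lookup_implicit:
  "Poly_Mapping.lookup (implicit_poly w P Q) m = dvar w 0 * dconst (Poly_Mapping.lookup Q m) - dconst (Poly_Mapping.lookup P m)"
  by (simp add: implicit_poly_def lookup_minus lookup_dconst_mult lookup_map_dconst)

text \<open>
  In $x q - p$ with constants $p, q$ nothing cancels.
\<close>

lemma lookup_implicit_eq_0:
  "Poly_Mapping.lookup (implicit_poly w P Q) m = 0 \<longleftrightarrow> Poly_Mapping.lookup Q m = 0 \<and> Poly_Mapping.lookup P m = 0"
proof
  assume "Poly_Mapping.lookup (implicit_poly w P Q) m = 0"
  then have *: "dvar w 0 * dconst (Poly_Mapping.lookup Q m) = dconst (Poly_Mapping.lookup P m)" by (simp add: lookup_implicit)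
  have "Poly_Mapping.lookup (dvar w 0 * dconst (Poly_Mapping.lookup Q m)) (dmon w 0) = Poly_Mapping.lookup Q m"
    by (simp add: lookup_mult_dmon lookup_dconst lookup_dvar)
  moreover have "Poly_Mapping.lookup (dvar w 0 * dconst (Poly_Mapping.lookup Q m)) 0 = 0"
    by (simp add: lookup_mult_zero lookup_dvar)
  ultimately show "Poly_Mapping.lookup Q m = 0 \<and> Poly_Mapping.lookup P m = 0"
    using * by (simp add: lookup_dconst)
qed (simp add: lookup_implicit dconst_def)

lemma Max_appearing_implicit:
  assumes P: "total_degree P \<le> 1" and Q: "total_degree Q \<le> 1" and m: "pair_order P Q m"
  shows "Max (appearing () (implicit_poly w P Q)) = m"
proof -
  have app: "k \<in> appearing () (implicit_poly w P Q) \<longleftrightarrow> coeff (linear_part P) k \<noteq> 0 \<or> coeff (linear_part Q) k \<noteq> 0" for k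
  proof -
    have "Poly_Mapping.keys (implicit_poly w P Q) = Poly_Mapping.keys P \<union> Poly_Mapping.keys Q"
      by (auto simp: in_keys_iff lookup_implicit_eq_0)
    then have "appearing () (implicit_poly w P Q) = appearing () P \<union> appearing () Q"
      by (auto simp: appearing_def)
    then show ?thesis by (simp add: appearing_linear[OF P] appearing_linear[OF Q])
  qed
  have sub: "appearing () (implicit_poly w P Q) \<subseteq> {..m}"
    using m app by (auto simp: pair_order_def not_le[symmetric])
  have "finite (appearing () (implicit_poly w P Q))" by (rule finite_subset[OF sub]) simp
  then show ?thesis using m app sub by (intro Max_eqI) (auto simp: pair_order_def)
qed

text \<open>
  The Leibniz rule for $\delta^n(w Q - P)$. The term with $w^{(n)}$ is set apart, because the highest
  derivative of \<open>w\<close> in the resultant comes from it.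
\<close>

lemma lookup_implicit_deriv:
  fixes P Q :: "'f::field_char_0 udpoly"
  assumes d: "derivation d" and m: "m = 0 \<or> (\<exists>k. m = dmon () k)"
  shows "Poly_Mapping.lookup ((dpoly_deriv (dpoly_deriv d) ^^ n) (implicit_poly w P Q)) m =
     dvar w n * dconst (Poly_Mapping.lookup Q m) +
     ((\<Sum>k<n. of_nat (n choose k) * dvar w k * dconst (Poly_Mapping.lookup ((dpoly_deriv d ^^ (n - k)) Q) m)) -
      dconst (Poly_Mapping.lookup ((dpoly_deriv d ^^ n) P) m))"
proof -
  let ?D = "dpoly_deriv (dpoly_deriv d) :: 'f xydpoly udpoly \<Rightarrow> _"
  let ?M = "Poly_Mapping.map dconst :: 'f udpoly \<Rightarrow> 'f xydpoly udpoly"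
  note d' = derivation_dpoly_deriv[OF d]
  note D = derivation_dpoly_deriv[OF d']
  have map: "Poly_Mapping.lookup ((?D ^^ n) (?M H)) 0 = dconst (Poly_Mapping.lookup ((dpoly_deriv d ^^ n) H) 0) \<and>
    (\<forall>k. Poly_Mapping.lookup ((?D ^^ n) (?M H)) (dmon () k) = dconst (Poly_Mapping.lookup ((dpoly_deriv d ^^ n) H) (dmon () k)))" for n H
  proof (induction n)
    case (Suc n)
    have add: "dconst (a + b) = dconst a + dconst b" for a b :: 'f by (simp add: dconst_def single_add)
    have z: "dconst (0::'f) = 0" by (simp add: dconst_def)
    show ?case using Suc
      by (auto simp: lookup_dpoly_deriv_zero[OF d'] lookup_dpoly_deriv_zero[OF d] lookup_dpoly_deriv_dmon[OF d']
          lookup_dpoly_deriv_dmon[OF d] dpoly_deriv_dconst[OF d] add z split: nat.splits)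
  qed (simp add: lookup_map_dconst)
  have map': "Poly_Mapping.lookup ((?D ^^ n) (?M H)) m = dconst (Poly_Mapping.lookup ((dpoly_deriv d ^^ n) H) m)" for n H
    using map m by auto
  have Dc: "(?D ^^ k) (dconst (dvar w 0)) = dconst (dvar w k)" for k
    by (induction k) (auto simp: dpoly_deriv_dconst[OF d'] dpoly_deriv_dvar[OF d])
  have on: "of_nat a * p = dconst (of_nat a) * p" for a and p :: "'f xydpoly udpoly"
    by (simp add: dconst_def)
  have "(?D ^^ n) (implicit_poly w P Q) =
     (\<Sum>k\<le>n. of_nat (n choose k) * dconst (dvar w k) * (?D ^^ (n - k)) (?M Q)) - (?D ^^ n) (?M P)"
    unfolding implicit_poly_def derivation_funpow_diff[OF D] derivation_funpow_mult[OF D] Dc ..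
  also have "{..n} = insert n {..<n}" by auto
  finally show ?thesis
    by (simp add: lookup_minus lookup_add lookup_sum on lookup_dconst_mult mult.assoc map')
       (simp add: map'[of 0, simplified] add_diff_eq)
qed

section \<open>Linear parametrizations and properness\<close>

context generic_point
begin

definition op_part :: "'f udpoly \<Rightarrow> 'e poly" where "op_part H = map_poly \<iota> (linear_part H)"

lemma coeff_op_part: "coeff (op_part H) k = \<iota> (Poly_Mapping.lookup H (dmon () k))"
  by (simp add: op_part_def coeff_map_poly is_homD[OF \<iota>] coeff_linear_part)

lemma op_part_deriv: "op_part (dpoly_deriv d H) = delta_comp dE (op_part H)"
  by (rule poly_eqI)
     (simp add: coeff_op_part coeff_delta_comp[OF dE] lookup_dpoly_deriv_dmon[OF d] is_homD[OF \<iota>] \<iota>_d split: nat.splits)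

lemma op_part_deriv_funpow: "op_part ((dpoly_deriv d ^^ n) H) = (delta_comp dE ^^ n) (op_part H)"
  by (induction n) (auto simp: op_part_deriv)

lemma degree_op_part_le: "(\<And>k. m < k \<Longrightarrow> coeff (linear_part H) k = 0) \<Longrightarrow> Polynomial.degree (op_part H) \<le> m"
  by (rule degree_le) (auto simp: coeff_op_part coeff_linear_part is_homD[OF \<iota>])

lemma grad_dvar: "grad (dvar () k) = monom 1 k"
proof (induction k)
  case (Suc k)
  have "grad (dvar () (Suc k)) = delta_comp dE (grad (dvar () k))"
    by (simp flip: grad_simps(5) add: dpoly_deriv_dvar[OF d])
  also have "\<dots> = monom 1 (Suc k)"
    unfolding Suc by (rule poly_eqI) (auto simp: coeff_delta_comp[OF dE] derivation_one[OF dE] derivation_zero[OF dE] split: nat.splits)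
  finally show ?case .
qed (simp add: grad_simps monom_0 one_pCons)

lemma
  assumes H: "total_degree H \<le> 1"
  shows ev_linear: "ev H = op_apply dE u (op_part H) + \<iota> (Poly_Mapping.lookup H 0)"
    and grad_linear: "grad H = op_part H"
proof -
  let ?n = "Polynomial.degree (linear_part H)"
  let ?S = "\<lambda>n. \<Sum>k<n. dconst (coeff (linear_part H) k) * dvar () k"
  have dec: "H = dconst (Poly_Mapping.lookup H 0) + ?S (Suc ?n)"
    using linear_decomp[OF H order_refl] by (simp only: lessThan_Suc_atMost)
  have S: "grad (?S n) = (\<Sum>k<n. Polynomial.smult (\<iota> (coeff (linear_part H) k)) (monom 1 k))" for n
  proof (induction n)
    case 0
    have "grad 0 = grad (dconst 0)" by (simp add: dconst_def)
    then show ?case by (simp add: grad_simps)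
  qed (simp add: grad_simps ev_simps grad_dvar)
  have "Polynomial.degree (op_part H) \<le> ?n" by (rule degree_op_part_le) (simp add: coeff_eq_0)
  then have "op_apply dE u (op_part H) = (\<Sum>k\<le>?n. coeff (op_part H) k * (dE ^^ k) u)"
    by (rule op_apply_eq_sum[OF dE])
  then show "ev H = op_apply dE u (op_part H) + \<iota> (Poly_Mapping.lookup H 0)"
    by (subst dec) (simp add: is_homD[OF is_hom_ev] ev_simps coeff_op_part coeff_linear_part lessThan_Suc_atMost del: sum.lessThan_Suc)
  show "grad H = op_part H"
  proof (rule poly_eqI)
    fix i
    have "coeff (grad H) i = (\<Sum>k<Suc ?n. if k = i then \<iota> (coeff (linear_part H) k) else 0)"
      by (subst dec) (simp add: grad_simps S coeff_sum if_distrib del: sum.lessThan_Suc cong: if_cong)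
    also have "\<dots> = \<iota> (coeff (linear_part H) i)"
      by (cases "i \<le> ?n") (auto simp: coeff_eq_0 is_homD[OF \<iota>] simp del: sum.lessThan_Suc)
    finally show "coeff (grad H) i = coeff (op_part H) i" by (simp add: coeff_op_part coeff_linear_part)
  qed
qed

text \<open>
  This identifies the operator $x_0 q - p$ with the differential of $x_0 = P/Q$, up to a factor.
\<close>

lemma has_diff_quotient:
  assumes P: "total_degree P \<le> 1" and Q: "total_degree Q \<le> 1" "ev Q \<noteq> 0"
  shows "has_diff (ev P / ev Q) (Polynomial.smult (- 1 / ev Q) (Polynomial.smult (ev P / ev Q) (op_part Q) - op_part P))"
  unfolding has_diff_def using Q(2)
  by (intro exI[of _ P] exI[of _ Q]) (simp add: grad_linear[OF P] grad_linear[OF Q(1)] field_simps)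

text \<open>
  If $P/Q$ were a constant, then $Q$ would divide $P$, hence be a unit, and both would have order
  $-\infty$.
\<close>

lemma rational_not_constant:
  assumes P: "total_degree P \<le> 1" and Q: "total_degree Q \<le> 1" "Q \<noteq> 0" and co: "dcoprime P Q" and m: "pair_order P Q m"
  shows "ev P / ev Q \<notin> range \<iota>"
proof
  assume "ev P / ev Q \<in> range \<iota>"
  then obtain c where "ev P / ev Q = \<iota> c" by blast
  moreover have "ev Q \<noteq> 0" using ev_eq_0 Q(2) by blast
  ultimately have "ev P = \<iota> c * ev Q" by (simp add: field_simps)
  then have "ev (P - dconst c * Q) = 0" by (simp add: ev_simps)
  then have eq: "P = dconst c * Q" using ev_eq_0 by fastforce
  then have "Q dvd 1" using co unfolding dcoprime_def by auto
  then have "linear_part Q = 0" by (rule linear_unit[OF Q(1)])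
  then have "coeff (linear_part P) k = 0" for k
    unfolding eq by (auto simp: coeff_linear_part lookup_dconst_mult poly_eq_iff)
  then show False using m \<open>linear_part Q = 0\<close> by (auto simp: pair_order_def)
qed

end

locale linear_curve = generic_point d dE \<iota> u
  for d :: "'f::field_char_0 \<Rightarrow> 'f" and dE :: "'e::field_char_0 \<Rightarrow> 'e" and \<iota> u +
  fixes P1 Q1 P2 Q2 :: "'f udpoly" and m1 m2 :: nat
  assumes P1: "total_degree P1 \<le> 1" and Q1: "total_degree Q1 \<le> 1" "Q1 \<noteq> 0" "dcoprime P1 Q1" "pair_order P1 Q1 m1"
    and P2: "total_degree P2 \<le> 1" and Q2: "total_degree Q2 \<le> 1" "Q2 \<noteq> 0" "dcoprime P2 Q2" "pair_order P2 Q2 m2"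
begin

definition "x0 = ev P1 / ev Q1"
definition "y0 = ev P2 / ev Q2"
definition "l1 = Polynomial.smult x0 (op_part Q1) - op_part P1"
definition "l2 = Polynomial.smult y0 (op_part Q2) - op_part P2"

abbreviation "N \<equiv> m1 + m2"
abbreviation "n \<equiv> m1 + m2 + 2"

lemma denominators_nonzero: "ev Q1 \<noteq> 0" "ev Q2 \<noteq> 0" using ev_eq_0 Q1 Q2 by auto

lemma x0_y0: "x0 \<notin> range \<iota>" "y0 \<notin> range \<iota>"
  unfolding x0_def y0_def by (rule rational_not_constant P1 Q1 P2 Q2)+

text \<open>
  The coefficients $x q - p$ with $p, q$ in $\mathcal{F}$ vanish only if $p$ and $q$ do, since $x$ is
  not in $\mathcal{F}$.
\<close>

lemma degree_combination:
  assumes x: "x \<notin> range \<iota>" and m: "pair_order P Q m"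
  shows "Polynomial.degree (Polynomial.smult x (op_part Q) - op_part P) = m" "Polynomial.smult x (op_part Q) - op_part P \<noteq> 0"
proof -
  have c: "coeff (Polynomial.smult x (op_part Q) - op_part P) k = x * \<iota> (coeff (linear_part Q) k) - \<iota> (coeff (linear_part P) k)" for k
    by (simp add: coeff_op_part coeff_linear_part)
  have inj: "\<iota> a = 0 \<Longrightarrow> a = 0" for a
    using is_homD(1,3)[OF \<iota>] by (metis field_class.field_inverse mult_eq_0_iff mult_zero_left one_neq_zero mult.commute)
  have top: "coeff (Polynomial.smult x (op_part Q) - op_part P) m \<noteq> 0"
  proof
    assume "coeff (Polynomial.smult x (op_part Q) - op_part P) m = 0"
    then have e: "x * \<iota> (coeff (linear_part Q) m) = \<iota> (coeff (linear_part P) m)" unfolding c by simp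
    show False
    proof (cases "coeff (linear_part Q) m = 0")
      case True
      then show False using e m inj by (auto simp: pair_order_def is_homD[OF \<iota>])
    next
      case False
      have "x = \<iota> (coeff (linear_part P) m * inverse (coeff (linear_part Q) m))"
      proof -
        have "x = x * \<iota> (coeff (linear_part Q) m * inverse (coeff (linear_part Q) m))" using False by (simp add: is_homD(1)[OF \<iota>])
        then show ?thesis by (simp add: is_homD(3)[OF \<iota>] mult.assoc[symmetric] e del: right_inverse)
      qed
      then show False using x by blast
    qed
  qed
  have le: "Polynomial.degree (Polynomial.smult x (op_part Q) - op_part P) \<le> m"
    using m by (intro degree_le) (simp only: c pair_order_def, simp add: is_homD[OF \<iota>])
  show "Polynomial.degree (Polynomial.smult x (op_part Q) - op_part P) = m"
    using le le_degree[OF top] by (rule antisym)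
  show "Polynomial.smult x (op_part Q) - op_part P \<noteq> 0"
    using top by (metis coeff_0)
qed

lemma l_degree: "Polynomial.degree l1 = m1" "l1 \<noteq> 0" "Polynomial.degree l2 = m2" "l2 \<noteq> 0"
  unfolding l1_def l2_def by (rule degree_combination x0_y0 Q1 Q2)+

definition K where "K = adjoin \<iota> dE {x0, y0}"
abbreviation "J \<equiv> left_ideal dE UNIV l1 l2"

lemma K_closed: "dsubfield dE K" "x0 \<in> K" "y0 \<in> K" "\<iota> c \<in> K"
  unfolding K_def using dsubfield_adjoin[of dE \<iota> "{x0, y0}"] adjoin_inc[where \<iota> = \<iota> and dE = dE and S = "{x0, y0}"]
  by (simp_all add: subset_iff)

lemma l_coeffs: "coeffs_in K l1" "coeffs_in K l2"
  unfolding coeffs_in_def l1_def l2_def by (auto simp: coeff_op_part intro!: dsubfieldD[OF K_closed(1)] K_closed)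

lemma J_closed:
  "p \<in> J \<Longrightarrow> q \<in> J \<Longrightarrow> p + q \<in> J" "p \<in> J \<Longrightarrow> q \<in> J \<Longrightarrow> p - q \<in> J"
  "p \<in> J \<Longrightarrow> Polynomial.smult c p \<in> J" "p \<in> J \<Longrightarrow> delta_comp dE p \<in> J" "0 \<in> J" "l1 \<in> J" "l2 \<in> J"
proof -
  note U = dsubfield_UNIV[OF dE]
  show "p \<in> J \<Longrightarrow> q \<in> J \<Longrightarrow> p + q \<in> J" by (rule left_ideal_add[OF dE U])
  show "p \<in> J \<Longrightarrow> q \<in> J \<Longrightarrow> p - q \<in> J" by (rule left_ideal_diff[OF dE U])
  show "p \<in> J \<Longrightarrow> Polynomial.smult c p \<in> J" by (rule left_ideal_smult[OF dE U UNIV_I])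
  show "p \<in> J \<Longrightarrow> delta_comp dE p \<in> J" by (rule left_ideal_delta_comp[OF dE U])
  show "0 \<in> J" "l1 \<in> J" "l2 \<in> J" by (rule left_ideal_gens[OF dE U])+
qed

lemma has_diff_const: "has_diff (\<iota> c) 0"
  using has_diff_ev[of "dconst c"] by (simp add: ev_simps grad_simps)

lemma has_diff_x0_y0:
  "has_diff x0 (Polynomial.smult (- 1 / ev Q1) l1)" "has_diff y0 (Polynomial.smult (- 1 / ev Q2) l2)"
  unfolding x0_def y0_def l1_def l2_def
  by (intro has_diff_quotient P1 Q1 P2 Q2 denominators_nonzero)+

text \<open>
  The differentials of $x_0$ and $y_0$ are multiples of $l_1$ and $l_2$.
\<close>

lemma has_diff_K: "a \<in> K \<Longrightarrow> \<exists>m\<in>J. has_diff a m"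
proof -
  have "dsubfield dE {a. \<exists>m\<in>J. has_diff a m}"
    by (rule dsubfield_diff_in) (auto intro: J_closed)
  moreover have "x0 \<in> {a. \<exists>m\<in>J. has_diff a m}" "y0 \<in> {a. \<exists>m\<in>J. has_diff a m}"
    using has_diff_x0_y0 J_closed by blast+
  moreover have "range \<iota> \<subseteq> {a. \<exists>m\<in>J. has_diff a m}" using has_diff_const J_closed by blast
  ultimately have "K \<subseteq> {a. \<exists>m\<in>J. has_diff a m}" unfolding K_def by (intro adjoin_minimal) auto
  then show "a \<in> K \<Longrightarrow> \<exists>m\<in>J. has_diff a m" by blast
qed

lemma u_in_K_imp_unit: "u \<in> K \<Longrightarrow> 1 \<in> J"
proof -
  assume "u \<in> K"
  then obtain m where m: "m \<in> J" "has_diff u m" using has_diff_K by blast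
  have "has_diff u 1" using has_diff_ev[of "dvar () 0"] by (simp add: ev_simps grad_simps)
  then show ?thesis using m has_diff_unique by metis
qed

text \<open>
  The jet of $u$ is a solution of $x_0 Q_1 - P_1 = 0$ and $y_0 Q_2 - P_2 = 0$; the right-hand sides
  are in $K$.
\<close>

lemma op_apply_l:
  "op_apply dE u l1 = \<iota> (Poly_Mapping.lookup P1 0) - x0 * \<iota> (Poly_Mapping.lookup Q1 0)"
  "op_apply dE u l2 = \<iota> (Poly_Mapping.lookup P2 0) - y0 * \<iota> (Poly_Mapping.lookup Q2 0)"
proof -
  have "op_apply dE u (op_part P1) + \<iota> (Poly_Mapping.lookup P1 0) = x0 * (op_apply dE u (op_part Q1) + \<iota> (Poly_Mapping.lookup Q1 0))"
    "op_apply dE u (op_part P2) + \<iota> (Poly_Mapping.lookup P2 0) = y0 * (op_apply dE u (op_part Q2) + \<iota> (Poly_Mapping.lookup Q2 0))"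
    unfolding ev_linear[OF P1, symmetric] ev_linear[OF Q1(1), symmetric] ev_linear[OF P2, symmetric] ev_linear[OF Q2(1), symmetric]
    using denominators_nonzero by (simp_all add: x0_def y0_def)
  then show "op_apply dE u l1 = \<iota> (Poly_Mapping.lookup P1 0) - x0 * \<iota> (Poly_Mapping.lookup Q1 0)"
    "op_apply dE u l2 = \<iota> (Poly_Mapping.lookup P2 0) - y0 * \<iota> (Poly_Mapping.lookup Q2 0)"
    by (simp_all add: l1_def l2_def op_apply_diff[OF dE] op_apply_smult[OF dE] algebra_simps)
qed

lemma unit_imp_u_in_K: "1 \<in> left_ideal dE K l1 l2 \<Longrightarrow> u \<in> K"
proof -
  assume "1 \<in> left_ideal dE K l1 l2"
  then obtain A B where AB: "1 = op_comp dE A l1 + op_comp dE B l2" "coeffs_in K A" "coeffs_in K B"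
    unfolding left_ideal_def[OF dE] by blast
  have "u = op_apply dE u 1" by (simp add: op_apply_def)
  also have "\<dots> = op_apply dE u (op_comp dE A l1) + op_apply dE u (op_comp dE B l2)"
    by (simp add: AB(1) op_apply_add[OF dE])
  finally have u: "u = op_apply dE u (op_comp dE A l1) + op_apply dE u (op_comp dE B l2)" .
  have f: "a \<in> K \<Longrightarrow> (dE ^^ i) a \<in> K" for a i by (induction i) (auto intro: dsubfieldD[OF K_closed(1)])
  have c: "op_apply dE u (op_comp dE C p) \<in> K" if "coeffs_in K C" "op_apply dE u p \<in> K" for C p
    unfolding op_apply_comp[OF dE] using that f
    by (intro dsubfieldD(10)[OF K_closed(1)] dsubfieldD(4)[OF K_closed(1)]) (auto simp: coeffs_in_def)
  have "op_apply dE u l1 \<in> K" "op_apply dE u l2 \<in> K"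
    unfolding op_apply_l by (auto intro!: dsubfieldD[OF K_closed(1)] K_closed)
  then show "u \<in> K" using c AB by (subst u) (intro dsubfieldD(3)[OF K_closed(1)], auto)
qed

lemma proper_iff: "proper_param \<iota> dE u P1 Q1 P2 Q2 \<longleftrightarrow> u \<in> K"
proof -
  have xy: "rat_val \<iota> dE u P1 Q1 = x0" "rat_val \<iota> dE u P2 Q2 = y0"
    by (simp_all add: rat_val_def x0_def y0_def ev_def)
  note U = dsubfield_adjoin[of dE \<iota> "{u}"]
  have "ev H \<in> adjoin \<iota> dE {u}" if "total_degree H \<le> 1" for H
  proof -
    have "(dE ^^ i) u \<in> adjoin \<iota> dE {u}" for i
      by (induction i) (use adjoin_inc(2)[where \<iota> = \<iota> and dE = dE and S = "{u}"] dsubfieldD[OF U] in auto)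
    then show ?thesis
      unfolding ev_linear[OF that] op_apply_def using adjoin_inc(1)[where \<iota> = \<iota> and dE = dE and S = "{u}"]
      by (intro dsubfieldD(3,10,4)[OF U]) (auto simp: coeff_op_part)
  qed
  from this[OF P1] this[OF Q1(1)] this[OF P2] this[OF Q2(1)]
  have "x0 \<in> adjoin \<iota> dE {u}" "y0 \<in> adjoin \<iota> dE {u}"
    unfolding x0_def y0_def by (blast intro: dsubfieldD(9)[OF U])+
  then have le: "K \<subseteq> adjoin \<iota> dE {u}"
    unfolding K_def using U adjoin_inc(1)[where \<iota> = \<iota> and dE = dE and S = "{u}"] by (intro adjoin_minimal) auto
  show ?thesis
    unfolding proper_param_def xy K_def[symmetric]
  proof
    assume "K = adjoin \<iota> dE {u}"
    then show "u \<in> K" using adjoin_inc(2)[where \<iota> = \<iota> and dE = dE and S = "{u}"] by auto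
  next
    assume "u \<in> K"
    then have "adjoin \<iota> dE {u} \<subseteq> K" using K_closed by (intro adjoin_minimal) auto
    then show "K = adjoin \<iota> dE {u}" using le by blast
  qed
qed

end

section \<open>The highest derivatives in the resultant\<close>

lemma free_of_of_nat: "free_of V (of_nat a)"
  by (induction a) (auto intro: free_of_add)

lemma col_mon_cases: "col_mon N j = 0 \<or> (\<exists>k. col_mon N j = dmon () k)"
  by (simp add: col_mon_def)

context linear_curve
begin

abbreviation "f1 \<equiv> implicit_poly Ix P1 Q1"
abbreviation "f2 \<equiv> implicit_poly Iy P2 Q2"

definition entry :: "'f udpoly \<Rightarrow> nat \<Rightarrow> nat \<Rightarrow> 'f" where
  "entry H i j = Poly_Mapping.lookup ((dpoly_deriv d ^^ i) H) (col_mon N j)"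

definition M :: "nat \<Rightarrow> nat \<Rightarrow> 'f xydpoly" where
  "M i j = Poly_Mapping.lookup (sylv_row (dpoly_deriv d) m1 m2 f1 f2 i) (col_mon N j)"

definition rest :: "indet \<Rightarrow> 'f udpoly \<Rightarrow> 'f udpoly \<Rightarrow> nat \<Rightarrow> nat \<Rightarrow> 'f xydpoly" where
  "rest w P Q i j = (\<Sum>k<i. of_nat (i choose k) * dvar w k * dconst (entry Q (i - k) j)) - dconst (entry P i j)"

lemma M_row1: "i \<le> m2 \<Longrightarrow> M i j = dvar Ix (m2 - i) * dconst (entry Q1 0 j) + rest Ix P1 Q1 (m2 - i) j"
  unfolding M_def sylv_row_def rest_def entry_def using lookup_implicit_deriv[OF d col_mon_cases] by simp

lemma M_row2: "m2 < i \<Longrightarrow> M i j = dvar Iy (N + 1 - i) * dconst (entry Q2 0 j) + rest Iy P2 Q2 (N + 1 - i) j"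
  unfolding M_def sylv_row_def rest_def entry_def using lookup_implicit_deriv[OF d col_mon_cases] by simp

definition "Sx = fdet n (M(0 := \<lambda>j. dconst (entry Q1 0 j)))"
definition "Sy = fdet n (M(Suc m2 := \<lambda>j. dconst (entry Q2 0 j)))"
definition "R = fdet n M"

lemma free_rest: "(\<And>k. k < i \<Longrightarrow> (w, k) \<notin> V) \<Longrightarrow> free_of V (rest w P Q i j)"
  unfolding rest_def by (intro free_of_diff free_of_sum free_of_mult free_of_of_nat free_of_dvar free_of_dconst) auto

lemma free_M1: "i \<le> m2 \<Longrightarrow> (\<And>k. k \<le> m2 - i \<Longrightarrow> (Ix, k) \<notin> V) \<Longrightarrow> free_of V (M i j)"
  by (subst M_row1, assumption) (intro free_of_add free_of_mult free_of_dvar free_of_dconst free_rest; simp)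

lemma free_M2: "m2 < i \<Longrightarrow> (\<And>k. k \<le> N + 1 - i \<Longrightarrow> (Iy, k) \<notin> V) \<Longrightarrow> free_of V (M i j)"
  by (subst M_row2, assumption) (intro free_of_add free_of_mult free_of_dvar free_of_dconst free_rest; simp)

text \<open>
  The derivative $x^{(m_2)}$ occurs only in the row of $f_1^{(m_2)}$, which has index $0$, and
  $y^{(m_1)}$ only in the row of $f_2^{(m_1)}$, which has index $m_2 + 1$.
\<close>

lemma appearing_R: "m2 \<in> appearing Ix R \<longleftrightarrow> Sx \<noteq> 0" "m1 \<in> appearing Iy R \<longleftrightarrow> Sy \<noteq> 0"
proof -
  have "M(0 := \<lambda>j. dvar Ix m2 * dconst (entry Q1 0 j) + rest Ix P1 Q1 m2 j) = M"
    using M_row1[of 0] by (auto simp: fun_eq_iff)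
  moreover have "m2 \<in> appearing Ix (fdet n (M(0 := \<lambda>j. dvar Ix m2 * dconst (entry Q1 0 j) + rest Ix P1 Q1 m2 j))) \<longleftrightarrow>
     fdet n (M(0 := \<lambda>j. dconst (entry Q1 0 j))) \<noteq> 0"
  proof (rule appearing_fdet_iff)
    fix i j assume "i < n" "i \<noteq> 0" "j < n"
    then show "free_of {(Ix, m2)} (M i j)"
      by (cases "i \<le> m2") (rule free_M1 free_M2; auto)+
  qed (auto intro!: free_rest)
  ultimately show "m2 \<in> appearing Ix R \<longleftrightarrow> Sx \<noteq> 0" by (simp add: R_def Sx_def)
  have "M(Suc m2 := \<lambda>j. dvar Iy m1 * dconst (entry Q2 0 j) + rest Iy P2 Q2 m1 j) = M"
    using M_row2[of "Suc m2"] by (auto simp: fun_eq_iff)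
  moreover have "m1 \<in> appearing Iy (fdet n (M(Suc m2 := \<lambda>j. dvar Iy m1 * dconst (entry Q2 0 j) + rest Iy P2 Q2 m1 j))) \<longleftrightarrow>
     fdet n (M(Suc m2 := \<lambda>j. dconst (entry Q2 0 j))) \<noteq> 0"
  proof (rule appearing_fdet_iff)
    fix i j assume "i < n" "i \<noteq> Suc m2" "j < n"
    then show "free_of {(Iy, m1)} (M i j)"
      by (cases "i \<le> m2") (rule free_M1 free_M2; auto)+
  qed (auto intro!: free_rest)
  ultimately show "m1 \<in> appearing Iy R \<longleftrightarrow> Sy \<noteq> 0" by (simp add: R_def Sy_def)
qed

lemma orders_R: "R \<noteq> 0 \<and> dord Ix R = ereal (real m2) \<and> dord Iy R = ereal (real m1) \<longleftrightarrow> Sx \<noteq> 0 \<and> Sy \<noteq> 0"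
proof -
  have "k \<notin> appearing Ix R" if "m2 < k" for k
    unfolding appearing_iff_not_free R_def not_not
  proof (rule free_of_fdet)
    fix i j show "free_of {(Ix, k)} (M i j)"
      using that by (cases "i \<le> m2") (rule free_M1 free_M2; auto)+
  qed
  moreover have "k \<notin> appearing Iy R" if "m1 < k" for k
    unfolding appearing_iff_not_free R_def not_not
  proof (rule free_of_fdet)
    fix i j show "free_of {(Iy, k)} (M i j)"
      using that by (cases "i \<le> m2") (rule free_M1 free_M2; auto)+
  qed
  moreover have "appearing Ix 0 = {}" by (simp add: appearing_def)
  ultimately show ?thesis
    using appearing_R by (auto simp: dord_eq_iff)
qed

lemma dres_eq_R: "dres (dpoly_deriv d) f1 f2 = R"
  unfolding R_def M_def
  by (rule dres_eq_fdet) (simp_all add: Max_appearing_implicit[OF P1 Q1(1,4)] Max_appearing_implicit[OF P2 Q2(1,4)])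

section \<open>Properness implies maximal orders\<close>

text \<open>
  The row of the affine operator with operator part \<open>p\<close> whose constant part is such that it vanishes
  at \<open>u\<close>.
\<close>

definition jet_row :: "'e poly \<Rightarrow> nat \<Rightarrow> 'e" where
  "jet_row p j = (if j \<le> N then coeff p (N - j) else - op_apply dE u p)"

lemma jet_row_add: "jet_row (p + q) j = jet_row p j + jet_row q j"
  by (simp add: jet_row_def op_apply_add[OF dE])

lemma jet_row_smult: "jet_row (Polynomial.smult c p) j = c * jet_row p j"
  by (simp add: jet_row_def op_apply_smult[OF dE])

lemma jet_row_0: "jet_row 0 j = 0" by (simp add: jet_row_def op_apply_0[OF dE])

lemma jet_row_sum: "jet_row (sum f I) j = (\<Sum>i\<in>I. jet_row (f i) j)"
  by (induction I rule: infinite_finite_induct) (auto simp: jet_row_add jet_row_0)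

definition rowop :: "nat \<Rightarrow> 'e poly" where
  "rowop i = (if i \<le> m2 then (delta_comp dE ^^ (m2 - i)) l1 else (delta_comp dE ^^ (N + 1 - i)) l2)"

definition at_curve :: "'f xydpoly \<Rightarrow> 'e" where
  "at_curve = dpoly_eval \<iota> dE (\<lambda>w. case w of Ix \<Rightarrow> x0 | Iy \<Rightarrow> y0)"

lemma is_hom_at_curve: "is_hom at_curve"
  unfolding at_curve_def by (rule is_hom_dpoly_eval[OF \<iota>])

lemma at_curve_simps: "at_curve (dconst c) = \<iota> c" "at_curve (dvar Ix 0) = x0" "at_curve (dvar Iy 0) = y0"
  "at_curve (dpoly_deriv d p) = dE (at_curve p)"
  by (auto simp: at_curve_def dpoly_eval_dconst[OF \<iota>] dpoly_eval_dvar[OF \<iota>] dpoly_eval_deriv[OF \<iota> d dE \<iota>_d])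

text \<open>
  On the curve, the rows of the matrix are the derivatives of $l_1$ and $l_2$, completed such that
  they vanish at $u$. Both sides obey the same recursion in the number of derivations.
\<close>

lemma at_curve_implicit_deriv:
  assumes w: "at_curve (dvar w 0) = z" and l: "l = Polynomial.smult z (op_part Q) - op_part P"
    and ul: "op_apply dE u l = \<iota> (Poly_Mapping.lookup P 0) - z * \<iota> (Poly_Mapping.lookup Q 0)"
  shows "at_curve (Poly_Mapping.lookup ((dpoly_deriv (dpoly_deriv d) ^^ i) (implicit_poly w P Q)) (col_mon N j)) = jet_row ((delta_comp dE ^^ i) l) j"
proof -
  let ?f = "\<lambda>i. (dpoly_deriv (dpoly_deriv d) ^^ i) (implicit_poly w P Q)"
  note d' = derivation_dpoly_deriv[OF d]
  have "at_curve (Poly_Mapping.lookup (?f i) 0) = - op_apply dE u ((delta_comp dE ^^ i) l) \<and>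
    (\<forall>k. at_curve (Poly_Mapping.lookup (?f i) (dmon () k)) = coeff ((delta_comp dE ^^ i) l) k)"
  proof (induction i)
    case 0
    show ?case
      by (simp add: lookup_implicit is_homD[OF is_hom_at_curve] at_curve_simps w ul) (simp add: l coeff_op_part)
  next
    case (Suc i)
    have "dE (- a) = - dE a" for a using derivation_diff[OF dE, of 0 a] by (simp add: derivation_zero[OF dE])
    then show ?case using Suc
      by (auto simp: lookup_dpoly_deriv_zero[OF d'] lookup_dpoly_deriv_dmon[OF d'] at_curve_simps op_apply_delta_comp[OF dE]
          coeff_delta_comp[OF dE] is_homD[OF is_hom_at_curve] split: nat.splits)
  qed
  then show ?thesis by (auto simp: jet_row_def col_mon_def)
qed

lemma at_curve_M: "i < n \<Longrightarrow> at_curve (M i j) = jet_row (rowop i) j"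
  unfolding M_def sylv_row_def rowop_def
  using at_curve_implicit_deriv[OF at_curve_simps(2) l1_def op_apply_l(1)] at_curve_implicit_deriv[OF at_curve_simps(3) l2_def op_apply_l(2)]
  by auto

lemma degree_rowop: "i < n \<Longrightarrow> Polynomial.degree (rowop i) \<le> N"
  using degree_delta_comp_funpow_le[OF dE, of l1 m1 "m2 - i"] degree_delta_comp_funpow_le[OF dE, of l2 m2 "N + 1 - i"] l_degree
  by (auto simp: rowop_def)

text \<open>
  A linear relation between the derivatives of $l_1$ up to order $m_2$ and those of $l_2$ up to order
  $m_1$ is a syzygy. If one of the two highest derivatives is missing, then it is too short.
\<close>

lemma rowop_independent:
  assumes one: "1 \<in> J" and r: "r = 0 \<or> r = Suc m2" and vr: "v r = 0"
    and sum: "(\<Sum>i<n. Polynomial.smult (v i) (rowop i)) = 0" and k: "k < n"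
  shows "v k = 0"
proof -
  define A where "A = (\<Sum>i\<le>m2. monom (v i) (m2 - i))"
  define B where "B = (\<Sum>i\<in>{m2<..<n}. monom (v i) (N + 1 - i))"
  have split: "{..<n} = {..m2} \<union> {m2<..<n}" by auto
  have "op_comp dE A l1 + op_comp dE B l2 = (\<Sum>i\<le>m2. Polynomial.smult (v i) (rowop i)) + (\<Sum>i\<in>{m2<..<n}. Polynomial.smult (v i) (rowop i))"
    unfolding A_def B_def op_comp_sum_left[OF dE] op_comp_monom[OF dE] by (intro arg_cong2[where f = "(+)"] sum.cong) (auto simp: rowop_def)
  also have "\<dots> = (\<Sum>i<n. Polynomial.smult (v i) (rowop i))"
    unfolding split by (rule sum.union_disjoint[symmetric]) auto
  also note sum
  finally have AB: "op_comp dE A l1 + op_comp dE B l2 = 0" .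
  have cA: "coeff A (m2 - i) = v i" if "i \<le> m2" for i
  proof -
    have "coeff A (m2 - i) = (\<Sum>i'\<le>m2. if i' = i then v i' else 0)"
      unfolding A_def coeff_sum by (rule sum.cong) (use that in auto)
    then show ?thesis using that by simp
  qed
  have cB: "coeff B (N + 1 - i) = v i" if "m2 < i" "i < n" for i
  proof -
    have "coeff B (N + 1 - i) = (\<Sum>i'\<in>{m2<..<n}. if i' = i then v i' else 0)"
      unfolding B_def coeff_sum by (rule sum.cong) (use that in auto)
    then show ?thesis using that by simp
  qed
  have dA: "Polynomial.degree A \<le> m2" unfolding A_def
    by (intro degree_sum_le) (auto intro: order_trans[OF degree_monom_le])
  have dB: "Polynomial.degree B \<le> m1" unfolding B_def
    by (intro degree_sum_le) (auto intro: order_trans[OF degree_monom_le])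
  have one': "1 \<in> left_ideal dE UNIV l2 l1"
  proof -
    obtain S T where "op_comp dE S l1 + op_comp dE T l2 = 1" using one unfolding left_ideal_def[OF dE] by auto
    then show ?thesis using left_idealI[OF dE coeffs_in_UNIV[OF dE] coeffs_in_UNIV[OF dE], of T l2 S l1] by (simp add: add.commute)
  qed
  have zero: "A = 0 \<longleftrightarrow> B = 0"
    using AB op_comp_nonzero(1)[OF dE] l_degree op_comp_0_left[OF dE] by (metis add.right_neutral add.left_neutral)
  have "A = 0 \<or> B = 0"
  proof (rule ccontr)
    assume nz: "\<not> ?thesis"
    show False using r
    proof
      assume "r = 0"
      then have "coeff A m2 = 0" using cA[of 0] vr by simp
      then have "Polynomial.degree A < m2" using dA nz by (metis leading_coeff_0_iff le_neq_implies_less)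
      then show False using syzygy_degree[OF dE l_degree(4) one AB] nz l_degree by auto
    next
      assume "r = Suc m2"
      then have "coeff B m1 = 0" using cB[of "Suc m2"] vr by simp
      then have "Polynomial.degree B < m1" using dB nz by (metis leading_coeff_0_iff le_neq_implies_less)
      moreover have "op_comp dE B l2 + op_comp dE A l1 = 0" using AB by (simp add: add.commute)
      ultimately show False using syzygy_degree[OF dE l_degree(2) one', of B A] nz l_degree by auto
    qed
  qed
  then have "A = 0" "B = 0" using zero by auto
  then show "v k = 0" using cA[of k] cB[of k] k by (cases "k \<le> m2") auto
qed

text \<open>
  At $(x_0, y_0)$ the row of $Q$ is the only one that does not vanish on the jet of $u$, so it
  has coefficient $0$ in every relation between the rows.
\<close>

lemma replaced_det_nonzero:
  assumes one: "1 \<in> J" and r: "r = 0 \<or> r = Suc m2" and Q: "total_degree Q \<le> 1" "ev Q \<noteq> 0" "Polynomial.degree (op_part Q) \<le> N"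
  shows "fdet n (M(r := \<lambda>j. dconst (entry Q 0 j))) \<noteq> 0"
proof -
  let ?M = "\<lambda>i j. at_curve ((M(r := \<lambda>j. dconst (entry Q 0 j))) i j)"
  have rn: "r < n" using r by auto
  have "fdet n ?M \<noteq> 0"
  proof (rule fdet_nonzero_if_rows_independent)
    fix v k assume v: "\<And>j. j < n \<Longrightarrow> (\<Sum>i<n. v i * ?M i j) = 0" and k: "k < n"
    let ?op = "\<lambda>i. if i = r then op_part Q else rowop i"
    define p where "p = (\<Sum>i<n. Polynomial.smult (v i) (?op i))"
    \<comment> \<open>the row of $Q$ differs from a row that vanishes at $u$ by the value of $Q$ there\<close>
    have e: "?M i j = jet_row (?op i) j + (if i = r then (if j \<le> N then 0 else ev Q) else 0)" if "i < n" for i j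
      using at_curve_M[OF that] ev_linear[OF Q(1)]
      by (auto simp: at_curve_simps entry_def col_mon_def jet_row_def coeff_op_part)
    have p: "jet_row p j + (if j \<le> N then 0 else v r * ev Q) = 0" if "j < n" for j
    proof -
      have "(\<Sum>i<n. v i * ?M i j) = (\<Sum>i<n. v i * jet_row (?op i) j + (if i = r then v i * (if j \<le> N then 0 else ev Q) else 0))"
        by (rule sum.cong) (auto simp: e algebra_simps simp del: fun_upd_apply)
      also have "\<dots> = jet_row p j + v r * (if j \<le> N then 0 else ev Q)"
        using rn unfolding p_def by (simp add: sum.distrib jet_row_sum jet_row_smult del: sum.lessThan_Suc)
      finally show ?thesis using v[OF that] by auto
    qed
    have "Polynomial.degree p \<le> N" unfolding p_def
      by (intro degree_sum_le) (auto intro!: order_trans[OF degree_smult_le] degree_rowop Q)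
    moreover have "coeff p i = 0" if "i \<le> N" for i
      using p[of "N - i"] that by (simp add: jet_row_def)
    ultimately have p0: "p = 0" by (metis leading_coeff_0_iff)
    then have vr: "v r = 0" using p[of "N + 1"] Q(2) by (simp add: jet_row_0)
    have "(\<Sum>i<n. Polynomial.smult (v i) (rowop i)) = p"
      unfolding p_def by (rule sum.cong) (auto simp: vr)
    then show "v k = 0" using rowop_independent[where v = v and r = r and k = k, OF one r vr _ k] p0 by simp
  qed
  then show ?thesis using fdet_hom[OF is_hom_at_curve, of n "M(r := \<lambda>j. dconst (entry Q 0 j))"]
    is_homD(4)[OF is_hom_at_curve] by force
qed

lemma degree_op_part:
  "Polynomial.degree (op_part P1) \<le> m1" "Polynomial.degree (op_part Q1) \<le> m1" "Polynomial.degree (op_part P2) \<le> m2" "Polynomial.degree (op_part Q2) \<le> m2"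
  by (rule degree_op_part_le; use Q1(4) Q2(4) in \<open>simp add: pair_order_def\<close>)+

lemma proper_imp_orders:
  assumes "1 \<in> J" shows "Sx \<noteq> 0 \<and> Sy \<noteq> 0"
  unfolding Sx_def Sy_def
  using replaced_det_nonzero[OF assms, of 0 Q1] replaced_det_nonzero[OF assms, of "Suc m2" Q2] Q1 Q2 denominators_nonzero degree_op_part
  by simp

end

section \<open>Improper parametrizations\<close>

context linear_curve
begin

lemma \<iota>_entry: "\<iota> (entry H i j) = (if j \<le> N then coeff ((delta_comp dE ^^ i) (op_part H)) (N - j) else (dE ^^ i) (\<iota> (Poly_Mapping.lookup H 0)))"
proof (cases "j \<le> N")
  case True
  then show ?thesis by (simp add: entry_def col_mon_def coeff_op_part flip: op_part_deriv_funpow)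
next
  case False
  have "\<iota> (Poly_Mapping.lookup ((dpoly_deriv d ^^ i) H) 0) = (dE ^^ i) (\<iota> (Poly_Mapping.lookup H 0))"
    by (induction i) (auto simp: lookup_dpoly_deriv_zero[OF d] \<iota>_d)
  then show ?thesis using False by (simp add: entry_def col_mon_def)
qed

text \<open>
  The row of the affine operator with operator part \<open>p\<close> and value \<open>e\<close> at \<open>u\<close>. In these coordinates the
  derivation acts on both components separately.
\<close>

definition affine_row :: "'e poly \<Rightarrow> 'e \<Rightarrow> nat \<Rightarrow> 'e" where
  "affine_row p e j = jet_row p j + (if j \<le> N then 0 else e)"

lemma \<iota>_entry_affine_row:
  assumes "total_degree H \<le> 1"
  shows "\<iota> (entry H i j) = affine_row ((delta_comp dE ^^ i) (op_part H)) ((dE ^^ i) (ev H)) j"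
  using ev_linear[OF assms]
  by (auto simp: affine_row_def jet_row_def \<iota>_entry op_apply_delta_comp_funpow[OF dE] derivation_funpow_add[OF dE])

text \<open>
  The entries of the matrix are combinations, with coefficients in $\mathcal{F}\{x,y\}$, of
  coefficients of derivatives of $P_i$ and $Q_i$, which are in $\mathcal{F}$. So it suffices to find
  a common kernel vector for the latter, and a functional replaces a vector over $\mathcal{E}$ by one
  over $\mathcal{F}$.
\<close>

lemma Sy_eq_0_if_kernel:
  assumes k: "k < n" "v k \<noteq> (0 :: 'e)"
    and 1: "\<And>H i. H \<in> {P1, Q1} \<Longrightarrow> i \<le> m2 \<Longrightarrow> (\<Sum>j<n. \<iota> (entry H i j) * v j) = 0"
    and 2: "\<And>H i. H \<in> {P2, Q2} \<Longrightarrow> i \<le> m1 \<Longrightarrow> (\<Sum>j<n. \<iota> (entry H i j) * v j) = 0"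
  shows "Sy = 0"
proof -
  obtain \<psi> where \<psi>: "\<And>x y. \<psi> (x + y) = \<psi> x + \<psi> y" "\<And>c x. \<psi> (\<iota> c * x) = c * \<psi> x" "\<psi> (v k) = 1"
    using exists_functional(1)[OF \<iota> k(2)] by blast
  have \<psi>0: "\<psi> 0 = 0" using \<psi>(1)[of 0 0] by simp
  have \<psi>s: "\<psi> (sum f I) = (\<Sum>i\<in>I. \<psi> (f i))" for f and I :: "nat set"
    by (induction I rule: infinite_finite_induct) (auto simp: \<psi> \<psi>0)
  let ?v = "\<lambda>j. dconst (\<psi> (v j)) :: 'f xydpoly"
  note dc = is_homD[OF is_hom_dconst]
  have ker: "(\<Sum>j<n. dconst (entry H i j) * ?v j) = 0" if "(\<Sum>j<n. \<iota> (entry H i j) * v j) = 0" for H i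
  proof -
    have "(\<Sum>j<n. dconst (entry H i j) * ?v j) = dconst (\<Sum>j<n. entry H i j * \<psi> (v j))"
      by (simp only: dc)
    also have "(\<Sum>j<n. entry H i j * \<psi> (v j)) = \<psi> (\<Sum>j<n. \<iota> (entry H i j) * v j)" by (simp only: \<psi>s \<psi>(2))
    finally show ?thesis by (simp only: that \<psi>0 dc)
  qed
  have comb: "(\<Sum>j<n. (dvar w i * dconst (entry Q 0 j) + rest w P Q i j) * ?v j) = 0"
    if "\<And>H i'. H \<in> {P, Q} \<Longrightarrow> i' \<le> i \<Longrightarrow> (\<Sum>j<n. dconst (entry H i' j) * ?v j) = 0" for w P Q i
  proof -
    have "(\<Sum>j<n. (dvar w i * dconst (entry Q 0 j) + rest w P Q i j) * ?v j) =
      dvar w i * (\<Sum>j<n. dconst (entry Q 0 j) * ?v j) +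
      (\<Sum>k<i. of_nat (i choose k) * dvar w k * (\<Sum>j<n. dconst (entry Q (i - k) j) * ?v j)) -
      (\<Sum>j<n. dconst (entry P i j) * ?v j)"
      unfolding rest_def
      by (subst sum_distrib_left, subst sum_distrib_left, subst sum.swap)
         (simp add: ring_distribs sum.distrib sum_subtractf sum_distrib_right mult.assoc add_diff_eq del: sum.lessThan_Suc)
    then show ?thesis using that by (simp del: sum.lessThan_Suc)
  qed
  show ?thesis unfolding Sy_def
  proof (rule fdet_eq_0_kernel[OF _ k(1), of _ ?v])
    show "?v k dvd 1" by (simp add: \<psi> dc)
    fix i assume i: "i < n"
    consider "i \<le> m2" | "i = Suc m2" | "Suc m2 < i" by linarith
    then show "(\<Sum>j<n. (M(Suc m2 := \<lambda>j. dconst (entry Q2 0 j))) i j * ?v j) = 0"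
    proof cases
      case 1
      then show ?thesis
        using comb[of P1 Q1 "m2 - i" Ix] ker assms(3) by (simp add: M_row1 del: sum.lessThan_Suc)
    next
      case 2
      then show ?thesis using ker assms(4)[of Q2 0] by (simp del: sum.lessThan_Suc)
    next
      case 3
      then have "N + 1 - i \<le> m1" by simp
      then show ?thesis
        using 3 comb[of P2 Q2 "N + 1 - i" Iy] ker assms(4) by (simp add: M_row2 del: sum.lessThan_Suc)
    qed
  qed
qed

lemma sum_affine_row_smult: "(\<Sum>j<n. affine_row (Polynomial.smult c p) (c * e) j * v j) = c * (\<Sum>j<n. affine_row p e j * v j)"
  by (simp add: affine_row_def jet_row_smult sum_distrib_left algebra_simps del: sum.lessThan_Suc) (rule sum.cong, auto simp: algebra_simps)

lemma sum_affine_row_add: "(\<Sum>j<n. affine_row (p + q) (e + e') j * v j) = (\<Sum>j<n. affine_row p e j * v j) + (\<Sum>j<n. affine_row q e' j * v j)"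
  unfolding sum.distrib[symmetric] by (rule sum.cong) (auto simp: affine_row_def jet_row_add algebra_simps)

text \<open>
  An affine operator with operator part $p$ and value $e$ at $u$ is \<open>good\<close> if $(p, e)$ is the sum of
  a multiple of $(\tau, -1)$ and some $(a, 0)$ with $a \in J$. Derivatives of good ones are good as
  $\delta\tau \in J$, and all $P_i, Q_i$ are good. Good ones of order at most $N = m_1 + m_2$ are spanned
  by the $N - g + 1$ rows of $G, \dots, \delta^{N-g} G$ and the row of $\tau$. As $g \ge 1$, these are
  fewer than $N + 2$, so they have a common nonzero kernel vector.
\<close>

lemma Sy_eq_0_if_common_affine_divisor:
  assumes G: "G \<in> J" "0 < Polynomial.degree G" and div: "\<And>a. a \<in> J \<Longrightarrow> \<exists>C. a = op_comp dE C G"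
    and \<tau>: "Polynomial.degree \<tau> < Polynomial.degree G" "delta_comp dE \<tau> \<in> J"
    and q1: "\<tau> - Polynomial.smult (- 1 / ev Q1) (op_part Q1) \<in> J" and q2: "\<tau> - Polynomial.smult (- 1 / ev Q2) (op_part Q2) \<in> J"
  shows "Sy = 0"
proof -
  let ?g = "Polynomial.degree G"
  have G0: "G \<noteq> 0" using G by auto
  obtain C where "l1 = op_comp dE C G" using div J_closed(6) by blast
  then have "C \<noteq> 0" "?g \<le> m1" using op_comp_nonzero(2)[OF dE _ G0, of C] l_degree op_comp_0_left[OF dE] by (cases "C = 0"; simp)+
  then have gN: "?g \<le> N" by simp
  define B where "B i = (if i \<le> N - ?g then affine_row ((delta_comp dE ^^ i) G) 0 else if i = N - ?g + 1 then affine_row \<tau> (- 1) else (\<lambda>_. 0))" for i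
  \<comment> \<open>the last row is zero because $G$ has positive order\<close>
  have "fdet n B = 0"
    by (rule fdet_zero_row[of "N + 1"]) (use G gN in \<open>auto simp: B_def\<close>)
  then obtain v k where v: "k < n" "v k \<noteq> 0" "\<And>i. i < n \<Longrightarrow> (\<Sum>j<n. B i j * v j) = 0"
    using fdet_exists_kernel by blast
  have kG: "(\<Sum>j<n. affine_row ((delta_comp dE ^^ i) G) 0 j * v j) = 0" if "i \<le> N - ?g" for i
    using v(3)[of i] that by (simp add: B_def del: sum.lessThan_Suc)
  have k\<tau>: "(\<Sum>j<n. affine_row \<tau> (- 1) j * v j) = 0"
    using v(3)[of "N - ?g + 1"] G gN by (simp add: B_def del: sum.lessThan_Suc)
  have kJ: "(\<Sum>j<n. affine_row a 0 j * v j) = 0" if a: "a \<in> J" "Polynomial.degree a \<le> N" for a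
  proof -
    obtain C where C: "a = op_comp dE C G" using div a by blast
    have dC: "Polynomial.degree C \<le> N - ?g"
      using op_comp_nonzero(2)[OF dE _ G0, of C] a C by (cases "C = 0") auto
    have "(\<Sum>j<n. affine_row (\<Sum>i<r. Polynomial.smult (coeff C i) ((delta_comp dE ^^ i) G)) 0 j * v j) = 0" if "r \<le> Suc (N - ?g)" for r
      using that
    proof (induction r)
      case 0
      then show ?case by (simp add: affine_row_def jet_row_0)
    next
      case (Suc r)
      have "(\<Sum>j<n. affine_row (\<Sum>i<Suc r. Polynomial.smult (coeff C i) ((delta_comp dE ^^ i) G)) 0 j * v j) =
        (\<Sum>j<n. affine_row (\<Sum>i<r. Polynomial.smult (coeff C i) ((delta_comp dE ^^ i) G)) 0 j * v j) +
        coeff C r * (\<Sum>j<n. affine_row ((delta_comp dE ^^ r) G) 0 j * v j)"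
        using sum_affine_row_add[of "\<Sum>i<r. Polynomial.smult (coeff C i) ((delta_comp dE ^^ i) G)" "Polynomial.smult (coeff C r) ((delta_comp dE ^^ r) G)" 0 0 v]
          sum_affine_row_smult[of "coeff C r" "(delta_comp dE ^^ r) G" 0 v] by simp
      then show ?case using Suc kG[of r] by simp
    qed
    from this[of "Suc (N - ?g)"] show ?thesis
      unfolding C op_comp_eq_sum[OF dE dC] by (simp only: lessThan_Suc_atMost order_refl)
  qed
  define good where "good p e \<longleftrightarrow> (\<exists>a\<in>J. p = Polynomial.smult (- e) \<tau> + a)" for p e
  have good_ker: "(\<Sum>j<n. affine_row p e j * v j) = 0" if "good p e" "Polynomial.degree p \<le> N" for p e
  proof -
    obtain a where a: "a \<in> J" "p = Polynomial.smult (- e) \<tau> + a" using \<open>good p e\<close> unfolding good_def by blast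
    have "Polynomial.degree (Polynomial.smult (- e) \<tau>) \<le> N" using \<tau> gN degree_smult_le[of "- e" \<tau>] by linarith
    then have "Polynomial.degree (p - Polynomial.smult (- e) \<tau>) \<le> N" using that by (intro degree_diff_le)
    moreover have "p - Polynomial.smult (- e) \<tau> = a" using a by simp
    ultimately have "Polynomial.degree a \<le> N" by simp
    then show ?thesis
      using sum_affine_row_add[of "Polynomial.smult (- e) \<tau>" a "(- e) * (- 1)" 0 v] sum_affine_row_smult[of "- e" \<tau> "- 1" v] kJ[OF a(1)] k\<tau>
      by (simp only: a(2)) simp
  qed
  have good_delta_comp: "good (delta_comp dE p) (dE e)" if "good p e" for p e
  proof -
    obtain a where a: "a \<in> J" "p = Polynomial.smult (- e) \<tau> + a" using \<open>good p e\<close> unfolding good_def by blast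
    have "dE (- e) = - dE e" using derivation_diff[OF dE, of 0 e] by (simp add: derivation_zero[OF dE])
    then have "delta_comp dE p = Polynomial.smult (- dE e) \<tau> + (Polynomial.smult (- e) (delta_comp dE \<tau>) + delta_comp dE a)"
      unfolding a(2) by (simp add: delta_comp_add[OF dE] delta_comp_diff[OF dE] delta_comp_smult[OF dE])
    moreover have "Polynomial.smult (- e) (delta_comp dE \<tau>) + delta_comp dE a \<in> J"
      by (rule J_closed(1)[OF J_closed(3)[OF \<tau>(2)] J_closed(4)[OF a(1)]])
    ultimately show ?thesis unfolding good_def by blast
  qed
  have good_funpow: "good ((delta_comp dE ^^ i) p) ((dE ^^ i) e)" if "good p e" for p e i
    by (induction i) (use that good_delta_comp in auto)
  have goodQ: "good (op_part Q) (ev Q)" if "\<tau> - Polynomial.smult (- 1 / ev Q) (op_part Q) \<in> J" "ev Q \<noteq> 0" for Q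
  proof -
    have "Polynomial.smult (ev Q) (\<tau> - Polynomial.smult (- 1 / ev Q) (op_part Q)) \<in> J"
      by (rule J_closed(3)[OF that(1)])
    moreover have "op_part Q = Polynomial.smult (- ev Q) \<tau> + Polynomial.smult (ev Q) (\<tau> - Polynomial.smult (- 1 / ev Q) (op_part Q))"
      using that(2) by (simp add: smult_diff_right smult_add_right)
    ultimately show ?thesis unfolding good_def by blast
  qed
  have goodP: "good (op_part P) (ev P)"
    if "good (op_part Q) (ev Q)" "ev Q \<noteq> 0" "Polynomial.smult (ev P / ev Q) (op_part Q) - op_part P \<in> J" for P Q
  proof -
    obtain a where a: "a \<in> J" "op_part Q = Polynomial.smult (- ev Q) \<tau> + a" using \<open>good (op_part Q) (ev Q)\<close> unfolding good_def by blast
    let ?l = "Polynomial.smult (ev P / ev Q) (op_part Q) - op_part P"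
    have "op_part P = Polynomial.smult (ev P / ev Q) (op_part Q) - ?l" by simp
    also have "\<dots> = Polynomial.smult (- ev P) \<tau> + (Polynomial.smult (ev P / ev Q) a - ?l)"
      unfolding a(2) using that(2) by (simp add: smult_add_right smult_diff_right)
    finally show ?thesis
      unfolding good_def using J_closed(2)[OF J_closed(3)[OF a(1)] that(3)] by blast
  qed
  have gQ: "good (op_part Q1) (ev Q1)" "good (op_part Q2) (ev Q2)" using goodQ q1 q2 denominators_nonzero by blast+
  have gP: "good (op_part P1) (ev P1)" "good (op_part P2) (ev P2)"
    using goodP[OF gQ(1) denominators_nonzero(1)] goodP[OF gQ(2) denominators_nonzero(2)] J_closed(6,7) unfolding l1_def l2_def x0_def y0_def by blast+
  have ker: "(\<Sum>j<n. \<iota> (entry H i j) * v j) = 0"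
    if "total_degree H \<le> 1" "good (op_part H) (ev H)" "Polynomial.degree (op_part H) + i \<le> N" for H i
  proof -
    have "Polynomial.degree ((delta_comp dE ^^ i) (op_part H)) \<le> N"
      using degree_delta_comp_funpow_le[OF dE order_refl, of i "op_part H"] that(3) by simp
    then show ?thesis unfolding \<iota>_entry_affine_row[OF that(1)] by (intro good_ker good_funpow that)
  qed
  show ?thesis
  proof (rule Sy_eq_0_if_kernel[where v = v and k = k, OF v(1,2)])
    fix H i
    show "(\<Sum>j<n. \<iota> (entry H i j) * v j) = 0" if "H \<in> {P1, Q1}" "i \<le> m2"
      using that P1 Q1(1) gP gQ degree_op_part by (intro ker) auto
    show "(\<Sum>j<n. \<iota> (entry H i j) * v j) = 0" if "H \<in> {P2, Q2}" "i \<le> m1"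
      using that P2 Q2(1) gP gQ degree_op_part by (intro ker) auto
  qed
qed

text \<open>
  The relation $P_2 - y_0 Q_2 = \beta (P_1 - x_0 Q_1)$ holds over $\mathcal{E}$. As $1$ and $y_0$ are
  linearly independent over $\mathcal{F}$, functionals that separate them express $P_2$ and $Q_2$
  through $P_1$ and $Q_1$ over $\mathcal{F}$. Then $f_1$, $f_2$ and $Q_2$ are combinations of the two
  rows $f_1$ and $Q_1$.
\<close>

lemma Sy_eq_0_if_proportional:
  assumes \<beta>: "l2 = Polynomial.smult \<beta> l1" and no_unit: "1 \<notin> left_ideal dE K l1 l2"
  shows "Sy = 0"
proof -
  have m: "m1 = m2" using \<beta> l_degree by (cases "\<beta> = 0") auto
  \<comment> \<open>If both orders were $0$, then $l_1$ would be a nonzero constant. Positive order makes the rows of $Q_2$ and of $f_2$ different rows.\<close>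
  have "m1 \<noteq> 0"
  proof
    assume "m1 = 0"
    then obtain c where c: "l1 = [:c:]" using l_degree(1) by (metis degree_eq_zeroE)
    then have "c \<noteq> 0" "c \<in> K" using l_degree(2) l_coeffs(1) by (auto simp: coeffs_in_def) (metis coeff_pCons_0)
    then have "Polynomial.smult (inverse c) l1 \<in> left_ideal dE K l1 l2"
      by (intro left_ideal_smult[OF dE K_closed(1)] left_ideal_gens[OF dE K_closed(1)] dsubfieldD[OF K_closed(1)])
    moreover have "Polynomial.smult (inverse c) l1 = 1" using c \<open>c \<noteq> 0\<close> by (simp add: one_pCons)
    ultimately show False using no_unit by simp
  qed
  have rel: "y0 * \<iota> (entry Q2 0 j) - \<iota> (entry P2 0 j) = \<beta> * (x0 * \<iota> (entry Q1 0 j) - \<iota> (entry P1 0 j))" for j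
  proof (cases "j \<le> N")
    case True
    have "coeff l2 (N - j) = \<beta> * coeff l1 (N - j)" by (simp add: \<beta>)
    then show ?thesis using True by (simp add: l1_def l2_def \<iota>_entry)
  next
    case False
    have "op_apply dE u l2 = \<beta> * op_apply dE u l1" by (simp add: \<beta> op_apply_smult[OF dE])
    then show ?thesis using False by (simp add: op_apply_l \<iota>_entry algebra_simps)
  qed
  have split: "\<psi> y0 * entry Q2 0 j - \<psi> 1 * entry P2 0 j = \<psi> (\<beta> * x0) * entry Q1 0 j - \<psi> \<beta> * entry P1 0 j"
    if \<psi>: "\<And>x y. \<psi> (x + y) = \<psi> x + \<psi> y" "\<And>c x. \<psi> (\<iota> c * x) = c * \<psi> x" for \<psi> j
  proof -
    have \<psi>d: "\<psi> (x - y) = \<psi> x - \<psi> y" for x y using \<psi>(1)[of "x - y" y] by simp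
    have "\<iota> (entry Q2 0 j) * y0 - \<iota> (entry P2 0 j) * 1 = \<iota> (entry Q1 0 j) * (\<beta> * x0) - \<iota> (entry P1 0 j) * \<beta>"
      using rel[of j] by (simp add: algebra_simps)
    then have "\<psi> (\<iota> (entry Q2 0 j) * y0 - \<iota> (entry P2 0 j) * 1) = \<psi> (\<iota> (entry Q1 0 j) * (\<beta> * x0) - \<iota> (entry P1 0 j) * \<beta>)"
      by (rule arg_cong)
    then show ?thesis by (simp only: \<psi>d \<psi>(2)) (simp add: mult.commute)
  qed
  obtain \<phi> where \<phi>: "\<And>x y. \<phi> (x + y) = \<phi> x + \<phi> y" "\<And>c x. \<phi> (\<iota> c * x) = c * \<phi> x" "\<phi> 1 = (1::'f)" "\<phi> y0 = 0"
    using exists_functional(2)[OF \<iota> x0_y0(2), of 1 0] by blast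
  obtain \<psi> where \<psi>: "\<And>x y. \<psi> (x + y) = \<psi> x + \<psi> y" "\<And>c x. \<psi> (\<iota> c * x) = c * \<psi> x" "\<psi> 1 = (0::'f)" "\<psi> y0 = 1"
    using exists_functional(2)[OF \<iota> x0_y0(2), of 0 1] by blast
  have P2c: "entry P2 0 j = \<phi> \<beta> * entry P1 0 j - \<phi> (\<beta> * x0) * entry Q1 0 j" for j
    using split[OF \<phi>(1,2), of j] \<phi>(3,4) by (simp add: algebra_simps)
  have Q2c: "entry Q2 0 j = \<psi> (\<beta> * x0) * entry Q1 0 j - \<psi> \<beta> * entry P1 0 j" for j
    using split[OF \<psi>(1,2), of j] \<psi>(3,4) by simp
  let ?S = "M(Suc m2 := \<lambda>j. dconst (entry Q2 0 j))"
  let ?B = "(M(Suc m2 := \<lambda>j. dconst (entry Q1 0 j)))(N + 1 := \<lambda>_. 0)"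
  \<comment> \<open>$Q_2 = a_1 Q_1 + b_1 f_1$ and $f_2 = a_2 Q_1 + b_2 f_1$\<close>
  define a1 :: "'f xydpoly" where "a1 = dconst (\<psi> (\<beta> * x0)) - dconst (\<psi> \<beta>) * dvar Ix 0"
  define b1 :: "'f xydpoly" where "b1 = dconst (\<psi> \<beta>)"
  define a2 :: "'f xydpoly" where "a2 = dvar Iy 0 * a1 - (dconst (\<phi> \<beta>) * dvar Ix 0 - dconst (\<phi> (\<beta> * x0)))"
  define b2 :: "'f xydpoly" where "b2 = dvar Iy 0 * b1 + dconst (\<phi> \<beta>)"
  note dc = is_homD[OF is_hom_dconst]
  have f1: "M m2 j = dvar Ix 0 * dconst (entry Q1 0 j) - dconst (entry P1 0 j)" for j
    by (simp add: M_row1 rest_def)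
  have f2: "M (N + 1) j = dvar Iy 0 * dconst (entry Q2 0 j) - dconst (entry P2 0 j)" for j
    by (simp add: M_row2 rest_def)
  have row1: "dconst (entry Q2 0 j) = a1 * dconst (entry Q1 0 j) + b1 * M m2 j" for j
    unfolding f1 a1_def b1_def Q2c by (simp add: dc algebra_simps)
  have row2: "M (N + 1) j = a2 * dconst (entry Q1 0 j) + b2 * M m2 j" for j
    unfolding f2 row1 unfolding f1 a2_def b2_def P2c by (simp add: dc algebra_simps)
  define C where "C i k = (if i = Suc m2 then (if k = Suc m2 then a1 else if k = m2 then b1 else 0)
     else if i = N + 1 then (if k = Suc m2 then a2 else if k = m2 then b2 else 0)
     else (if k = i then 1 else 0))" for i k
  have two: "(\<Sum>k<n. (if k = Suc m2 then a else if k = m2 then b else 0) * ?B k j) = a * dconst (entry Q1 0 j) + b * M m2 j" for a b j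
  proof -
    have "(\<Sum>k<n. (if k = Suc m2 then a else if k = m2 then b else 0) * ?B k j) =
       (\<Sum>k<n. (if k = Suc m2 then a * ?B k j else 0) + (if k = m2 then b * ?B k j else 0))"
      by (rule sum.cong) auto
    also have "\<dots> = a * ?B (Suc m2) j + b * ?B m2 j" by (simp add: sum.distrib del: sum.lessThan_Suc fun_upd_apply)
    finally show ?thesis using \<open>m1 \<noteq> 0\<close> by simp
  qed
  show ?thesis unfolding Sy_def
  proof (rule fdet_eq_0_row_span[of n _ C ?B "N + 1"])
    fix i j assume ij: "i < n" "j < n"
    show "?S i j = (\<Sum>k<n. C i k * ?B k j)"
    proof (cases "i = Suc m2 \<or> i = N + 1")
      case True
      then show ?thesis
      proof
        assume "i = Suc m2"
        then show ?thesis unfolding C_def using two[of a1 b1 j] row1[of j] by (simp del: sum.lessThan_Suc fun_upd_apply) simp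
      next
        assume "i = N + 1"
        then show ?thesis unfolding C_def using two[of a2 b2 j] row2[of j] \<open>m1 \<noteq> 0\<close>
          by (simp del: sum.lessThan_Suc fun_upd_apply) simp
      qed
    next
      case False
      then have "(\<Sum>k<n. C i k * ?B k j) = (\<Sum>k<n. if k = i then ?B i j else 0)"
        by (intro sum.cong) (auto simp: C_def)
      also have "\<dots> = ?S i j" using ij False by (simp del: sum.lessThan_Suc)
      finally show ?thesis ..
    qed
  qed auto
qed

text \<open>
  The differential on $K$ satisfies the assumptions of \<open>tangent\<close> with $\kappa_i = -1/Q_i(u)$.
\<close>

lemma not_proper_imp_Sy_eq_0:
  assumes np: "u \<notin> K" shows "Sy = 0"
proof -
  have no_unit: "1 \<notin> left_ideal dE K l1 l2" using unit_imp_u_in_K np by blast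
  show ?thesis
  proof (cases "\<exists>\<beta>. l2 = Polynomial.smult \<beta> l1")
    case True
    then show ?thesis using Sy_eq_0_if_proportional no_unit by blast
  next
    case False
    have hd: "has_diff a (diff_of a)" "diff_of a \<in> J" if "a \<in> K" for a
      using has_diff_K[OF that] diff_of_eq by auto
    have coef: "has_diff (coeff (Polynomial.smult z (op_part Q) - op_part P) i) (Polynomial.smult (\<kappa> * coeff (op_part Q) i) l)"
      if "has_diff z (Polynomial.smult \<kappa> l)" for z \<kappa> l P Q i
    proof -
      have "has_diff (- \<iota> c) 0" for c using has_diff_const[of "- c"] by (simp add: is_homD[OF \<iota>])
      from has_diff_add[OF has_diff_mult[OF has_diff_const that] this]
      show ?thesis by (simp add: coeff_op_part mult.commute)
    qed
    interpret T: tangent dE K diff_of l1 l2 "op_part Q1" "op_part Q2" "- 1 / ev Q1" "- 1 / ev Q2"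
    proof
      fix a b assume ab: "a \<in> K" "b \<in> K"
      show "diff_of (a + b) = diff_of a + diff_of b"
        by (rule diff_of_eq) (intro has_diff_add hd ab)
      show "diff_of (a * b) = Polynomial.smult a (diff_of b) + Polynomial.smult b (diff_of a)"
        by (rule diff_of_eq) (intro has_diff_mult hd ab)
      show "diff_of (dE a) = delta_comp dE (diff_of a)"
        by (rule diff_of_eq) (intro has_diff_deriv hd ab)
      show "diff_of a \<in> J" by (intro hd ab)
    next
      show "diff_of (coeff l1 i) = Polynomial.smult (- 1 / ev Q1 * coeff (op_part Q1) i) l1" for i
        by (rule diff_of_eq, subst (1) l1_def) (rule coef[OF has_diff_x0_y0(1)])
      show "diff_of (coeff l2 i) = Polynomial.smult (- 1 / ev Q2 * coeff (op_part Q2) i) l2" for i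
        by (rule diff_of_eq, subst (1) l2_def) (rule coef[OF has_diff_x0_y0(2)])
    qed (use dE K_closed l_degree l_coeffs denominators_nonzero in auto)
    show ?thesis
      by (rule T.dichotomy[OF no_unit]) (use False Sy_eq_0_if_common_affine_divisor in blast)+
  qed
qed

theorem proper_iff_orders:
  "proper_param \<iota> dE u P1 Q1 P2 Q2 \<longleftrightarrow> R \<noteq> 0 \<and> dord Ix R = ereal (real m2) \<and> dord Iy R = ereal (real m1)"
  unfolding proper_iff orders_R
  using u_in_K_imp_unit proper_imp_orders not_proper_imp_Sy_eq_0 by blast

end

theorem theorem4p10:
  fixes d :: "'f::field_char_0 \<Rightarrow> 'f"
    and dE :: "'e::field_char_0 \<Rightarrow> 'e"
    and \<iota> :: "'f \<Rightarrow> 'e"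
    and u :: 'e
    and P1 Q1 P2 Q2 :: "'f udpoly"
  assumes "universal_extension d dE \<iota>"
    and "diff_transcendental \<iota> dE u"
    and "linear_param \<iota> dE u P1 Q1 P2 Q2"
    and "rat_ord P1 Q1 \<ge> 0"
    and "rat_ord P2 Q2 \<ge> 0"
  shows "proper_param \<iota> dE u P1 Q1 P2 Q2 \<longleftrightarrow>
    (let R = dres (dpoly_deriv d) (implicit_poly Ix P1 Q1) (implicit_poly Iy P2 Q2)
     in R \<noteq> 0 \<and> dord Ix R = rat_ord P2 Q2 \<and> dord Iy R = rat_ord P1 Q1)"
proof -
  have ext: "derivation d" "derivation dE" and hom: "\<iota> \<in> diff_hom (ring_of UNIV) d (ring_of UNIV) dE"
    using assms(1) by (auto simp: universal_extension_def)
  have \<iota>: "is_hom \<iota>" "\<And>c. \<iota> (d c) = dE (\<iota> c)"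
    using hom by (auto simp: diff_hom_def Ring.ring_hom_def ring_of_def is_hom_def)
  have lp: "total_degree P1 \<le> 1" "total_degree Q1 \<le> 1" "Q1 \<noteq> 0" "dcoprime P1 Q1"
    "total_degree P2 \<le> 1" "total_degree Q2 \<le> 1" "Q2 \<noteq> 0" "dcoprime P2 Q2"
    using assms(3) by (auto simp: linear_param_def)
  obtain m1 where m1: "rat_ord P1 Q1 = ereal (real m1)" "pair_order P1 Q1 m1"
    using pair_order_exists[OF lp(1,2) assms(4)] .
  obtain m2 where m2: "rat_ord P2 Q2 = ereal (real m2)" "pair_order P2 Q2 m2"
    using pair_order_exists[OF lp(5,6) assms(5)] .
  interpret linear_curve d dE \<iota> u P1 Q1 P2 Q2 m1 m2
    by unfold_locales (use ext \<iota> assms(2) lp m1 m2 in auto)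
  show ?thesis
    unfolding Let_def dres_eq_R m1(1) m2(1) by (rule proper_iff_orders)
qed

end
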